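(* Let $p$ be a prime and let $n>2$ be an integer. Then the number of orbits of $\mathrm{GL}(2,p)$ acting on the set of irreducible binary forms of degree $n$ over $\mathrm{GF}(p)$ (forms being identified up to non-zero scalar multiples) is $$\frac{1}{|\mathrm{GL}(2,p)|}\,(a+b+c+d),\qquad |\mathrm{GL}(2,p)|=(p^2-1)(p^2-p),$$ where $$a=\frac{p-1}{n}\sum_{t\mid n}\mu(t)\,p^{n/t},$$ $$b=(p-1)(p^2-1)\,B(p,n),$$ $$c=\sum_{e\mid \gcd(n,p-1),\ e\neq 1}\varphi(e)\,\frac{p-1}{2}\,(p^2+p)\,A(p,n,e),$$ $$d=\sum_{e\mid \gcd(n,p+1),\ e\neq 1}\varphi(e)\,\frac{p-1}{2}\,(p^2-p)\,C(p,n,e),$$ and the functions $A$, $B$, $C$ are those defined in the context.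
   Context: A binary form of degree $n$ over a field $F$ is a non-zero homogeneous polynomial $f=\alpha_0x^n+\alpha_1x^{n-1}y+\dots+\alpha_ny^n$ with coefficients in $F$; two binary forms are regarded as identical if one is a (non-zero) scalar multiple of the other. A form is irreducible if it is irreducible as a polynomial in $F[x,y]$. A matrix $g=\begin{pmatrix}a&b\\c&d\end{pmatrix}\in\mathrm{GL}(2,F)$ acts on forms by $fg=f(ax+by,\,cx+dy)$, i.e. $fg=\alpha_0(ax+by)^n+\alpha_1(ax+by)^{n-1}(cx+dy)+\dots+\alpha_n(cx+dy)^n$. Here $F=\mathrm{GF}(p)$ and $\mathrm{GL}(2,p)=\mathrm{GL}(2,\mathrm{GF}(p))$. $\mu$ is the Möbius function and $\varphi$ is Euler's function. All divisors are positive. Definition of $B$: $B(p,n)=0$ if $p\nmid n$, and if $p\mid n$ then $$B(p,n)=\frac{p-1}{n}\sum_{t\mid n,\ p\nmid t}\mu(t)\,p^{n/(pt)}.$$ Definition of $A$ and $C$: for $e\mid n$ with $e>1$ write $\frac{n}{e}=kr$, where $k$ is the largest divisor of $n$ which is coprime to $e$ (so $k$ divides $n/e$). For $e\mid\gcd(n,p-1)$, $e>1$, $$A(p,n,e)=\frac{\varphi(e)}{n}\sum_{t\mid k}\mu(t)\,(p^{kr/t}-1).$$ For $e\mid\gcd(n,p+1)$, $e>1$, $$C(p,n,e)=\frac{\varphi(e)}{n}\sum_{t\mid k}\mu\!\left(\frac{k}{t}\right)\bigl(p^{rt}-1+2(rt \bmod 2)\bigr),$$ where $rt\bmod 2\in\{0,1\}$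 is the remainder of $rt$ on division by 2. *)

theory Defs
  imports
    "HOL-Analysis.Determinants"
    "HOL-Algebra.Group_Action"
    "HOL-Number_Theory.Totient"
    "HOL-Computational_Algebra.Polynomial_Factorial"
    "HOL-Computational_Algebra.Squarefree"
begin

(* F[x,y] is the type 'a poly poly, i.e. F[x][y]. *)

definition const2 :: "'a::comm_ring_1 \<Rightarrow> 'a poly poly"
  where "const2 c = [:[:c:]:]"

definition X2 :: "'a::comm_ring_1 poly poly"
  where "X2 = [:[:0, 1:]:]"

definition Y2 :: "'a::comm_ring_1 poly poly"
  where "Y2 = [:0, 1:]"

definition subst2 :: "'a::comm_ring_1 poly poly \<Rightarrow> 'a poly poly \<Rightarrow> 'a poly poly \<Rightarrow> 'a poly poly"
  where "subst2 f u v = poly (map_poly (\<lambda>q. poly (map_poly const2 q) u) f) v"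

definition binary_form :: "nat \<Rightarrow> 'a::field poly poly \<Rightarrow> bool"
  where "binary_form n f \<longleftrightarrow>
    f \<noteq> 0 \<and> (\<exists>\<alpha>. f = (\<Sum>i\<le>n. const2 (\<alpha> i) * X2 ^ (n - i) * Y2 ^ i))"

definition irreducible_forms :: "nat \<Rightarrow> 'a::field poly poly set"
  where "irreducible_forms n = {f. binary_form n f \<and> irreducible f}"

definition proportional :: "('a::field poly poly \<times> 'a poly poly) set"
  where "proportional = {(f, h). \<exists>c. c \<noteq> 0 \<and> h = const2 c * f}"

definition GL2 :: "('a::field ^ 2 ^ 2) monoid"
  where "GL2 = \<lparr>carrier = {g. invertible g}, monoid.mult = (**), one = mat 1\<rparr>"

definition form_act :: "'a::field ^ 2 ^ 2 \<Rightarrow> 'a poly poly \<Rightarrow> 'a poly poly"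
  where "form_act g f =
    subst2 f (const2 (g $ 1 $ 1) * X2 + const2 (g $ 1 $ 2) * Y2)
             (const2 (g $ 2 $ 1) * X2 + const2 (g $ 2 $ 2) * Y2)"

(* form_act is a right action: form_act (g ** h) f = form_act h (form_act g f).
   The constant orbits is defined for an arbitrary map from the group to self-maps of a set,
   so it gives the orbits of a right action as well. *)
definition form_orbits :: "nat \<Rightarrow> 'a::field poly poly set set set"
  where "form_orbits n =
    orbits GL2 (irreducible_forms n // proportional) (\<lambda>g K. form_act g ` K)"

lemma const2_simps [simp]:
  "const2 0 = 0" "const2 1 = 1" "const2 (a + b) = const2 a + const2 b"
  "const2 (a * b) = const2 a * const2 b"
  by (simp_all add: const2_def one_pCons)

lemma eval_const2:
  fixes u :: "'a::comm_ring_1 poly poly"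
  shows "poly (map_poly const2 (p + q)) u = poly (map_poly const2 p) u + poly (map_poly const2 q) u"
    and "poly (map_poly const2 (monom c k)) u = const2 c * u ^ k"
proof -
  have "map_poly const2 (p + q) = map_poly const2 p + map_poly const2 q"
    by (rule poly_eqI) (simp add: coeff_map_poly)
  then show "poly (map_poly const2 (p + q)) u =
      poly (map_poly const2 p) u + poly (map_poly const2 q) u"
    by simp
qed (simp add: map_poly_monom poly_monom)

lemma subst2_add: "subst2 (f + h) u v = subst2 f u v + subst2 h u v"
proof -
  let ?m = "map_poly (\<lambda>q. poly (map_poly const2 q) u)"
  have "?m (f + h) = ?m f + ?m h"
    by (rule poly_eqI) (simp add: coeff_map_poly eval_const2)
  then show ?thesis
    by (simp add: subst2_def)
qed

lemma subst2_monomial: "subst2 (const2 c * X2 ^ j * Y2 ^ i) u v = const2 c * u ^ j * v ^ i"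
proof -
  have X: "(X2 :: 'a poly poly) ^ j = [:monom 1 j:]"
    by (induction j) (simp_all add: X2_def one_pCons monom_Suc monom_0)
  have Y: "(Y2 :: 'a poly poly) ^ i = monom 1 i"
    by (simp add: Y2_def monom_altdef)
  have "const2 c * X2 ^ j * Y2 ^ i = monom (monom c j) i"
    by (simp add: const2_def X Y smult_monom)
  then show ?thesis
    by (simp add: subst2_def map_poly_monom poly_monom eval_const2)
qed

lemma form_act_binary_form:
  fixes g :: "'a::field ^ 2 ^ 2"
  shows "form_act g (\<Sum>i\<le>n. const2 (\<alpha> i) * X2 ^ (n - i) * Y2 ^ i) =
    (\<Sum>i\<le>n. const2 (\<alpha> i)
       * (const2 (g $ 1 $ 1) * X2 + const2 (g $ 1 $ 2) * Y2) ^ (n - i)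
       * (const2 (g $ 2 $ 1) * X2 + const2 (g $ 2 $ 2) * Y2) ^ i)"
proof -
  have "subst2 (sum f I) u v = (\<Sum>i\<in>I. subst2 (f i) u v)"
    for f :: "nat \<Rightarrow> 'a poly poly" and I u v
  proof (induction I rule: infinite_finite_induct)
    case (insert x F)
    then show ?case by (simp add: subst2_add)
  qed (simp_all add: subst2_def)
  then show ?thesis
    by (simp add: form_act_def subst2_monomial)
qed

definition moebius :: "nat \<Rightarrow> int"
  where "moebius t = (if squarefree t then (- 1) ^ card (prime_factors t) else 0)"

definition B_fun :: "nat \<Rightarrow> nat \<Rightarrow> real"
  where "B_fun p n =
    (if p dvd n
     then (real p - 1) / real n *
       (\<Sum>t | t dvd n \<and> \<not> p dvd t. real_of_int (moebius t) * real p ^ (n div (p * t)))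
     else 0)"

definition coprime_part :: "nat \<Rightarrow> nat \<Rightarrow> nat"
  where "coprime_part n e = Max {k. k dvd n \<and> coprime k e}"

definition A_fun :: "nat \<Rightarrow> nat \<Rightarrow> nat \<Rightarrow> real"
  where "A_fun p n e =
    (let k = coprime_part n e; r = (n div e) div k in
      real (totient e) / real n *
        (\<Sum>t | t dvd k. real_of_int (moebius t) * (real p ^ (k * r div t) - 1)))"

definition C_fun :: "nat \<Rightarrow> nat \<Rightarrow> nat \<Rightarrow> real"
  where "C_fun p n e =
    (let k = coprime_part n e; r = (n div e) div k in
      real (totient e) / real n *
        (\<Sum>t | t dvd k. real_of_int (moebius (k div t)) *
           (real p ^ (r * t) - 1 + 2 * real (r * t mod 2))))"

end

theory Submission
  imports "HOL-Algebra.Algebraic_Closure_Type" Defs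
begin

text \<open>
  Let \<open>F = GF(p)\<close>, let \<open>K\<close> be its algebraic closure and \<open>s(z) = z\<^sup>p\<close> the Frobenius map of \<open>K\<close>. Setting \<open>x = 1\<close>
  turns a binary form into a polynomial in \<open>y\<close>. An irreducible form of degree \<open>n > 1\<close> is determined up to
  a scalar by any of its roots, its roots form one orbit of \<open>s\<close> of length \<open>n\<close>, and every such orbit occurs
  (\<open>irreducible_form_root\<close>, \<open>irreducible_root_form\<close>, \<open>form_with_root\<close>). Matrices act on the roots by Moebius
  maps, which commute with \<open>s\<close> (\<open>form_act_root_class\<close>). By Burnside's lemma it remains to sum, over all
  invertible matrices \<open>g\<close>, the number of points \<open>z\<close> of period \<open>n\<close> under \<open>s\<close> for which \<open>g z\<close> lies in the
  \<open>s\<close>-orbit of \<open>z\<close> (\<open>card_form_orbits_burnside\<close>).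

  Let \<open>e\<close> be the order of \<open>g\<close> modulo scalars. A power of \<open>g\<close> is \<open>x + y g\<close> with \<open>x, y\<close> in \<open>F\<close>, so it is scalar or
  has the same fixed points as \<open>g\<close>; hence all points not fixed by \<open>g\<close> have period \<open>e\<close> under \<open>g\<close>. If \<open>g z\<close> lies in
  the \<open>s\<close>-orbit of \<open>z\<close>, then \<open>e\<close> divides \<open>n\<close>, and \<open>n / e\<close> steps of \<open>s\<close> act on \<open>z\<close> as a power of \<open>g\<close> whose exponent
  is prime to \<open>e\<close>. Moebius inversion over the divisors of \<open>n\<close> prime to \<open>e\<close> reduces the count of points of exact
  period \<open>n\<close> to the number of points on which \<open>u\<close> steps of \<open>s\<close> agree with such a power of \<open>g\<close>
  (\<open>card_translate_in_orbit\<close>).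

  The latter number is easy: for any invertible \<open>h\<close> over \<open>F\<close> the equation \<open>s\<^sup>u z = h z\<close> is separable, and it has
  exactly \<open>p\<^sup>u + 1\<close> solutions on the projective line (\<open>card_frob_eq_mob\<close>). Subtracting the fixed points of
  \<open>g\<close> that are also fixed by \<open>u\<close> steps of \<open>s\<close>, which correspond to eigenvalues of \<open>g\<close> (\<open>card_fixed_points\<close>),
  leaves \<open>p\<^sup>u\<close> for a non-scalar matrix with a double eigenvalue, \<open>p\<^sup>u - 1\<close> for two eigenvalues in \<open>F\<close>, and \<open>p\<^sup>u + 1\<close> or
  \<open>p\<^sup>u - 1\<close>, depending on the parity of \<open>u\<close>, for two conjugate eigenvalues. These are the terms of \<open>B_fun\<close>,
  \<open>A_fun\<close> and \<open>C_fun\<close>; scalar matrices give the first summand of the formula.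

  Finally, \<open>e\<close> is \<open>p\<close> in the case of a double eigenvalue and otherwise the multiplicative order of the quotient of
  the eigenvalues, and the number of matrices with given trace and determinant is \<open>p (p - 1)\<close> plus \<open>p\<close> times
  the number of eigenvalues in \<open>F\<close> (\<open>card_eigen_matrices\<close>). Summing over ordered pairs of eigenvalues counts
  each matrix with distinct eigenvalues twice, whence the factor \<open>(p - 1) / 2\<close>.
\<close>

section \<open>Moebius inversion over divisors\<close>

lemma moebius_mult_prime:
  assumes "prime q" "squarefree t" "\<not> q dvd t"
  shows "squarefree (q * t)" "moebius (q * t) = - moebius t"
proof -
  have [simp]: "t \<noteq> 0" using assms(2) by (rule contrapos_pn) simp
  have "coprime q t" using assms by (simp add: prime_imp_coprime)
  then show *: "squarefree (q * t)"
    using assms by (simp add: squarefree_mult_coprime squarefree_prime)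
  have "prime_factors (q * t) = insert q (prime_factors t)"
    using assms by (simp add: prime_factors_product prime_prime_factors)
  moreover have "q \<notin> prime_factors t" using assms by auto
  ultimately show "moebius (q * t) = - moebius t"
    using * assms by (simp add: moebius_def)
qed

text \<open>
  Multiplication by a fixed prime divisor of \<open>n\<close> pairs off the squarefree divisors and changes the
  sign of the Moebius function.
\<close>
lemma sum_moebius_divisors:
  assumes "n > 0"
  shows "(\<Sum>t | t dvd n. moebius t) = (if n = 1 then 1 else 0)"
proof (cases "n = 1")
  case True
  then show ?thesis by (simp add: moebius_def)
next
  case False
  then obtain q where q: "prime q" "q dvd n" using prime_factor_nat by blast
  define D where "D = {t. t dvd n \<and> squarefree t}"
  define A where "A = {t \<in> D. \<not> q dvd t}"
  have fin: "finite {t. t dvd n}" using assms by simp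
  then have finD: "finite D" by (simp add: D_def)
  have D: "D = A \<union> (\<lambda>t. q * t) ` A"
  proof (intro equalityI subsetI)
    fix t assume t: "t \<in> D"
    show "t \<in> A \<union> (\<lambda>t. q * t) ` A"
    proof (cases "q dvd t")
      case True
      then obtain s where s: "t = q * s" by blast
      have "squarefree s" using t s squarefree_multD(2)[of q s] by (simp add: D_def)
      moreover have "s dvd n" using t s by (auto simp: D_def dest: dvd_mult_right)
      moreover have "\<not> q dvd s"
      proof
        assume "q dvd s"
        then have "q\<^sup>2 dvd t" using s by (simp add: power2_eq_square)
        then show False using t q by (auto simp: D_def squarefree_def)
      qed
      ultimately show ?thesis using s by (auto simp: A_def D_def)
    qed (use t in \<open>auto simp: A_def\<close>)
  next
    fix t assume "t \<in> A \<union> (\<lambda>t. q * t) ` A"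
    then show "t \<in> D"
      using q by (auto simp: A_def D_def moebius_mult_prime(1) prime_imp_coprime intro!: divides_mult)
  qed
  have "(\<Sum>t | t dvd n. moebius t) = (\<Sum>t\<in>D. moebius t)"
    by (rule sum.mono_neutral_right) (use fin in \<open>auto simp: D_def moebius_def\<close>)
  also have "\<dots> = (\<Sum>t\<in>A. moebius t) + (\<Sum>t\<in>(\<lambda>t. q * t) ` A. moebius t)"
    unfolding D by (rule sum.union_disjoint) (use finD in \<open>auto simp: A_def\<close>)
  also have "(\<Sum>t\<in>(\<lambda>t. q * t) ` A. moebius t) = (\<Sum>t\<in>A. moebius (q * t))"
    using q by (subst sum.reindex) (auto simp: inj_on_def)
  also have "\<dots> = - (\<Sum>t\<in>A. moebius t)"
    using q by (simp add: A_def D_def moebius_mult_prime(2) sum_negf flip: sum_negf)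
  finally show ?thesis using False by simp
qed

text \<open>
  The least common multiple of two divisors prime to \<open>e\<close> is again such a divisor, so the largest one
  is a multiple of all the others.
\<close>
lemma coprime_part_props:
  assumes "n > 0"
  shows "coprime_part n e dvd n" "coprime (coprime_part n e) e"
    "t dvd coprime_part n e \<longleftrightarrow> t dvd n \<and> coprime t e"
proof -
  let ?S = "{k. k dvd n \<and> coprime k e}"
  have fin: "finite ?S" using assms by simp
  have ne: "?S \<noteq> {}" by (auto intro: exI[of _ 1])
  have in_S: "coprime_part n e \<in> ?S"
    unfolding coprime_part_def using Max_in[OF fin ne] .
  then show 1: "coprime_part n e dvd n" and 2: "coprime (coprime_part n e) e" by auto
  show "t dvd coprime_part n e \<longleftrightarrow> t dvd n \<and> coprime t e"
  proof
    assume "t dvd n \<and> coprime t e"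
    then have "lcm t (coprime_part n e) \<in> ?S"
      using 1 coprime_divisors[of "lcm t (coprime_part n e)" "t * coprime_part n e" e e] 2
      by (simp add: lcm_least)
    then have "lcm t (coprime_part n e) \<le> coprime_part n e"
      unfolding coprime_part_def using fin by (intro Max_ge) auto
    then show "t dvd coprime_part n e"
      using assms 1 by (metis dvd_lcm1 dvd_lcm2 dvd_imp_le dvd_pos_nat gcd_nat.extremum_strict le_antisym lcm_pos_nat \<open>t dvd n \<and> coprime t e\<close>)
  next
    assume "t dvd coprime_part n e"
    then show "t dvd n \<and> coprime t e"
      using 1 2 by (meson coprime_divisors dvd_refl dvd_trans)
  qed
qed

section \<open>Points that a map moves inside their orbit under another map\<close>

text \<open>
  Divisibility records all return times at once, and gives period 0 to a point that never returns.
\<close>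
definition has_period :: "('b \<Rightarrow> 'b) \<Rightarrow> nat \<Rightarrow> 'b \<Rightarrow> bool"
  where "has_period f n x \<longleftrightarrow> (\<forall>j. (f ^^ j) x = x \<longleftrightarrow> n dvd j)"

lemma funpow_mult_fixed: "(f ^^ a) x = x \<Longrightarrow> (f ^^ (a * l)) x = x"
  by (induction l) (simp_all add: funpow_add)

lemma funpow_add_fixed: "(f ^^ a) x = x \<Longrightarrow> (f ^^ (b + a * l)) x = (f ^^ b) x"
  by (simp add: funpow_add funpow_mult_fixed)

lemma funpow_mod_fixed: "(f ^^ a) x = x \<Longrightarrow> (f ^^ (b mod a)) x = (f ^^ b) x"
  using funpow_add_fixed[of a f x "b mod a" "b div a"] by simp

lemma has_periodI:
  assumes "n > 0" "(f ^^ n) x = x" "\<And>j. 0 < j \<Longrightarrow> j < n \<Longrightarrow> (f ^^ j) x \<noteq> x"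
  shows "has_period f n x"
  unfolding has_period_def
proof (intro allI iffI)
  fix j assume "(f ^^ j) x = x"
  then have "(f ^^ (j mod n)) x = x" using funpow_mod_fixed[OF assms(2)] by simp
  then have "j mod n = 0" using assms by (metis mod_less_divisor neq0_conv)
  then show "n dvd j" by auto
qed (use assms in \<open>auto simp: funpow_mult_fixed\<close>)

lemma has_period_unique: "has_period f n x \<Longrightarrow> has_period f m x \<Longrightarrow> n = m"
  unfolding has_period_def by (metis dvd_antisym dvd_refl)

lemma has_period_exists:
  assumes "n > 0" "(f ^^ n) x = x"
  obtains d where "d > 0" "d dvd n" "has_period f d x"
proof -
  define d where "d = (LEAST d. d > 0 \<and> (f ^^ d) x = x)"
  have d: "d > 0 \<and> (f ^^ d) x = x"
    unfolding d_def by (rule LeastI[of _ n]) (use assms in auto)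
  have "has_period f d x"
    by (rule has_periodI) (use d not_less_Least[of _ "\<lambda>d. d > 0 \<and> (f ^^ d) x = x"] in \<open>auto simp: d_def\<close>)
  with d assms that show thesis by (auto simp: has_period_def)
qed

lemma funpow_eq_iff:
  assumes "has_period f n x" "n > 0"
  shows "(f ^^ a) x = (f ^^ b) x \<longleftrightarrow> [a = b] (mod n)"
proof
  assume "[a = b] (mod n)"
  then show "(f ^^ a) x = (f ^^ b) x"
    using assms funpow_mod_fixed[of n f x] by (metis cong_def dvd_refl has_period_def)
next
  have *: "[a = b] (mod n)" if "(f ^^ a) x = (f ^^ b) x" "a \<le> b" for a b
  proof -
    \<comment> \<open>\<open>k\<close> further steps complete the \<open>a\<close> steps to a multiple of the period\<close>
    define k where "k = a * (n - 1)"
    have "a + k = n * a" using \<open>n > 0\<close> by (cases n) (auto simp: k_def)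
    then have ka: "n dvd a + k" by simp
    have "(f ^^ (k + a)) x = (f ^^ (k + b)) x" using that by (simp add: funpow_add)
    moreover have "(f ^^ (k + a)) x = x" using assms ka by (simp add: has_period_def add.commute)
    ultimately have "n dvd k + b" using assms by (metis has_period_def)
    then have "[k + a = k + b] (mod n)" using ka by (simp add: cong_def add.commute mod_eq_0_iff_dvd dvd_imp_mod_0)
    then show ?thesis by (simp add: cong_add_lcancel_nat)
  qed
  assume "(f ^^ a) x = (f ^^ b) x"
  then show "[a = b] (mod n)"
    using *[of a b] *[of b a] by (metis cong_sym nat_le_linear)
qed

lemma totative_inverse_exists:
  fixes m e :: nat
  assumes "coprime i e" "e > 0"
  obtains j where "j \<in> totatives e" "[i * j = 1] (mod e)"
proof (cases "e = 1")
  case True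
  then show ?thesis using that[of 1] by simp
next
  case False
  obtain x where x: "[i * x = 1] (mod e)" using assms cong_solve_coprime_nat[of i e] by auto
  have cop: "coprime x e" using x by (metis cong_imp_coprime cong_sym coprime_1_left coprime_mult_left_iff)
  then have "x mod e \<in> totatives e"
    using False assms by (auto simp: totatives_def intro!: Nat.gr0I)
  moreover have "[i * (x mod e) = 1] (mod e)" using x by (simp add: cong_def mod_mult_right_eq)
  ultimately show ?thesis using that by blast
qed

text \<open>
  The model is the Frobenius map \<open>f\<close>, the Moebius map \<open>T\<close> of a matrix whose order modulo scalars
  is \<open>e\<close>, and the set \<open>Z\<close> of points that are not fixed by \<open>T\<close>.
\<close>
locale commuting_maps =
  fixes f T :: "'b \<Rightarrow> 'b" and Z :: "'b set" and e :: nat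
  assumes e_pos: "e > 0"
    and f_closed: "x \<in> Z \<Longrightarrow> f x \<in> Z"
    and T_closed: "x \<in> Z \<Longrightarrow> T x \<in> Z"
    and commute: "x \<in> Z \<Longrightarrow> T (f x) = f (T x)"
    and T_period: "x \<in> Z \<Longrightarrow> has_period T e x"
begin

lemma funpow_closed:
  assumes "x \<in> Z" shows "(f ^^ a) x \<in> Z" "(T ^^ a) x \<in> Z"
  by (induction a) (auto simp: assms f_closed T_closed)

lemma funpow_commute1: "x \<in> Z \<Longrightarrow> T ((f ^^ a) x) = (f ^^ a) (T x)"
  by (induction a) (auto simp: commute funpow_closed)

lemma funpow_commute: "x \<in> Z \<Longrightarrow> (T ^^ b) ((f ^^ a) x) = (f ^^ a) ((T ^^ b) x)"
  by (induction b) (auto simp: funpow_commute1 funpow_closed)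

lemma T_funpow_eq_iff: "x \<in> Z \<Longrightarrow> (T ^^ a) x = (T ^^ b) x \<longleftrightarrow> [a = b] (mod e)"
  using funpow_eq_iff T_period e_pos by metis

lemma funpow_transfer:
  assumes "x \<in> Z" "(f ^^ u) x = (T ^^ j) x"
  shows "(f ^^ (u * l)) x = (T ^^ (j * l)) x"
proof (induction l)
  case (Suc l)
  have "(f ^^ (u * Suc l)) x = (f ^^ u) ((T ^^ (j * l)) x)"
    by (simp add: funpow_add Suc)
  also have "\<dots> = (T ^^ (j * l)) ((T ^^ j) x)"
    using assms(1) by (simp add: funpow_commute flip: assms(2))
  also have "\<dots> = (T ^^ (j * l + j)) x" by (simp add: funpow_add)
  finally show ?case by (simp add: add.commute)
qed simp

text \<open>
  If \<open>T x = f\<^sup>i x\<close>, then \<open>T\<close> has order \<open>n / gcd i n\<close> on the orbit of \<open>x\<close>, so this is \<open>e\<close>; a multiple of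
  \<open>i\<close> congruent to \<open>gcd i n\<close> modulo \<open>n\<close> then replaces the unknown exponent \<open>i\<close> by the fixed exponent
  \<open>n / e\<close>.
\<close>
lemma translate_in_orbit_iff:
  assumes x: "x \<in> Z" and per: "has_period f n x" and n: "n > 0"
  shows "(\<exists>i. T x = (f ^^ i) x) \<longleftrightarrow>
    e dvd n \<and> (\<exists>j\<in>totatives e. (f ^^ (n div e)) x = (T ^^ j) x)"
proof
  assume "\<exists>i. T x = (f ^^ i) x"
  then obtain i where i: "(f ^^ i) x = (T ^^ 1) x" by auto
  have pw: "(f ^^ (i * l)) x = (T ^^ l) x" for l
    using funpow_transfer[OF x i, of l] by simp
  have div_iff: "n dvd i * l \<longleftrightarrow> e dvd l" for l
    using pw[of l] per T_period[OF x] by (metis has_period_def)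
  define m where "m = gcd i n"
  define i' where "i' = i div m"
  define n' where "n' = n div m"
  have m: "m > 0" "i = m * i'" "n = m * n'" using n by (auto simp: m_def i'_def n'_def)
  have cop: "coprime i' n'" unfolding i'_def n'_def m_def using n by (intro div_gcd_coprime) auto
  have "n dvd i * l \<longleftrightarrow> n' dvd l" for l
    using m cop by (simp add: mult.assoc coprime_dvd_mult_right_iff coprime_commute)
  then have "n' = e" using div_iff by (metis dvd_antisym dvd_refl)
  then have ed: "e dvd n" and nm: "n div e = m" using m e_pos by auto
  obtain j where j: "j \<in> totatives e" "[i' * j = 1] (mod e)"
    using totative_inverse_exists cop \<open>n' = e\<close> e_pos by blast
  have "[i * j = m] (mod n)"
  proof -
    have "[m * (i' * j) = m * 1] (mod (m * e))"
      using j(2) m(1) by (simp add: cong_def mult_mod_right[symmetric])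
    then show ?thesis using m \<open>n' = e\<close> by (simp add: mult.assoc)
  qed
  then have "(f ^^ (i * j)) x = (f ^^ m) x" using funpow_eq_iff[OF per n] by simp
  then show "e dvd n \<and> (\<exists>j\<in>totatives e. (f ^^ (n div e)) x = (T ^^ j) x)"
    using ed nm pw j by metis
next
  assume "e dvd n \<and> (\<exists>j\<in>totatives e. (f ^^ (n div e)) x = (T ^^ j) x)"
  then obtain j where j: "j \<in> totatives e" "(f ^^ (n div e)) x = (T ^^ j) x" by blast
  obtain j' where j': "[j * j' = 1] (mod e)"
    using j(1) totative_inverse_exists[of j e] e_pos by (auto simp: totatives_def)
  have "(f ^^ (n div e * j')) x = (T ^^ (j * j')) x" using funpow_transfer[OF x j(2)] .
  also have "\<dots> = (T ^^ 1) x" using j' by (simp only: T_funpow_eq_iff[OF x])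
  finally show "\<exists>i. T x = (f ^^ i) x" by (metis funpow_0 funpow.simps(2) One_nat_def comp_apply)
qed

text \<open>
  A solution returns after \<open>e * m\<close> steps of \<open>f\<close>, and \<open>m * l\<close> steps bring it back only if \<open>e\<close> divides \<open>l\<close>.
  The second condition forces the cofactor of its period to be prime to \<open>e\<close>.
\<close>
lemma period_factor:
  assumes x: "x \<in> Z" and m: "m > 0" and cop: "coprime j e" and eq: "(f ^^ m) x = (T ^^ j) x"
  obtains s where "s > 0" "s dvd e * m" "coprime s e" "has_period f (e * m div s) x"
proof -
  have pw: "(f ^^ (m * l)) x = x \<longleftrightarrow> e dvd l" for l
  proof -
    have "(f ^^ (m * l)) x = x \<longleftrightarrow> e dvd j * l"
      using funpow_transfer[OF x eq] T_period[OF x] by (simp add: has_period_def)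
    then show ?thesis using cop by (simp add: coprime_dvd_mult_right_iff coprime_commute)
  qed
  have "(f ^^ (e * m)) x = x" using pw[of e] by (simp add: mult.commute)
  then obtain d where d: "d > 0" "d dvd e * m" "has_period f d x"
    using has_period_exists[of "e * m" f x] m e_pos by auto
  have dl: "d dvd m * l \<longleftrightarrow> e dvd l" for l using pw d by (simp add: has_period_def)
  define g where "g = gcd m d"
  define m' where "m' = m div g"
  define d' where "d' = d div g"
  have g: "g > 0" "m = g * m'" "d = g * d'" using m by (auto simp: g_def m'_def d'_def)
  have cop': "coprime m' d'" unfolding m'_def d'_def g_def using m by (intro div_gcd_coprime) auto
  have "d dvd m * l \<longleftrightarrow> d' dvd l" for l
    using g cop' by (simp add: mult.assoc coprime_dvd_mult_right_iff coprime_commute)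
  then have "d' = e" using dl by (metis dvd_antisym dvd_refl)
  then have "e * m = d * m'" "m' > 0" using g m by auto
  then show thesis
    using that[of m'] d cop' \<open>d' = e\<close> by auto
qed

text \<open>
  Moebius inversion over the cofactor \<open>s\<close> of \<open>period_factor\<close>. For \<open>t\<close> prime to \<open>e\<close>, with inverse \<open>k\<close>
  modulo \<open>e\<close>, the two conditions that \<open>f\<close> to the \<open>m\<close> acts on \<open>x\<close> as \<open>T\<close> to the \<open>j\<close> and that \<open>f\<close> to the
  \<open>n / t\<close> fixes \<open>x\<close> merge into the single equation with exponents \<open>m / t\<close> and \<open>j * k\<close>; the number of its
  solutions is again a value of \<open>c\<close>.
\<close>
lemma card_exact_period_level:
  assumes n: "n = e * m" "m > 0" and cop: "coprime j e"
    and fin: "\<And>u. u > 0 \<Longrightarrow> finite {x \<in> Z. (f ^^ u) x = (T ^^ j) x}"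
    and c: "\<And>u j. u > 0 \<Longrightarrow> coprime j e \<Longrightarrow> card {x \<in> Z. (f ^^ u) x = (T ^^ j) x} = c u"
  shows "int (card {x \<in> Z. has_period f n x \<and> (f ^^ m) x = (T ^^ j) x}) =
    (\<Sum>t | t dvd n \<and> coprime t e. moebius t * int (c (m div t)))"
proof -
  define W where "W = {x \<in> Z. (f ^^ m) x = (T ^^ j) x}"
  define D where "D = {t. t dvd n \<and> coprime t e}"
  have npos: "n > 0" using n e_pos by simp
  have finD: "finite D" using npos by (auto simp: D_def)
  have finW: "finite W" using fin n by (simp add: W_def)
  have ind: "(if has_period f n x then 1 else 0) =
      (\<Sum>t\<in>D. if (f ^^ (n div t)) x = x then moebius t else 0)" if "x \<in> W" for x
  proof -
    have x: "x \<in> Z" "(f ^^ m) x = (T ^^ j) x" using that by (auto simp: W_def)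
    obtain s where s: "s > 0" "s dvd n" "coprime s e" "has_period f (n div s) x"
      unfolding n(1) by (rule period_factor[OF x(1) n(2) cop x(2)])
    have "t dvd s \<longleftrightarrow> t \<in> D \<and> (f ^^ (n div t)) x = x" for t
    proof -
      have "t dvd s \<longleftrightarrow> n div s dvd n div t" if "t dvd n"
      proof -
        from that obtain t' where t': "n = t * t'" by blast
        from s obtain s' where s': "n = s * s'" by blast
        have pos: "s > 0" "s' > 0" "t > 0" "t' > 0" using npos t' s' by (auto intro: Nat.gr0I)
        have "t dvd s \<longleftrightarrow> t * s' dvd s * s'" using pos by simp
        also have "\<dots> \<longleftrightarrow> t * s' dvd t * t'" using t' s' by simp
        also have "\<dots> \<longleftrightarrow> s' dvd t'" using pos by simp
        also have "s' = n div s" using s' pos by simp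
        also have "t' = n div t" using t' pos by simp
        finally show ?thesis .
      qed
      moreover have "t dvd s \<Longrightarrow> t dvd n \<and> coprime t e"
        using s by (meson coprime_divisors dvd_refl dvd_trans)
      ultimately show ?thesis using s by (auto simp: D_def has_period_def)
    qed
    then have "(\<Sum>t\<in>D. if (f ^^ (n div t)) x = x then moebius t else 0) = (\<Sum>t | t dvd s. moebius t)"
      using finD by (simp add: sum.inter_filter[symmetric])
    also have "\<dots> = (if s = 1 then 1 else 0)" using s by (rule_tac sum_moebius_divisors)
    also have "s = 1 \<longleftrightarrow> has_period f n x"
    proof
      assume "has_period f n x"
      then have "n div s = n" by (rule has_period_unique[OF s(4)])
      moreover have "n = s * (n div s)" using s by simp
      ultimately show "s = 1" using npos by simp
    qed (use s in auto)
    finally show ?thesis by simp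
  qed
  have level: "card {x \<in> W. (f ^^ (n div t)) x = x} = c (m div t)" if "t \<in> D" for t
  proof -
    have tc: "coprime t e" and "t dvd n" using that by (auto simp: D_def)
    then have tm: "t dvd m" using n coprime_dvd_mult_right_iff by blast
    define u where "u = m div t"
    have u: "u > 0" "m = u * t" using tm n by (auto simp: u_def elim: dvdE)
    have nt: "n div t = u * e" using n u npos by (cases "t = 0") auto
    obtain k where k: "k \<in> totatives e" "[t * k = 1] (mod e)"
      using totative_inverse_exists tc e_pos by blast
    have kc: "coprime (j * k) e" using k cop by (simp add: totatives_def)
    have "(f ^^ m) x = (T ^^ j) x \<and> (f ^^ (n div t)) x = x \<longleftrightarrow> (f ^^ u) x = (T ^^ (j * k)) x"
      if x: "x \<in> Z" for x
    proof (intro iffI conjI; (elim conjE)?)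
      assume 1: "(f ^^ m) x = (T ^^ j) x" and 2: "(f ^^ (n div t)) x = x"
      have "k \<ge> 1" using k by (simp add: totatives_def)
      then have "t * k \<ge> 1" using tm n by (cases "t = 0") auto
      then obtain l where l: "t * k = 1 + e * l" using k(2)
        by (metis cong_to_1_nat dvdE le_add_diff_inverse)
      have "(f ^^ (m * k)) x = (T ^^ (j * k)) x" using funpow_transfer[OF x 1] .
      moreover have "m * k = u * (t * k)" using u by simp
      then have "m * k = u + n div t * l" unfolding nt l by (simp add: algebra_simps)
      ultimately show "(f ^^ u) x = (T ^^ (j * k)) x" using funpow_add_fixed[OF 2, of u l] by simp
    next
      assume 1: "(f ^^ u) x = (T ^^ (j * k)) x"
      have "(f ^^ m) x = (T ^^ (j * k * t)) x" using funpow_transfer[OF x 1, of t] u by simp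
      moreover have "[j * k * t = j] (mod e)"
        using cong_scalar_left[OF k(2), of j] by (simp add: mult_ac)
      ultimately show "(f ^^ m) x = (T ^^ j) x" using T_funpow_eq_iff[OF x] by simp
      have "(f ^^ (n div t)) x = (T ^^ (j * k * e)) x" using funpow_transfer[OF x 1, of e] nt by simp
      then show "(f ^^ (n div t)) x = x" using T_period[OF x] by (simp add: has_period_def)
    qed
    then have "{x \<in> W. (f ^^ (n div t)) x = x} = {x \<in> Z. (f ^^ u) x = (T ^^ (j * k)) x}"
      by (auto simp: W_def)
    then show ?thesis using c[OF u(1) kc] u_def by simp
  qed
  have "int (card {x \<in> Z. has_period f n x \<and> (f ^^ m) x = (T ^^ j) x}) =
      int (card {x \<in> W. has_period f n x})"
    by (rule arg_cong[where f = "\<lambda>A. int (card A)"]) (auto simp: W_def)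
  also have "\<dots> = (\<Sum>x\<in>W. if has_period f n x then 1 else 0)"
    using finW by (simp add: sum.inter_filter[symmetric])
  also have "\<dots> = (\<Sum>x\<in>W. \<Sum>t\<in>D. if (f ^^ (n div t)) x = x then moebius t else 0)"
    using ind by (rule sum.cong[OF refl])
  also have "\<dots> = (\<Sum>t\<in>D. \<Sum>x\<in>W. if (f ^^ (n div t)) x = x then moebius t else 0)"
    by (rule sum.swap)
  also have "\<dots> = (\<Sum>t\<in>D. moebius t * int (card {x \<in> W. (f ^^ (n div t)) x = x}))"
    using finW by (simp add: sum.inter_filter[symmetric] mult.commute)
  also have "\<dots> = (\<Sum>t\<in>D. moebius t * int (c (m div t)))"
    using level by simp
  finally show ?thesis by (simp add: D_def)
qed

text \<open>
  The exponent \<open>j\<close> of \<open>translate_in_orbit_iff\<close> is unique modulo \<open>e\<close>, so the solutions fall into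
  \<open>totient e\<close> disjoint sets, all of the same size.
\<close>
theorem card_translate_in_orbit:
  assumes n: "n > 0"
    and fin: "\<And>u j. u > 0 \<Longrightarrow> finite {x \<in> Z. (f ^^ u) x = (T ^^ j) x}"
    and c: "\<And>u j. u > 0 \<Longrightarrow> coprime j e \<Longrightarrow> card {x \<in> Z. (f ^^ u) x = (T ^^ j) x} = c u"
  shows "int (card {x \<in> Z. has_period f n x \<and> (\<exists>i. T x = (f ^^ i) x)}) =
    (if e dvd n then int (totient e) *
       (\<Sum>t | t dvd n \<and> coprime t e. moebius t * int (c (n div (e * t)))) else 0)"
proof (cases "e dvd n")
  case True
  then obtain m where m: "n = e * m" "m > 0" using n by (metis dvdE gr0I mult_0_right)
  define S where "S j = {x \<in> Z. has_period f n x \<and> (f ^^ m) x = (T ^^ j) x}" for j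
  have finS: "finite (S j)" for j
    by (rule finite_subset[OF _ fin[of m j]]) (use m in \<open>auto simp: S_def\<close>)
  have "{x \<in> Z. has_period f n x \<and> (\<exists>i. T x = (f ^^ i) x)} = (\<Union>j\<in>totatives e. S j)"
    using translate_in_orbit_iff[OF _ _ n] m e_pos by (auto simp: S_def)
  moreover have "card (\<Union>j\<in>totatives e. S j) = (\<Sum>j\<in>totatives e. card (S j))"
  proof (rule card_UN_disjoint)
    show "\<forall>i\<in>totatives e. \<forall>j\<in>totatives e. i \<noteq> j \<longrightarrow> S i \<inter> S j = {}"
    proof (intro ballI impI)
      fix i j assume ij: "i \<in> totatives e" "j \<in> totatives e" "i \<noteq> j"
      have "\<not> [i = j] (mod e)"
      proof (cases "e = 1")
        case True
        then show ?thesis using ij by simp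
      next
        case False
        then have "i < e" "j < e" using ij e_pos totatives_less by auto
        then show ?thesis using ij by (simp add: cong_def)
      qed
      then show "S i \<inter> S j = {}" using T_funpow_eq_iff by (auto simp: S_def cong_sym_eq)
    qed
  qed (use finS in auto)
  moreover have "int (card (S j)) = (\<Sum>t | t dvd n \<and> coprime t e. moebius t * int (c (m div t)))"
    if "j \<in> totatives e" for j
    unfolding S_def using that m
    by (intro card_exact_period_level) (auto intro: fin c simp: totatives_def)
  ultimately have "int (card {x \<in> Z. has_period f n x \<and> (\<exists>i. T x = (f ^^ i) x)}) =
     int (totient e) * (\<Sum>t | t dvd n \<and> coprime t e. moebius t * int (c (m div t)))"
    by (simp add: totient_def)
  then show ?thesis using True m e_pos by (simp add: div_mult2_eq)
next
  case False
  then have empty: "{x \<in> Z. has_period f n x \<and> (\<exists>i. T x = (f ^^ i) x)} = {}"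
    using translate_in_orbit_iff[OF _ _ n] by auto
  show ?thesis unfolding empty using False by simp
qed

end

section \<open>Separable polynomials and the Frobenius map\<close>

lemma card_roots_separable:
  fixes P :: "'b::alg_closed_field poly"
  assumes "P \<noteq> 0" "\<And>x. poly P x = 0 \<Longrightarrow> poly (pderiv P) x \<noteq> 0"
  shows "card {x. poly P x = 0} = degree P"
proof -
  obtain A where A: "size A = degree P" "P = smult (lead_coeff P) (\<Prod>x\<in>#A. [:- x, 1:])"
    using alg_closed_imp_factorization[OF assms(1)] by blast
  have "count A a \<le> 1" for a
  proof (rule ccontr)
    assume "\<not> count A a \<le> 1"
    then have "count A a \<ge> 2" by simp
    then have "{#a, a#} \<subseteq># A" by (simp add: subseteq_mset_def)
    then obtain B where "A = {#a, a#} + B" by (metis mset_subset_eq_exists_conv)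
    then have "P = [:- a, 1:] * ([:- a, 1:] * smult (lead_coeff P) (\<Prod>x\<in>#B. [:- x, 1:]))"
      using A(2) by simp
    then obtain R where R: "P = [:- a, 1:] * ([:- a, 1:] * R)" by blast
    have "poly P a = 0" "poly (pderiv P) a = 0"
      unfolding R pderiv_mult poly_add poly_mult by simp_all
    then show False using assms(2) by blast
  qed
  then have "A = mset_set (set_mset A)"
    by (intro multiset_eqI) (force simp: count_mset_set' le_Suc_eq simp flip: not_in_iff)
  then have "size A = card (set_mset A)" by (metis size_mset_set)
  moreover have "set_mset A = {x. poly P x = 0}"
  proof -
    have "poly P x = lead_coeff P * (\<Prod>y\<in>#A. x - y)" for x
      by (subst A(2)) (simp add: poly_prod_mset image_mset.compositionality o_def)
    then show ?thesis using assms(1) by auto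
  qed
  ultimately show ?thesis using A(1) by simp
qed

text \<open>
  Over a finite field, 1 plus the product of all linear polynomials \<open>X - a\<close> has no root.
\<close>
lemma infinite_alg_closed: "infinite (UNIV :: 'b::alg_closed_field set)"
proof
  assume fin: "finite (UNIV :: 'b set)"
  define P :: "'b poly" where "P = (\<Prod>a\<in>UNIV. [:- a, 1:]) + 1"
  have "degree (\<Prod>a\<in>(UNIV :: 'b set). [:- a, 1:]) = card (UNIV :: 'b set)"
    by (subst degree_prod_eq_sum_degree) auto
  then have "degree P > 0"
    using fin by (simp add: P_def degree_add_eq_left finite_UNIV_card_ge_0)
  then obtain x where "poly P x = 0" using alg_closed_imp_poly_has_root by blast
  moreover have "poly (\<Prod>a\<in>(UNIV :: 'b set). [:- a, 1:]) x = 0"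
    using fin by (auto simp: poly_prod)
  ultimately show False by (simp add: P_def)
qed

lemma card_power_eq:
  fixes w :: "'b::alg_closed_field"
  assumes "of_nat m \<noteq> (0 :: 'b)" "w \<noteq> 0"
  shows "card {x. x ^ m = w} = m"
proof -
  have m: "m > 0" using assms(1) by (cases m) auto
  define P where "P = monom 1 m + [:- w:]"
  have deg: "degree P = m" using m
    unfolding P_def by (subst degree_add_eq_left) (simp_all add: degree_monom_eq)
  have rt: "poly P x = x ^ m - w" for x by (simp add: P_def poly_monom)
  have "card {x. poly P x = 0} = degree P"
  proof (rule card_roots_separable)
    show "P \<noteq> 0" using deg m by auto
    fix x assume "poly P x = 0"
    then have "x \<noteq> 0" using assms m by (auto simp: rt power_0_left)
    then show "poly (pderiv P) x \<noteq> 0"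
      using assms by (simp add: P_def pderiv_add pderiv_monom pderiv_pCons poly_monom)
  qed
  then show ?thesis by (simp add: rt deg)
qed

text \<open>
  The order is 0 for the zero element and for elements of infinite order.
\<close>
definition mult_order :: "'b::field \<Rightarrow> nat \<Rightarrow> bool"
  where "mult_order w e \<longleftrightarrow> (\<forall>j. w ^ j = 1 \<longleftrightarrow> e dvd j)"

lemma mult_orderD: "mult_order w e \<Longrightarrow> w ^ e = 1"
  by (simp add: mult_order_def)

lemma mult_order_iff_has_period: "mult_order w e \<longleftrightarrow> has_period ((*) w) e 1"
proof -
  have "((*) w ^^ j) 1 = w ^ j" for j by (induction j) auto
  then show ?thesis by (simp add: mult_order_def has_period_def)
qed

lemma mult_order_unique: "mult_order w e \<Longrightarrow> mult_order w e' \<Longrightarrow> e = e'"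
  using has_period_unique by (metis mult_order_iff_has_period)

lemma mult_order_exists:
  assumes "m > 0" "w ^ m = 1"
  obtains e where "e > 0" "e dvd m" "mult_order w e"
proof -
  have "((*) w ^^ j) 1 = w ^ j" for j by (induction j) auto
  then have "((*) w ^^ m) 1 = 1" using assms by simp
  then show thesis using has_period_exists[of m "(*) w" 1] assms that mult_order_iff_has_period by metis
qed

text \<open>
  Summed over the divisors of \<open>e\<close>, the left side counts all \<open>e\<close>-th roots of unity and the right side
  is \<open>e\<close> by \<open>totient_divisor_sum\<close>; induction removes the proper divisors.
\<close>
lemma card_mult_order:
  assumes "of_nat e \<noteq> (0 :: 'b::alg_closed_field)"
  shows "card {w :: 'b. mult_order w e} = totient e"
  using assms
proof (induction e rule: less_induct)
  case (less e)
  have e: "e > 0" using less.prems by (cases e) auto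
  let ?O = "\<lambda>d. {w :: 'b. mult_order w d}"
  have nz: "of_nat d \<noteq> (0 :: 'b)" if "d dvd e" for d using that less.prems by auto
  have fin: "finite (?O d)" if "d dvd e" for d
  proof (rule finite_subset)
    show "?O d \<subseteq> {w. w ^ e = 1}" using that by (auto simp: mult_order_def)
    show "finite {w :: 'b. w ^ e = 1}" using card_power_eq[of e "1 :: 'b"] less.prems e
      by (intro card_ge_0_finite) simp
  qed
  have "e = card {w :: 'b. w ^ e = 1}" using card_power_eq[of e "1 :: 'b"] less.prems by simp
  also have "{w :: 'b. w ^ e = 1} = (\<Union>d\<in>{d. d dvd e}. ?O d)"
    using e by (auto simp: mult_order_def elim: mult_order_exists[OF e])
      (metis mult_order_def mult_order_exists)
  also have "card \<dots> = (\<Sum>d | d dvd e. card (?O d))"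
    by (rule card_UN_disjoint) (use e fin in \<open>auto dest: mult_order_unique\<close>)
  also have "\<dots> = card (?O e) + (\<Sum>d | d dvd e \<and> d \<noteq> e. card (?O d))"
    using e by (subst sum.remove[of _ e]) (auto intro!: arg_cong2[where f = "(+)"] sum.cong)
  also have "(\<Sum>d | d dvd e \<and> d \<noteq> e. card (?O d)) = (\<Sum>d | d dvd e \<and> d \<noteq> e. totient d)"
    using e nz by (intro sum.cong refl less.IH) (auto simp: dvd_imp_le le_neq_implies_less)
  finally have *: "e = card (?O e) + (\<Sum>d | d dvd e \<and> d \<noteq> e. totient d)" .
  have "e = (\<Sum>d | d dvd e. totient d)" by (simp add: totient_divisor_sum)
  also have "\<dots> = totient e + (\<Sum>d | d dvd e \<and> d \<noteq> e. totient d)"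
    using e by (subst sum.remove[of _ e]) (auto intro!: arg_cong2[where f = "(+)"] sum.cong)
  finally show ?case using * by linarith
qed

definition frob :: "'a::{field,finite} alg_closure \<Rightarrow> 'a alg_closure"
  where "frob x = x ^ CARD('a)"

lemma funpow_frob: "(frob ^^ j) (x :: 'a::{field,finite} alg_closure) = x ^ (CARD('a) ^ j)"
  by (induction j) (simp_all add: frob_def flip: power_mult, simp add: mult.commute)

lemma power_card_eq_same: "(x :: 'a::{field,finite}) ^ CARD('a) = x"
proof (cases "x = 0")
  case False
  define P where "P = (\<Prod>y\<in>UNIV - {0 :: 'a}. y)"
  have "bij_betw ((*) x) (UNIV - {0}) (UNIV - {0})"
    by (rule bij_betwI[where g = "\<lambda>y. y / x"]) (use False in auto)
  then have "P = (\<Prod>y\<in>UNIV - {0}. x * y)"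
    unfolding P_def by (rule prod.reindex_bij_betw[symmetric])
  also have "\<dots> = x ^ (CARD('a) - 1) * P"
    by (simp add: P_def prod.distrib card_Diff_singleton)
  finally have "x ^ (CARD('a) - 1) = 1" by (simp add: P_def)
  then show ?thesis using power_minus_mult[of "CARD('a)" x] by simp
qed simp

lemma frob_to_ac [simp]: "frob (to_ac x) = to_ac x"
  by (simp add: frob_def power_card_eq_same flip: to_ac_power)

lemma funpow_frob_to_ac [simp]: "(frob ^^ j) (to_ac x) = to_ac x"
  by (induction j) auto

text \<open>
  The elements of the base field already exhaust the roots of \<open>X\<^sup>q - X\<close>, where \<open>q\<close> is their number.
\<close>
lemma frob_eq_iff: "frob x = x \<longleftrightarrow> x \<in> range to_ac"
proof
  assume *: "frob x = x"
  let ?q = "CARD('a)"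
  have q: "?q > 1" using card_mono[of "UNIV :: 'a set" "{0, 1}"] by simp
  define P :: "'a alg_closure poly" where "P = monom 1 ?q + [:0, - 1:]"
  have "degree ([:0, - 1:] :: 'a alg_closure poly) < degree (monom (1 :: 'a alg_closure) ?q)"
    using q by (simp add: degree_monom_eq)
  then have deg: "degree P = ?q" unfolding P_def by (subst degree_add_eq_left) (simp_all add: degree_monom_eq)
  then have P0: "P \<noteq> 0" using q by auto
  have rt: "poly P y = 0 \<longleftrightarrow> frob y = y" for y by (simp add: P_def poly_monom frob_def)
  have "range to_ac = {y :: 'a alg_closure. poly P y = 0}"
  proof (rule card_subset_eq)
    show "finite {y. poly P y = 0}" using P0 by (rule poly_roots_finite)
    show *: "range to_ac \<subseteq> {y. poly P y = 0}" by (auto simp: rt)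
    have "card {y. poly P y = 0} \<le> ?q" using card_poly_roots_bound[OF P0] deg by simp
    moreover have "card (range to_ac :: 'a alg_closure set) = ?q" by (simp add: card_image inj_to_ac)
    ultimately show "card (range to_ac :: 'a alg_closure set) = card {y. poly P y = 0}"
      using card_mono[OF poly_roots_finite[OF P0] *] by simp
  qed
  then show "x \<in> range to_ac" using * rt by blast
qed auto

lemma frob_mult [simp]: "frob (x * y) = frob x * frob y"
  and frob_divide [simp]: "frob (x / y) = frob x / frob y"
  and frob_power [simp]: "frob (x ^ k) = frob x ^ k"
  and frob_1 [simp]: "frob 1 = 1"
  and frob_0 [simp]: "frob 0 = 0"
  by (simp_all add: frob_def power_mult_distrib power_divide power_commutes flip: power_mult)
    (simp add: mult.commute)

context
  assumes prime_card: "prime CARD('a::{field,finite})"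
begin

lemma CHAR_eq_CARD: "CHAR('a) = CARD('a)"
proof -
  have "(\<Sum>x\<in>(UNIV :: 'a set). x) = (\<Sum>x\<in>UNIV. x + 1)"
    by (rule sum.reindex_bij_witness[of _ "\<lambda>x. x + 1" "\<lambda>x. x - 1"]) auto
  then have "of_nat CARD('a) = (0 :: 'a)" by (simp add: sum.distrib)
  then have "CHAR('a) dvd CARD('a)" by (simp add: of_nat_eq_0_iff_char_dvd)
  then show ?thesis using prime_card CHAR_not_1'[where ?'a = 'a] by (auto simp: prime_nat_iff)
qed

lemma of_nat_ac_eq_0_iff: "of_nat m = (0 :: 'a alg_closure) \<longleftrightarrow> CARD('a) dvd m"
  by (simp add: of_nat_eq_0_iff_char_dvd CHAR_eq_CARD)

lemma funpow_frob_add: "(frob ^^ j) (x + y :: 'a alg_closure) = (frob ^^ j) x + (frob ^^ j) y"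
  unfolding funpow_frob by (rule freshmans_dream') (simp_all add: CHAR_eq_CARD prime_card)

lemma frob_add: "frob (x + y :: 'a alg_closure) = frob x + frob y"
  using funpow_frob_add[of 1] by simp

lemma frob_uminus: "frob (- x :: 'a alg_closure) = - frob x"
  using frob_add[of x "- x"] by (simp add: eq_neg_iff_add_eq_0 add.commute)

lemma frob_diff: "frob (x - y :: 'a alg_closure) = frob x - frob y"
  using frob_add[of x "- y"] by (simp add: frob_uminus)

lemma frob_inj: "frob x = frob y \<longleftrightarrow> x = (y :: 'a alg_closure)"
proof
  assume "frob x = frob y"
  then have "frob (x - y) = 0" by (simp add: frob_diff)
  then show "x = y" by (simp add: frob_def)
qed simp

lemma funpow_frob_inj: "(frob ^^ j) x = (frob ^^ j) y \<longleftrightarrow> x = (y :: 'a alg_closure)"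
  by (induction j) (auto simp: frob_inj)

end

section \<open>Moebius maps over a finite field\<close>

text \<open>
  The matrix with rows \<open>(a, b)\<close> and \<open>(c, d)\<close> sends the column \<open>(x, y)\<close> to \<open>(a x + b y, c x + d y)\<close>;
  this is its effect on \<open>z = y / x\<close>. The map fixes the point at infinity exactly for \<open>b = 0\<close>.
\<close>
definition mob :: "'a \<Rightarrow> 'a \<Rightarrow> 'a \<Rightarrow> 'a \<Rightarrow> 'a::field alg_closure \<Rightarrow> 'a alg_closure"
  where "mob a b c d z = (to_ac c + to_ac d * z) / (to_ac a + to_ac b * z)"

text \<open>
  The zeros are the finite fixed points of the Moebius map.
\<close>
definition quad :: "'a \<Rightarrow> 'a \<Rightarrow> 'a \<Rightarrow> 'a \<Rightarrow> 'a::field alg_closure \<Rightarrow> 'a alg_closure"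
  where "quad a b c d z = to_ac b * z\<^sup>2 + (to_ac a - to_ac d) * z - to_ac c"

lemma to_ac_lin_eq_0:
  assumes "z \<notin> range to_ac" "to_ac a + to_ac b * z = 0"
  shows "a = 0 \<and> b = 0"
proof (cases "b = 0")
  case False
  then have "z = to_ac (- a / b)" using assms(2) by (simp add: field_simps eq_neg_iff_add_eq_0)
  then show ?thesis using assms(1) by blast
qed (use assms in auto)

lemma mob_denom_nonzero:
  assumes "a * d - b * c \<noteq> 0" "z \<notin> range to_ac"
  shows "to_ac a + to_ac b * z \<noteq> 0"
  using to_ac_lin_eq_0[OF assms(2), of a b] assms(1) by auto

lemma mob_notin_base:
  assumes det: "a * d - b * c \<noteq> 0" and z: "z \<notin> range to_ac"
  shows "mob a b c d z \<notin> range to_ac"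
proof
  assume "mob a b c d z \<in> range to_ac"
  then obtain v where "mob a b c d z = to_ac v" by blast
  then have "to_ac c + to_ac d * z = to_ac v * (to_ac a + to_ac b * z)"
    using mob_denom_nonzero[OF assms] by (simp add: mob_def field_simps)
  then have "to_ac (c - v * a) + to_ac (d - v * b) * z = 0" by (simp add: algebra_simps)
  then have "c = v * a" "d = v * b" using to_ac_lin_eq_0[OF z] by fastforce+
  then show False using det by simp
qed

lemma mob_comp:
  assumes "to_ac a' + to_ac b' * z \<noteq> 0"
  shows "mob a b c d (mob a' b' c' d' z) =
    mob (a * a' + b * c') (a * b' + b * d') (c * a' + d * c') (c * b' + d * d') z"
proof -
  define N where "N = to_ac c' + to_ac d' * z"
  define M where "M = to_ac a' + to_ac b' * z"
  have M: "M \<noteq> 0" using assms by (simp add: M_def)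
  have lin: "v + w * (N / M) = (v * M + w * N) / M" for v w
    using M by (simp add: add_divide_distrib)
  have cancel: "(v / M) / (w / M) = v / w" for v w
    using M by simp
  have "mob a b c d (mob a' b' c' d' z) = (to_ac c * M + to_ac d * N) / (to_ac a * M + to_ac b * N)"
    unfolding mob_def N_def[symmetric] M_def[symmetric] lin by (rule cancel)
  then show ?thesis by (simp add: mob_def N_def M_def algebra_simps)
qed

lemma mob_scalar: "a \<noteq> 0 \<Longrightarrow> mob a 0 0 a z = z"
  by (simp add: mob_def)

lemma mob_eq_iff:
  assumes "to_ac a + to_ac b * z \<noteq> 0"
  shows "mob a b c d z = z \<longleftrightarrow> quad a b c d z = 0"
  using assms by (auto simp: mob_def quad_def field_simps power2_eq_square)

lemma mob_inverse:
  assumes "a * d - b * c \<noteq> 0" "z \<notin> range to_ac"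
  shows "mob d (- b) (- c) a (mob a b c d z) = z"
proof -
  have "mob d (- b) (- c) a (mob a b c d z) = mob (a * d - b * c) 0 0 (a * d - b * c) z"
    by (subst mob_comp[OF mob_denom_nonzero[OF assms]]) (simp add: algebra_simps)
  then show ?thesis using assms by (simp add: mob_scalar)
qed

text \<open>
  By the Cayley-Hamilton theorem, the powers of a matrix \<open>g\<close> with trace \<open>t\<close> and determinant \<open>D\<close> are
  \<open>x + y g\<close>; the pairs \<open>(x, y)\<close> form a Lucas sequence.
\<close>
primrec power_coeffs :: "'a::comm_ring_1 \<Rightarrow> 'a \<Rightarrow> nat \<Rightarrow> 'a \<times> 'a" where
  "power_coeffs t D 0 = (1, 0)"
| "power_coeffs t D (Suc j) = (- D * snd (power_coeffs t D j), fst (power_coeffs t D j) + t * snd (power_coeffs t D j))"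

text \<open>
  The left side is the determinant of \<open>x + y g\<close>.
\<close>
lemma power_coeffs_norm:
  "fst (power_coeffs t D j) ^ 2 + fst (power_coeffs t D j) * snd (power_coeffs t D j) * t + D * snd (power_coeffs t D j) ^ 2 = D ^ j"
proof (induction j)
  case (Suc j)
  show ?case unfolding power_Suc Suc[symmetric]
    by (simp add: power2_eq_square algebra_simps)
qed simp

lemma power_coeffs_det:
  fixes a b c d :: "'a::comm_ring_1" and j :: nat
  defines "x \<equiv> fst (power_coeffs (a + d) (a * d - b * c) j)" and "y \<equiv> snd (power_coeffs (a + d) (a * d - b * c) j)"
  shows "(x + y * a) * (x + y * d) - (y * b) * (y * c) = (a * d - b * c) ^ j"
  unfolding power_coeffs_norm[of "a + d" "a * d - b * c" j, symmetric] x_def[symmetric] y_def[symmetric]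
  by (simp add: power2_eq_square algebra_simps)

lemma funpow_mob:
  assumes det: "a * d - b * c \<noteq> 0" and z: "z \<notin> range to_ac"
  shows "(mob a b c d ^^ j) z =
    (let (x, y) = power_coeffs (a + d) (a * d - b * c) j in mob (x + y * a) (y * b) (y * c) (x + y * d) z)"
proof (induction j)
  case 0
  then show ?case by (simp add: mob_scalar)
next
  case (Suc j)
  obtain x y where xy: "power_coeffs (a + d) (a * d - b * c) j = (x, y)" by force
  have "(x + y * a) * (x + y * d) - (y * b) * (y * c) \<noteq> 0"
    using power_coeffs_det[of a d b c j] det by (simp add: xy)
  from mob_denom_nonzero[OF this z] have den: "to_ac (x + y * a) + to_ac (y * b) * z \<noteq> 0" .
  have "(mob a b c d ^^ Suc j) z = mob a b c d (mob (x + y * a) (y * b) (y * c) (x + y * d) z)"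
    using Suc by (simp add: xy)
  also have "\<dots> = mob (a * (x + y * a) + b * (y * c)) (a * (y * b) + b * (x + y * d))
      (c * (x + y * a) + d * (y * c)) (c * (y * b) + d * (x + y * d)) z"
    by (rule mob_comp[OF den])
  finally show ?case by (simp add: xy algebra_simps)
qed

lemma power_coeffs_eigenvalue:
  fixes k :: "'a::field alg_closure"
  assumes "k\<^sup>2 = to_ac t * k - to_ac D"
  shows "to_ac (fst (power_coeffs t D j)) + to_ac (snd (power_coeffs t D j)) * k = k ^ j"
proof (induction j)
  case (Suc j)
  let ?x = "to_ac (fst (power_coeffs t D j))" and ?y = "to_ac (snd (power_coeffs t D j))"
  have "k * (?x + ?y * k) = ?x * k + ?y * k\<^sup>2" by (simp add: power2_eq_square algebra_simps)
  then show ?case unfolding power_Suc Suc[symmetric] assms by (simp add: algebra_simps)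
qed simp

text \<open>
  The power \<open>x + y g\<close> is scalar exactly if \<open>y = 0\<close>. Its eigenvalues \<open>x + y k\<close> and \<open>x + y l\<close> are the powers
  of \<open>k\<close> and \<open>l\<close>, and they coincide exactly in that case.
\<close>
lemma power_coeffs_snd_distinct:
  fixes k l :: "'a::field alg_closure"
  assumes "to_ac t = k + l" "to_ac D = k * l" "k \<noteq> l" "l \<noteq> 0"
  shows "snd (power_coeffs t D j) = 0 \<longleftrightarrow> (k / l) ^ j = 1"
proof -
  have k: "to_ac (fst (power_coeffs t D j)) + to_ac (snd (power_coeffs t D j)) * k = k ^ j"
    and l: "to_ac (fst (power_coeffs t D j)) + to_ac (snd (power_coeffs t D j)) * l = l ^ j"
    unfolding atomize_conj
    by (intro conjI power_coeffs_eigenvalue) (simp_all add: assms(1,2) power2_eq_square algebra_simps)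
  have "k ^ j - l ^ j = to_ac (snd (power_coeffs t D j)) * (k - l)"
    by (simp add: algebra_simps flip: k l)
  then have "snd (power_coeffs t D j) = 0 \<longleftrightarrow> k ^ j = l ^ j" using assms(3) by auto
  then show ?thesis using assms(4) by (simp add: power_divide)
qed

text \<open>
  For a double eigenvalue \<open>k\<close> the coefficient \<open>y\<close> is the derivative of \<open>X\<^sup>j\<close> at \<open>k\<close>, so a power with \<open>k \<noteq> 0\<close> is
  scalar exactly if the characteristic divides \<open>j\<close>. The factor \<open>k\<close> on the left avoids the exponent
  \<open>j - 1\<close>.
\<close>
lemma power_coeffs_double:
  fixes k :: "'a::comm_ring_1"
  assumes "t = k + k" "D = k * k"
  shows "k * snd (power_coeffs t D j) = of_nat j * k ^ j \<and> fst (power_coeffs t D j) = (1 - of_nat j) * k ^ j"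
proof (induction j)
  case (Suc j)
  let ?x = "fst (power_coeffs t D j)" and ?y = "snd (power_coeffs t D j)"
  have 1: "k * (?x + t * ?y) = k * ?x + k * (k * ?y) + k * (k * ?y)" and 2: "- D * ?y = - (k * (k * ?y))"
    by (simp_all add: assms algebra_simps)
  have y: "k * ?y = of_nat j * k ^ j" and x: "?x = (1 - of_nat j) * k ^ j" using Suc by simp_all
  have "k * (?x + t * ?y) = of_nat (Suc j) * k ^ Suc j"
    unfolding 1 unfolding y unfolding x by (simp add: algebra_simps)
  moreover have "- D * ?y = (1 - of_nat (Suc j)) * k ^ Suc j"
    unfolding 2 unfolding y by simp
  ultimately show ?case by simp
qed simp

text \<open>
  An eigenvector \<open>(1, z)\<close> has eigenvalue \<open>a + b z\<close>, so this substitution matches fixed points with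
  eigenvalues.
\<close>
lemma quad_factor:
  fixes k l :: "'a::field alg_closure"
  assumes "to_ac (a + d) = k + l" "to_ac (a * d - b * c) = k * l"
  shows "to_ac b * quad a b c d z = (to_ac a + to_ac b * z - k) * (to_ac a + to_ac b * z - l)"
proof -
  let ?w = "to_ac a + to_ac b * z"
  have "(?w - k) * (?w - l) = ?w * ?w - (k + l) * ?w + k * l" by (simp add: algebra_simps)
  also have "\<dots> = to_ac b * quad a b c d z"
    unfolding assms[symmetric] quad_def by (simp add: algebra_simps power2_eq_square)
  finally show ?thesis ..
qed

context
  assumes prime_card: "prime CARD('a::{field,finite})"
begin

lemma frob_mob: "frob (mob a b c d z) = mob a b c d (frob (z :: 'a alg_closure))"
  by (simp add: mob_def frob_add prime_card)

lemma funpow_frob_mob: "(frob ^^ j) (mob a b c d z) = mob a b c d ((frob ^^ j) (z :: 'a alg_closure))"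
  by (induction j) (simp_all add: frob_mob)

lemma frob_in_base_iff: "frob (z :: 'a alg_closure) \<in> range to_ac \<longleftrightarrow> z \<in> range to_ac"
  by (metis frob_eq_iff frob_inj prime_card)

lemma frob_quad: "frob (quad a b c d z) = quad a b c d (frob (z :: 'a alg_closure))"
  by (simp add: quad_def frob_add frob_diff prime_card)

text \<open>
  With \<open>Q\<close> the \<open>u\<close>-th power of the characteristic, the equation says that \<open>z\<close> is a root of
  \<open>b X\<^sup>Q\<^sup>+\<^sup>1 + a X\<^sup>Q - d X - c\<close>. The derivative is \<open>b X\<^sup>Q - d\<close>, and a common root would give \<open>a d = b c\<close>. On the
  projective line the number of solutions is always \<open>Q + 1\<close>; the one at infinity exists for \<open>b = 0\<close>.
\<close>
lemma card_frob_eq_mob: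
  fixes a b c d :: 'a
  assumes det: "a * d - b * c \<noteq> 0" and u: "u > 0"
  shows "card {z :: 'a alg_closure. (frob ^^ u) z * (to_ac a + to_ac b * z) = to_ac c + to_ac d * z} =
    CARD('a) ^ u + (if b = 0 then 0 else 1)"
    and "finite {z :: 'a alg_closure. (frob ^^ u) z * (to_ac a + to_ac b * z) = to_ac c + to_ac d * z}"
proof -
  define Q where "Q = CARD('a) ^ u"
  have "CARD('a) > 1" using prime_card prime_gt_1_nat by blast
  then have Q: "Q > 1" using u unfolding Q_def by (rule one_less_power)
  have Q0: "of_nat Q = (0 :: 'a alg_closure)"
    using u by (simp add: Q_def CHAR_eq_CARD[OF prime_card] of_nat_eq_0_iff_char_dvd)
  define P where "P = monom (to_ac b) (Suc Q) + (monom (to_ac a) Q + [:- to_ac c, - to_ac d:])"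
  have rt: "poly P z = z ^ Q * (to_ac a + to_ac b * z) - (to_ac c + to_ac d * z)" for z
    by (simp add: P_def poly_monom algebra_simps)
  have lin: "degree [:- to_ac c, - to_ac d:] < Q"
    by (rule le_less_trans[OF _ Q]) (simp add: degree_pCons_eq_if)
  have deg: "degree P = Q + (if b = 0 then 0 else 1)"
  proof (cases "b = 0")
    case True
    then have "a \<noteq> 0" using det by auto
    then show ?thesis using True lin by (simp add: P_def degree_add_eq_left degree_monom_eq)
  next
    case False
    have "degree (monom (to_ac a) Q + [:- to_ac c, - to_ac d:]) \<le> Q"
      by (rule degree_add_le) (use lin in \<open>auto intro: degree_monom_le\<close>)
    then have "degree P = degree (monom (to_ac b) (Suc Q))"
      unfolding P_def using False by (intro degree_add_eq_left) (simp add: degree_monom_eq)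
    then show ?thesis using False by (simp add: degree_monom_eq)
  qed
  have P0: "P \<noteq> 0" using deg Q by auto
  have "card {z. poly P z = 0} = degree P"
  proof (rule card_roots_separable[OF P0])
    fix z assume z: "poly P z = 0"
    show "poly (pderiv P) z \<noteq> 0"
    proof
      assume "poly (pderiv P) z = 0"
      then have 1: "to_ac b * z ^ Q = to_ac d"
        using Q0 by (simp add: P_def pderiv_add pderiv_monom pderiv_pCons poly_monom)
      have "to_ac a * z ^ Q + z * (to_ac b * z ^ Q) - (to_ac c + to_ac d * z) = 0"
        using z by (simp add: rt algebra_simps)
      then have 2: "to_ac a * z ^ Q = to_ac c" unfolding 1 by (simp add: algebra_simps)
      have "to_ac (a * d - b * c) = to_ac a * (to_ac b * z ^ Q) - to_ac b * (to_ac a * z ^ Q)"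
        by (simp add: 1 2)
      also have "\<dots> = 0" by (simp add: algebra_simps)
      finally show False using det by (simp only: to_ac_eq_0_iff)
    qed
  qed
  moreover have "{z. poly P z = 0} =
    {z :: 'a alg_closure. (frob ^^ u) z * (to_ac a + to_ac b * z) = to_ac c + to_ac d * z}"
    by (simp add: rt funpow_frob Q_def)
  moreover have "finite {z. poly P z = 0}" using P0 by (rule poly_roots_finite)
  ultimately show "card {z :: 'a alg_closure. (frob ^^ u) z * (to_ac a + to_ac b * z) = to_ac c + to_ac d * z} =
    CARD('a) ^ u + (if b = 0 then 0 else 1)"
    and "finite {z :: 'a alg_closure. (frob ^^ u) z * (to_ac a + to_ac b * z) = to_ac c + to_ac d * z}"
    using deg by (simp_all add: Q_def)
qed

text \<open>
  Eigenlines of the matrix are fixed points on the projective line. The two correction terms account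
  for the point at infinity, which is fixed for \<open>b = 0\<close>.
\<close>
lemma card_fixed_points:
  fixes a b c d :: 'a and k l :: "'a alg_closure"
  assumes tr: "to_ac (a + d) = k + l" and dt: "to_ac (a * d - b * c) = k * l"
    and ns: "\<not> (b = 0 \<and> c = 0 \<and> a = d)"
  shows "card {z. quad a b c d z = 0 \<and> (frob ^^ u) z = z} + 1 =
    card {h \<in> {k, l}. (frob ^^ u) h = h} + (if b = 0 then 0 else 1)"
proof (cases "b = 0")
  case False
  have "bij_betw (\<lambda>z. to_ac a + to_ac b * z) {z. quad a b c d z = 0 \<and> (frob ^^ u) z = z}
      {h \<in> {k, l}. (frob ^^ u) h = h}"
  proof (rule bij_betwI[where g = "\<lambda>h. (h - to_ac a) / to_ac b"])
    have "quad a b c d z = 0 \<longleftrightarrow> to_ac a + to_ac b * z \<in> {k, l}" for z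
      using quad_factor[OF tr dt, of z] False by auto
    moreover have "(frob ^^ u) (to_ac a + to_ac b * z) = to_ac a + to_ac b * z \<longleftrightarrow> (frob ^^ u) z = z" for z
    proof -
      have "(frob ^^ u) (to_ac b * z) = to_ac b * (frob ^^ u) z"
        using funpow_frob_to_ac[of u b] by (simp add: funpow_frob power_mult_distrib)
      then show ?thesis using False by (simp add: funpow_frob_add[OF prime_card])
    qed
    ultimately have *: "quad a b c d z = 0 \<and> (frob ^^ u) z = z \<longleftrightarrow>
        to_ac a + to_ac b * z \<in> {h \<in> {k, l}. (frob ^^ u) h = h}" for z
      by auto
    show "(\<lambda>z. to_ac a + to_ac b * z) \<in> {z. quad a b c d z = 0 \<and> (frob ^^ u) z = z} \<rightarrow>
        {h \<in> {k, l}. (frob ^^ u) h = h}" using * by blast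
    show "(\<lambda>h. (h - to_ac a) / to_ac b) \<in> {h \<in> {k, l}. (frob ^^ u) h = h} \<rightarrow>
        {z. quad a b c d z = 0 \<and> (frob ^^ u) z = z}"
    proof
      fix h assume "h \<in> {h \<in> {k, l}. (frob ^^ u) h = h}"
      moreover have "to_ac a + to_ac b * ((h - to_ac a) / to_ac b) = h" using False by simp
      ultimately show "(h - to_ac a) / to_ac b \<in> {z. quad a b c d z = 0 \<and> (frob ^^ u) z = z}"
        using *[of "(h - to_ac a) / to_ac b"] by simp
    qed
  qed (use False in auto)
  then show ?thesis using False by (auto dest: bij_betw_same_card)
next
  case True
  have "(k - to_ac a) * (k - to_ac d) = 0" "(l - to_ac a) * (l - to_ac d) = 0"
  proof -
    have "(k - to_ac a) * (k - to_ac d) = k * k - (k + l) * k + k * l"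
      unfolding tr[symmetric] dt[symmetric] True by (simp add: algebra_simps)
    then show "(k - to_ac a) * (k - to_ac d) = 0" by (simp add: algebra_simps)
    have "(l - to_ac a) * (l - to_ac d) = l * l - (k + l) * l + k * l"
      unfolding tr[symmetric] dt[symmetric] True by (simp add: algebra_simps)
    then show "(l - to_ac a) * (l - to_ac d) = 0" by (simp add: algebra_simps)
  qed
  then have kl: "{k, l} = {to_ac a, to_ac d}" using tr by auto
  have *: "{h \<in> {k, l}. (frob ^^ u) h = h} = {to_ac a, to_ac d}" unfolding kl by auto
  show ?thesis
  proof (cases "a = d")
    case ad: True
    then have empty: "{z. quad a b c d z = 0 \<and> (frob ^^ u) z = z} = {}"
      using True ns by (auto simp: quad_def)
    show ?thesis unfolding * empty using ad True by simp
  next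
    case ad: False
    define v where "v = c / (a - d)"
    have nz: "to_ac (a - d) \<noteq> (0 :: 'a alg_closure)" using ad by simp
    have "quad a b c d z = z * to_ac (a - d) - to_ac c" for z
      using True by (simp add: quad_def algebra_simps)
    moreover have "z = to_ac v \<longleftrightarrow> z * to_ac (a - d) = to_ac c" for z
      unfolding v_def to_ac_divide by (rule nonzero_eq_divide_eq[OF nz])
    ultimately have "quad a b c d z = 0 \<longleftrightarrow> z = to_ac v" for z
      by (metis right_minus_eq)
    then have single: "{z. quad a b c d z = 0 \<and> (frob ^^ u) z = z} = {to_ac v}"
      using funpow_frob_to_ac[of u v] by blast
    show ?thesis unfolding * single using ad True by simp
  qed
qed

end

section \<open>Points that a matrix moves inside their Frobenius orbit\<close>

context
  assumes prime_card: "prime CARD('a::{field,finite})"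
begin

lemma finite_frob_fixed:
  assumes "u > 0"
  shows "finite {z :: 'a alg_closure. (frob ^^ u) z = z}"
    and "card {z :: 'a alg_closure. (frob ^^ u) z = z} = CARD('a) ^ u"
  using card_frob_eq_mob[OF prime_card, of 1 1 0 0 u] assms by simp_all

text \<open>
  The identity is the case \<open>e = 1\<close> of the general count.
\<close>
lemma card_frob_period:
  assumes "n > 0"
  shows "int (card {z :: 'a alg_closure. has_period frob n z}) =
    (\<Sum>t | t dvd n. moebius t * int (CARD('a) ^ (n div t)))"
proof -
  have id: "((\<lambda>z. z) ^^ j) z = z" for j and z :: "'a alg_closure" by (induction j) auto
  interpret commuting_maps frob "\<lambda>z. z" "UNIV :: 'a alg_closure set" 1
    by unfold_locales (auto simp: has_period_def id)
  have "{z :: 'a alg_closure. has_period frob n z} =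
      {z \<in> UNIV. has_period frob n z \<and> (\<exists>i. z = (frob ^^ i) z)}"
    by (auto intro: exI[of _ 0])
  then show ?thesis
    using card_translate_in_orbit[OF assms, of "\<lambda>u. CARD('a) ^ u"] finite_frob_fixed by (simp add: id)
qed

lemma frob_period_notin_base:
  assumes "has_period frob n (z :: 'a alg_closure)" "n > 1"
  shows "z \<notin> range to_ac"
proof
  assume "z \<in> range to_ac"
  then have "(frob ^^ 1) z = z" by auto
  then show False using assms unfolding has_period_def by (metis nat_dvd_1_iff_1 less_irrefl)
qed

context
  fixes a b c d :: 'a and k l :: "'a alg_closure" and e :: nat
  assumes det: "a * d - b * c \<noteq> 0"
    and tr: "to_ac (a + d) = k + l" and dt: "to_ac (a * d - b * c) = k * l"
    and ns: "\<not> (b = 0 \<and> c = 0 \<and> a = d)"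
    and per: "\<And>j. snd (power_coeffs (a + d) (a * d - b * c) j) = 0 \<longleftrightarrow> e dvd j"
    and e_pos: "e > 0"
begin

text \<open>
  Leaving out the base field as well keeps all denominators away from zero.
\<close>
definition nonfixed :: "'a alg_closure set"
  where "nonfixed = {z. z \<notin> range to_ac \<and> quad a b c d z \<noteq> 0}"

text \<open>
  A power of the matrix is either scalar or has the fixed points of the matrix itself, because \<open>quad\<close>
  of \<open>x + y g\<close> is \<open>y\<close> times that of \<open>g\<close>. This makes \<open>e\<close> the period of every point of \<open>nonfixed\<close>.
\<close>
lemma funpow_mob_matrix:
  obtains x y where "\<forall>z. z \<notin> range to_ac \<longrightarrow> (mob a b c d ^^ j) z = mob (x + y * a) (y * b) (y * c) (x + y * d) z"
    "(x + y * a) * (x + y * d) - (y * b) * (y * c) \<noteq> 0" "y = 0 \<longleftrightarrow> e dvd j"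
proof -
  obtain x y where xy: "power_coeffs (a + d) (a * d - b * c) j = (x, y)" by force
  show thesis
  proof (rule that)
    show "y = 0 \<longleftrightarrow> e dvd j" using per[of j] xy by simp
    show "(x + y * a) * (x + y * d) - (y * b) * (y * c) \<noteq> 0"
      using power_coeffs_det[of a d b c j] det by (simp add: xy)
    show "\<forall>z. z \<notin> range to_ac \<longrightarrow> (mob a b c d ^^ j) z = mob (x + y * a) (y * b) (y * c) (x + y * d) z"
      using funpow_mob[OF det, of _ j] by (simp add: xy)
  qed
qed

lemma quad_power: "quad (x + y * a) (y * b) (y * c) (x + y * d) z = to_ac y * quad a b c d z"
  by (simp add: quad_def algebra_simps)

lemma nonfixed_commuting_maps: "commuting_maps frob (mob a b c d) nonfixed e"
proof
  fix z :: "'a alg_closure" assume z: "z \<in> nonfixed"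
  then have zF: "z \<notin> range to_ac" and zq: "quad a b c d z \<noteq> 0" by (auto simp: nonfixed_def)
  show "frob z \<in> nonfixed"
  proof -
    have "quad a b c d (frob z) \<noteq> frob 0"
      unfolding frob_quad[OF prime_card, symmetric] frob_inj[OF prime_card] by (rule zq)
    then show ?thesis using zF by (simp add: nonfixed_def frob_in_base_iff[OF prime_card])
  qed
  have mF: "mob a b c d z \<notin> range to_ac" by (rule mob_notin_base[OF det zF])
  show "mob a b c d z \<in> nonfixed"
  proof -
    have "mob a b c d (mob a b c d z) \<noteq> mob a b c d z"
    proof
      assume "mob a b c d (mob a b c d z) = mob a b c d z"
      then have "mob a b c d z = z" using mob_inverse[OF det] zF mF by metis
      then show False using zq mob_eq_iff[OF mob_denom_nonzero[OF det zF]] by blast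
    qed
    then show ?thesis using mF mob_eq_iff[OF mob_denom_nonzero[OF det mF]] by (simp add: nonfixed_def)
  qed
  show "mob a b c d (frob z) = frob (mob a b c d z)" by (simp add: frob_mob prime_card)
  show "has_period (mob a b c d) e z"
    unfolding has_period_def
  proof
    fix j
    obtain x y where xy: "\<forall>z. z \<notin> range to_ac \<longrightarrow> (mob a b c d ^^ j) z = mob (x + y * a) (y * b) (y * c) (x + y * d) z"
      "(x + y * a) * (x + y * d) - (y * b) * (y * c) \<noteq> 0" "y = 0 \<longleftrightarrow> e dvd j"
      by (rule funpow_mob_matrix[of j])
    show "(mob a b c d ^^ j) z = z \<longleftrightarrow> e dvd j"
      unfolding xy(1)[rule_format, OF zF] mob_eq_iff[OF mob_denom_nonzero[OF xy(2) zF]] quad_power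
      using zq xy(3) by simp
  qed
qed (rule e_pos)

text \<open>
  Of the solutions counted by \<open>card_frob_eq_mob\<close> for a non-scalar \<open>j\<close>-th power, those outside \<open>nonfixed\<close> are the
  fixed points of the matrix that are also fixed by the \<open>u\<close>-th Frobenius power: a solution in the base
  field is fixed by the power of the matrix, hence by the matrix. By \<open>card_fixed_points\<close> the answer
  depends on the eigenvalues only.
\<close>
lemma frob_eq_funpow_mob:
  assumes u: "u > 0"
  shows "finite {z \<in> nonfixed. (frob ^^ u) z = (mob a b c d ^^ j) z}"
    and "\<not> e dvd j \<Longrightarrow> card {z \<in> nonfixed. (frob ^^ u) z = (mob a b c d ^^ j) z} =
      CARD('a) ^ u + 1 - card {h \<in> {k, l}. (frob ^^ u) h = h}"
proof -
  obtain x y where xy: "\<forall>z. z \<notin> range to_ac \<longrightarrow> (mob a b c d ^^ j) z = mob (x + y * a) (y * b) (y * c) (x + y * d) z"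
    "(x + y * a) * (x + y * d) - (y * b) * (y * c) \<noteq> 0" "y = 0 \<longleftrightarrow> e dvd j"
    by (rule funpow_mob_matrix[of j])
  define V where "V = {z. (frob ^^ u) z * (to_ac (x + y * a) + to_ac (y * b) * z) = to_ac (y * c) + to_ac (x + y * d) * z}"
  define W where "W = {z \<in> nonfixed. (frob ^^ u) z = (mob a b c d ^^ j) z}"
  define R where "R = {z. quad a b c d z = 0 \<and> (frob ^^ u) z = z}"
  have V: "finite V" "card V = CARD('a) ^ u + (if y * b = 0 then 0 else 1)"
    unfolding V_def using card_frob_eq_mob[OF prime_card xy(2) u] by simp_all
  have W_iff: "z \<in> W \<longleftrightarrow> z \<in> nonfixed \<and> z \<in> V" for z
  proof (cases "z \<in> range to_ac")
    case False
    have "(frob ^^ u) z = (mob a b c d ^^ j) z \<longleftrightarrow> z \<in> V"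
      unfolding xy(1)[rule_format, OF False] V_def mob_def mem_Collect_eq
      by (rule nonzero_eq_divide_eq[OF mob_denom_nonzero[OF xy(2) False]])
    then show ?thesis by (simp add: W_def)
  qed (auto simp: W_def nonfixed_def)
  then have "W \<subseteq> V" by blast
  then have finW: "finite W" using V finite_subset by blast
  then show "finite {z \<in> nonfixed. (frob ^^ u) z = (mob a b c d ^^ j) z}" by (simp add: W_def)
  assume "\<not> e dvd j"
  then have y: "y \<noteq> 0" using xy(3) by simp
  have fix_iff: "z \<in> V \<longleftrightarrow> quad a b c d z = 0" if "(frob ^^ u) z = z" for z
  proof -
    have "z \<in> V \<longleftrightarrow> to_ac y * quad a b c d z = 0"
      using that unfolding V_def quad_power[where x = x, symmetric] by (simp add: quad_def algebra_simps power2_eq_square)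
    then show ?thesis using y by simp
  qed
  have "V = W \<union> R"
  proof (intro equalityI subsetI)
    fix z assume z: "z \<in> V"
    show "z \<in> W \<union> R"
    proof (cases "z \<in> nonfixed")
      case True
      then show ?thesis using z W_iff by blast
    next
      case False
      show ?thesis
      proof (cases "z \<in> range to_ac")
        case True
        then have "(frob ^^ u) z = z" by auto
        then show ?thesis using fix_iff z by (simp add: R_def)
      next
        case zF: False
        then have q: "quad a b c d z = 0" using False by (simp add: nonfixed_def)
        have "mob (x + y * a) (y * b) (y * c) (x + y * d) z = z"
          unfolding mob_eq_iff[OF mob_denom_nonzero[OF xy(2) zF]] quad_power q by simp
        moreover have "(frob ^^ u) z = mob (x + y * a) (y * b) (y * c) (x + y * d) z"
          using z unfolding V_def mob_def mem_Collect_eq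
          by (simp only: nonzero_eq_divide_eq[OF mob_denom_nonzero[OF xy(2) zF]])
        ultimately show ?thesis using q by (simp add: R_def)
      qed
    qed
  next
    fix z assume "z \<in> W \<union> R"
    then show "z \<in> V" using W_iff fix_iff by (auto simp: R_def)
  qed
  moreover have "W \<inter> R = {}" by (auto simp: W_def R_def nonfixed_def)
  moreover have "finite R" using V \<open>V = W \<union> R\<close> by simp
  ultimately have "card V = card W + card R" using finW by (simp add: card_Un_disjoint)
  then show "card {z \<in> nonfixed. (frob ^^ u) z = (mob a b c d ^^ j) z} =
      CARD('a) ^ u + 1 - card {h \<in> {k, l}. (frob ^^ u) h = h}"
    using card_fixed_points[OF prime_card tr dt ns, of u] V(2) y
    unfolding R_def[symmetric] W_def[symmetric] by (simp split: if_splits)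
qed

text \<open>
  The fixed points have Frobenius period at most 2, like the eigenvalues, so for \<open>n > 2\<close> every point of
  period \<open>n\<close> lies in \<open>nonfixed\<close>.
\<close>
lemma card_mob_in_frob_orbit:
  assumes n: "n > 2" and k: "frob (frob k) = k" and l: "frob (frob l) = l"
  shows "int (card {z. has_period frob n z \<and> (\<exists>i. mob a b c d z = (frob ^^ i) z)}) =
    (if e dvd n then int (totient e) * (\<Sum>t | t dvd n \<and> coprime t e. moebius t *
       int (CARD('a) ^ (n div (e * t)) + 1 - card {h \<in> {k, l}. (frob ^^ (n div (e * t))) h = h})) else 0)"
proof -
  interpret commuting_maps frob "mob a b c d" nonfixed e by (rule nonfixed_commuting_maps)
  \<comment> \<open>the matrix itself is not scalar\<close>
  have "e \<noteq> 1" using per[of 1] by auto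
  have "z \<in> nonfixed" if z: "has_period frob n z" for z :: "'a alg_closure"
  proof -
    have zF: "z \<notin> range to_ac" using frob_period_notin_base[OF z] n by simp
    have z2: "(frob ^^ 2) z \<noteq> z" using z n unfolding has_period_def by (metis dvd_imp_le not_le zero_less_numeral)
    have "quad a b c d z \<noteq> 0"
    proof
      assume q: "quad a b c d z = 0"
      have "(frob ^^ 2) (to_ac a + to_ac b * z) = to_ac a + to_ac b * z"
      proof -
        have "to_ac a + to_ac b * z = k \<or> to_ac a + to_ac b * z = l"
          using quad_factor[OF tr dt, of z] q by simp
        then show ?thesis using k l by (auto simp: numeral_2_eq_2)
      qed
      then have "to_ac b * (frob ^^ 2) z = to_ac b * z"
        by (simp add: numeral_2_eq_2 frob_add prime_card)
      then have "b = 0" using z2 by simp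
      then have "to_ac (- c) + to_ac (a - d) * z = 0" using q by (simp add: quad_def algebra_simps)
      then show False using to_ac_lin_eq_0[OF zF, of "- c" "a - d"] ns \<open>b = 0\<close> by simp
    qed
    then show ?thesis using zF by (simp add: nonfixed_def)
  qed
  then have "{z. has_period frob n z \<and> (\<exists>i. mob a b c d z = (frob ^^ i) z)} =
      {z \<in> nonfixed. has_period frob n z \<and> (\<exists>i. mob a b c d z = (frob ^^ i) z)}" by blast
  also have "int (card \<dots>) = (if e dvd n then int (totient e) * (\<Sum>t | t dvd n \<and> coprime t e. moebius t *
       int (CARD('a) ^ (n div (e * t)) + 1 - card {h \<in> {k, l}. (frob ^^ (n div (e * t))) h = h})) else 0)"
  proof (rule card_translate_in_orbit)
    show "n > 0" using n by simp
    show "finite {z \<in> nonfixed. (frob ^^ u) z = (mob a b c d ^^ j) z}" if "u > 0" for u j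
      by (rule frob_eq_funpow_mob(1)[OF that])
    show "card {z \<in> nonfixed. (frob ^^ u) z = (mob a b c d ^^ j) z} =
      CARD('a) ^ u + 1 - card {h \<in> {k, l}. (frob ^^ u) h = h}" if "u > 0" "coprime j e" for u j
    proof (rule frob_eq_funpow_mob(2)[OF that(1)])
      show "\<not> e dvd j" using that(2) \<open>e \<noteq> 1\<close> by (metis coprime_absorb_right nat_dvd_1_iff_1)
    qed
  qed
  finally show ?thesis .
qed

end

end

section \<open>Binary forms and their values\<close>

lemma map_poly_ring_hom:
  fixes h :: "'b::comm_ring_1 \<Rightarrow> 'c::comm_ring_1"
  assumes "h 0 = 0" "\<And>x y. h (x + y) = h x + h y" "\<And>x y. h (x * y) = h x * h y"
  shows "map_poly h (p + q) = map_poly h p + map_poly h q"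
    and "map_poly h (p * q) = map_poly h p * map_poly h q"
proof -
  have sum: "h (sum f A) = (\<Sum>x\<in>A. h (f x))" for f :: "nat \<Rightarrow> 'b" and A
    by (induction A rule: infinite_finite_induct) (simp_all add: assms)
  show "map_poly h (p + q) = map_poly h p + map_poly h q"
    by (rule poly_eqI) (simp add: coeff_map_poly assms)
  show "map_poly h (p * q) = map_poly h p * map_poly h q"
    by (rule poly_eqI) (simp add: coeff_map_poly assms coeff_mult sum)
qed

lemmas map_poly_to_ac_add = map_poly_ring_hom(1)[of to_ac, OF to_ac_0 to_ac_add to_ac_mult]
lemmas map_poly_to_ac_mult = map_poly_ring_hom(2)[of to_ac, OF to_ac_0 to_ac_add to_ac_mult]

text \<open>
  Sets \<open>x = 1\<close>: a polynomial over polynomials has \<open>y\<close> as its outer variable.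
\<close>
definition dehom :: "'a::field poly poly \<Rightarrow> 'a poly"
  where "dehom f = map_poly (\<lambda>q. poly q 1) f"

definition homogenize :: "nat \<Rightarrow> 'a::field poly \<Rightarrow> 'a poly poly"
  where "homogenize n m = (\<Sum>i\<le>n. const2 (coeff m i) * X2 ^ (n - i) * Y2 ^ i)"

lemma monomial_eq_monom: "const2 c * X2 ^ j * Y2 ^ i = monom (monom c j) i"
proof -
  have X: "(X2 :: 'a poly poly) ^ j = [:monom 1 j:]"
    by (induction j) (simp_all add: X2_def one_pCons monom_Suc monom_0)
  have Y: "(Y2 :: 'a poly poly) ^ i = monom 1 i"
    by (simp add: Y2_def monom_altdef)
  show ?thesis by (simp add: const2_def X Y smult_monom)
qed

lemma dehom_mult: "dehom (f * g) = dehom f * dehom g"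
  unfolding dehom_def by (rule map_poly_ring_hom(2)) auto

lemma degree_dehom_le: "degree (dehom f) \<le> degree f"
  unfolding dehom_def by (rule map_poly_degree_leq)

lemma coeff_homogenize: "coeff (homogenize n m) i = (if i \<le> n then monom (coeff m i) (n - i) else 0)"
proof -
  have "coeff (homogenize n m) i = (\<Sum>j\<le>n. if j = i then monom (coeff m j) (n - j) else 0)"
    unfolding homogenize_def monomial_eq_monom coeff_sum coeff_monom ..
  then show ?thesis unfolding sum.delta[OF finite_atMost] atMost_iff .
qed

lemma dehom_homogenize: "degree m \<le> n \<Longrightarrow> dehom (homogenize n m) = m"
  by (rule poly_eqI) (auto simp: dehom_def coeff_map_poly coeff_homogenize poly_monom coeff_eq_0)

lemma homogenize_mult:
  assumes "degree u \<le> s" "degree v \<le> t"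
  shows "homogenize (s + t) (u * v) = homogenize s u * homogenize t v"
proof (rule poly_eqI)
  fix i
  have *: "coeff (homogenize s u) j * coeff (homogenize t v) (i - j) =
      (if i \<le> s + t then monom (coeff u j * coeff v (i - j)) (s + t - i) else 0)" if "j \<le> i" for j
  proof (cases "j \<le> s \<and> i - j \<le> t")
    case True
    then have "s - j + (t - (i - j)) = s + t - i" "i \<le> s + t" using that by auto
    then show ?thesis using True by (simp add: coeff_homogenize mult_monom)
  next
    case False
    then have "coeff u j = 0 \<or> coeff v (i - j) = 0" using assms by (auto intro!: coeff_eq_0)
    then show ?thesis using False by (auto simp: coeff_homogenize)
  qed
  have "coeff (homogenize s u * homogenize t v) i =
      (\<Sum>j\<le>i. if i \<le> s + t then monom (coeff u j * coeff v (i - j)) (s + t - i) else 0)"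
    unfolding coeff_mult by (intro sum.cong refl *) simp
  also have "\<dots> = coeff (homogenize (s + t) (u * v)) i"
    by (simp add: coeff_homogenize coeff_mult monom_sum)
  finally show "coeff (homogenize (s + t) (u * v)) i = coeff (homogenize s u * homogenize t v) i" ..
qed

lemma homogenize_add: "homogenize n (u + v) = homogenize n u + homogenize n v"
  by (rule poly_eqI) (simp add: coeff_homogenize add_monom)

lemma homogenize_smult: "homogenize n (smult c m) = const2 c * homogenize n m"
  by (rule poly_eqI) (simp add: coeff_homogenize const2_def smult_monom)

text \<open>
  Contains the zero polynomial, so that it is closed under addition.
\<close>
definition forms :: "nat \<Rightarrow> 'a::field poly poly set"
  where "forms n = {homogenize n m | m. degree m \<le> n}"

lemma homogenize_eq_sum: "(\<Sum>i\<le>n. const2 (\<alpha> i) * X2 ^ (n - i) * Y2 ^ i) = homogenize n (\<Sum>i\<le>n. monom (\<alpha> i) i)"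
proof -
  have "coeff (\<Sum>i\<le>n. monom (\<alpha> i) i) j = \<alpha> j" if "j \<le> n" for j
    using that by (simp add: coeff_sum coeff_monom)
  then show ?thesis unfolding homogenize_def by (intro sum.cong refl) simp
qed

lemma degree_sum_monom_le: "degree (\<Sum>i\<le>n. monom (\<alpha> i) i) \<le> n"
proof (rule degree_sum_le)
  show "degree (monom (\<alpha> i) i) \<le> n" if "i \<in> {..n}" for i
    using degree_monom_le[of "\<alpha> i" i] that by simp
qed simp

lemma binary_form_iff: "binary_form n f \<longleftrightarrow> f \<noteq> 0 \<and> f \<in> forms n"
proof
  assume "binary_form n f"
  then show "f \<noteq> 0 \<and> f \<in> forms n"
    unfolding binary_form_def forms_def homogenize_eq_sum using degree_sum_monom_le by blast
qed (auto simp: binary_form_def forms_def homogenize_def)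

lemma forms_dehom: "f \<in> forms n \<Longrightarrow> f = homogenize n (dehom f) \<and> degree (dehom f) \<le> n"
  by (auto simp: forms_def dehom_homogenize)

lemma homogenize_in_forms: "degree m \<le> n \<Longrightarrow> homogenize n m \<in> forms n"
  by (auto simp: forms_def)

lemma forms_add: "f \<in> forms n \<Longrightarrow> g \<in> forms n \<Longrightarrow> f + g \<in> forms n"
  using homogenize_in_forms[OF degree_add_le, of "dehom f" n "dehom g"] forms_dehom[of f n] forms_dehom[of g n]
  unfolding homogenize_add by metis

lemma forms_mult: "f \<in> forms s \<Longrightarrow> g \<in> forms t \<Longrightarrow> f * g \<in> forms (s + t)"
proof -
  assume "f \<in> forms s" "g \<in> forms t"
  then obtain u v where "f = homogenize s u" "degree u \<le> s" "g = homogenize t v" "degree v \<le> t"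
    by (auto simp: forms_def)
  moreover from this have "degree (u * v) \<le> s + t" using degree_mult_le[of u v] by simp
  ultimately show ?thesis using homogenize_mult[of u s v t] homogenize_in_forms[of "u * v" "s + t"] by simp
qed

lemma forms_const2: "const2 c \<in> forms 0"
  using homogenize_in_forms[of "[:c:]" 0] by (simp add: homogenize_def)

lemma forms_power: "f \<in> forms s \<Longrightarrow> f ^ k \<in> forms (k * s)"
  by (induction k) (use forms_const2[of 1] forms_mult in \<open>auto simp: add.commute\<close>)

lemma forms_sum:
  fixes f :: "'i \<Rightarrow> 'a::field poly poly"
  shows "finite I \<Longrightarrow> (\<And>i. i \<in> I \<Longrightarrow> f i \<in> forms n) \<Longrightarrow> sum f I \<in> forms n"
proof (induction I rule: finite_induct)
  case empty
  have "homogenize n 0 = (0 :: 'a poly poly)" by (simp add: homogenize_def)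
  then show ?case using homogenize_in_forms[of "0 :: 'a poly" n] by simp
qed (auto intro: forms_add)

lemma forms_linear: "const2 a * X2 + const2 b * Y2 \<in> forms 1"
  using homogenize_in_forms[of "[:a, b:]" 1] by (simp add: homogenize_def)

definition form_eval :: "'a::field poly poly \<Rightarrow> 'a alg_closure \<Rightarrow> 'a alg_closure \<Rightarrow> 'a alg_closure"
  where "form_eval f x y = poly (map_poly (\<lambda>q. poly (map_poly to_ac q) x) f) y"

lemma form_eval_add: "form_eval (f + g) x y = form_eval f x y + form_eval g x y"
  and form_eval_mult: "form_eval (f * g) x y = form_eval f x y * form_eval g x y"
  unfolding form_eval_def
  by (subst map_poly_ring_hom; simp add: map_poly_to_ac_add map_poly_to_ac_mult)+

lemma form_eval_const2 [simp]: "form_eval (const2 c) x y = to_ac c"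
  and form_eval_X2 [simp]: "form_eval X2 x y = x"
  and form_eval_Y2 [simp]: "form_eval Y2 x y = y"
  and form_eval_0 [simp]: "form_eval 0 x y = 0"
  by (simp_all add: form_eval_def const2_def X2_def Y2_def map_poly_pCons)

lemma form_eval_power: "form_eval (f ^ k) x y = form_eval f x y ^ k"
  using form_eval_const2[of 1 x y] by (induction k) (simp_all add: form_eval_mult)

lemma form_eval_sum: "form_eval (sum f I) x y = (\<Sum>i\<in>I. form_eval (f i) x y)"
  by (induction I rule: infinite_finite_induct) (simp_all add: form_eval_add)

lemma form_eval_homogenize: "form_eval (homogenize n m) x y = (\<Sum>i\<le>n. to_ac (coeff m i) * x ^ (n - i) * y ^ i)"
  by (simp add: homogenize_def form_eval_sum form_eval_mult form_eval_power)

lemma form_eval_1_homogenize: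
  assumes "degree m \<le> n"
  shows "form_eval (homogenize n m) 1 y = poly (map_poly to_ac m) y"
proof -
  have "poly (map_poly to_ac m) y = (\<Sum>i\<le>degree m. to_ac (coeff m i) * y ^ i)"
    by (simp add: poly_altdef coeff_map_poly degree_map_poly)
  also have "\<dots> = (\<Sum>i\<le>n. to_ac (coeff m i) * y ^ i)"
    using assms by (intro sum.mono_neutral_left) (auto simp: coeff_eq_0)
  finally show ?thesis by (simp add: form_eval_homogenize)
qed

lemma form_eval_scale:
  assumes "f \<in> forms n"
  shows "form_eval f (s * x) (s * y) = s ^ n * form_eval f x y"
proof -
  obtain m where m: "f = homogenize n m" using assms by (auto simp: forms_def)
  have "s ^ (n - i) * s ^ i = s ^ n" if "i \<le> n" for i using that by (simp flip: power_add)
  then have "to_ac c * (s * x) ^ (n - i) * (s * y) ^ i = s ^ n * (to_ac c * x ^ (n - i) * y ^ i)" if "i \<le> n" for c i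
    using that by (simp add: power_mult_distrib mult_ac)
  then show ?thesis unfolding m form_eval_homogenize sum_distrib_left by (intro sum.cong refl) auto
qed

lemma form_act_homogenize:
  "form_act g (homogenize n m) = (\<Sum>i\<le>n. const2 (coeff m i)
       * (const2 (g $ 1 $ 1) * X2 + const2 (g $ 1 $ 2) * Y2) ^ (n - i)
       * (const2 (g $ 2 $ 1) * X2 + const2 (g $ 2 $ 2) * Y2) ^ i)"
  unfolding homogenize_def by (rule form_act_binary_form)

lemma form_eval_act:
  assumes "f \<in> forms n"
  shows "form_eval (form_act g f) x y =
    form_eval f (to_ac (g $ 1 $ 1) * x + to_ac (g $ 1 $ 2) * y) (to_ac (g $ 2 $ 1) * x + to_ac (g $ 2 $ 2) * y)"
proof -
  obtain m where m: "f = homogenize n m" using assms by (auto simp: forms_def)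
  show ?thesis unfolding m form_act_homogenize form_eval_homogenize
    by (simp add: form_eval_sum form_eval_mult form_eval_power form_eval_add)
qed

lemma form_act_in_forms:
  assumes "f \<in> forms n"
  shows "form_act g f \<in> forms n"
proof -
  obtain m where m: "f = homogenize n m" using assms by (auto simp: forms_def)
  have "const2 c * (const2 a * X2 + const2 b * Y2) ^ (n - i) * (const2 a' * X2 + const2 b' * Y2) ^ i \<in> forms n"
    if "i \<le> n" for i a b a' b' and c :: 'a
    using forms_mult[OF forms_mult[OF forms_const2[of c] forms_power[OF forms_linear[of a b], of "n - i"]]
        forms_power[OF forms_linear[of a' b'], of i]] that by simp
  then show ?thesis unfolding m form_act_homogenize by (intro forms_sum) auto
qed

lemma form_act_scale:
  assumes "f \<in> forms n"
  shows "form_act g (const2 c * f) = const2 c * form_act g f"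
proof -
  obtain m where m: "f = homogenize n m" using assms by (auto simp: forms_def)
  show ?thesis unfolding m homogenize_smult[symmetric] form_act_homogenize
    by (simp add: sum_distrib_left mult.assoc)
qed

lemma is_unit_homogenize:
  assumes "is_unit (homogenize n m)"
  shows "n = 0"
proof -
  from assms obtain q where q: "homogenize n m = [:q:]" "is_unit q"
    using is_unit_poly_iff[of "homogenize n m"] by blast
  then have "q = monom (coeff m 0) n" using coeff_homogenize[of n m 0] by simp
  moreover have "q \<noteq> 0" using q(2) by (metis not_is_unit_0)
  moreover from this have "degree q = 0" using q(2) is_unit_iff_degree by blast
  ultimately show ?thesis by (cases "coeff m 0 = 0") (auto simp: degree_monom_eq)
qed

section \<open>Irreducible forms and Frobenius orbits\<close>

definition frob_poly :: "nat \<Rightarrow> 'a::{field,finite} alg_closure \<Rightarrow> 'a alg_closure poly"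
  where "frob_poly n z = (\<Prod>i<n. [:- (frob ^^ i) z, 1:])"

text \<open>
  For \<open>z\<close> of Frobenius period \<open>n\<close> this is the minimal polynomial of \<open>z\<close> over the base field.
\<close>
definition min_poly :: "nat \<Rightarrow> 'a::{field,finite} alg_closure \<Rightarrow> 'a poly"
  where "min_poly n z = map_poly of_ac (frob_poly n z)"

definition root_form :: "nat \<Rightarrow> 'a::{field,finite} alg_closure \<Rightarrow> 'a poly poly"
  where "root_form n z = homogenize n (min_poly n z)"

lemma funpow_frob_0: "(frob ^^ j) 0 = 0"
  by (induction j) auto

lemma degree_frob_poly: "degree (frob_poly n z) = n"
  unfolding frob_poly_def by (subst degree_prod_eq_sum_degree) auto

lemma lead_coeff_frob_poly: "lead_coeff (frob_poly n z) = 1"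
  unfolding frob_poly_def by (subst lead_coeff_prod) simp

lemma poly_frob_poly_eq_0_iff: "poly (frob_poly n z) y = 0 \<longleftrightarrow> (\<exists>i<n. y = (frob ^^ i) z)"
  unfolding frob_poly_def by (auto simp: poly_prod)

definition nonzero_multiples :: "'a::field poly poly \<Rightarrow> 'a poly poly set"
  where "nonzero_multiples f = {const2 c * f | c. c \<noteq> 0}"

definition root_class :: "nat \<Rightarrow> 'a::{field,finite} alg_closure \<Rightarrow> 'a poly poly set"
  where "root_class n z = nonzero_multiples (root_form n z)"

abbreviation mob_mat :: "'a::field ^ 2 ^ 2 \<Rightarrow> 'a alg_closure \<Rightarrow> 'a alg_closure"
  where "mob_mat g \<equiv> mob (g $ 1 $ 1) (g $ 1 $ 2) (g $ 2 $ 1) (g $ 2 $ 2)"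

lemma proportional_class: "proportional `` {f} = nonzero_multiples f"
  by (auto simp: proportional_def nonzero_multiples_def)

lemma nonzero_multiples_scale:
  assumes "c \<noteq> 0"
  shows "nonzero_multiples (const2 c * f) = nonzero_multiples f"
proof (intro equalityI subsetI)
  fix h assume "h \<in> nonzero_multiples (const2 c * f)"
  then obtain b where "b \<noteq> 0" "h = const2 b * (const2 c * f)" by (auto simp: nonzero_multiples_def)
  then have "b * c \<noteq> 0 \<and> h = const2 (b * c) * f" using assms by (simp add: mult.assoc)
  then show "h \<in> nonzero_multiples f" by (auto simp: nonzero_multiples_def simp del: const2_simps)
next
  fix h assume "h \<in> nonzero_multiples f"
  then obtain b where b: "b \<noteq> 0" "h = const2 b * f" by (auto simp: nonzero_multiples_def)
  have "const2 (b / c) * const2 c = const2 b" using assms by (simp flip: const2_simps(4))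
  then have "h = const2 (b / c) * (const2 c * f)" using b by (simp flip: mult.assoc)
  then show "h \<in> nonzero_multiples (const2 c * f)" using b assms by (auto simp: nonzero_multiples_def)
qed

context
  assumes prime_card: "prime CARD('a::{field,finite})"
begin

lemma poly_funpow_frob:
  "poly (map_poly to_ac m) ((frob ^^ i) z) = (frob ^^ i) (poly (map_poly to_ac m) (z :: 'a alg_closure))"
proof -
  have "poly (map_poly to_ac m) (frob y) = frob (poly (map_poly to_ac m) y)" for y :: "'a alg_closure"
  proof (induction m)
    case (pCons c m)
    then show ?case by (simp add: map_poly_pCons frob_add prime_card)
  qed simp
  then show ?thesis by (induction i) simp_all
qed

text \<open>
  The Frobenius map permutes the factors of \<open>frob_poly\<close> cyclically, so it fixes the coefficients.
\<close>
lemma map_min_poly: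
  fixes z :: "'a alg_closure"
  assumes "(frob ^^ n) z = z" "n > 0"
  shows "map_poly to_ac (min_poly n z) = frob_poly n z"
proof -
  have fm: "map_poly frob (p * q) = map_poly frob p * map_poly frob q" for p q :: "'a alg_closure poly"
    by (rule map_poly_ring_hom(2)) (simp_all add: frob_add prime_card)
  have "map_poly frob (frob_poly k z) = (\<Prod>i<k. [:- (frob ^^ Suc i) z, 1:])" for k
  proof (induction k)
    case (Suc k)
    have "map_poly frob [:- (frob ^^ k) z, 1:] = [:- (frob ^^ Suc k) z, 1:]"
      by (simp add: map_poly_pCons frob_uminus prime_card)
    then show ?case using Suc unfolding frob_poly_def prod.lessThan_Suc fm by simp
  qed (simp add: frob_poly_def)
  then have "map_poly frob (frob_poly n z) = (\<Prod>i<n. [:- (frob ^^ Suc i) z, 1:])" .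
  also have "\<dots> = frob_poly n z"
  proof -
    obtain n' where n': "n = Suc n'" using assms(2) by (cases n) auto
    have "(\<Prod>i<n. [:- (frob ^^ Suc i) z, 1:]) = (\<Prod>i<n'. [:- (frob ^^ Suc i) z, 1:]) * [:- z, 1:]"
      using assms(1) n' by simp
    also have "\<dots> = (\<Prod>i<n. [:- (frob ^^ i) z, 1:])"
      unfolding n' prod.lessThan_Suc_shift by (simp add: mult.commute)
    finally show ?thesis by (simp add: frob_poly_def)
  qed
  finally have "frob (coeff (frob_poly n z) i) = coeff (frob_poly n z) i" for i
    by (metis coeff_map_poly frob_0)
  then have "coeff (frob_poly n z) i \<in> range to_ac" for i by (simp add: frob_eq_iff)
  then show ?thesis
    by (intro poly_eqI) (simp add: min_poly_def coeff_map_poly to_ac_of_ac)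
qed

lemma degree_min_poly:
  fixes z :: "'a alg_closure"
  assumes "(frob ^^ n) z = z" "n > 0"
  shows "degree (min_poly n z) = n" "lead_coeff (min_poly n z) = 1" "min_poly n z \<noteq> 0"
proof -
  have d: "degree (min_poly n z) = degree (map_poly to_ac (min_poly n z))"
    by (rule degree_map_poly[symmetric]) simp
  then show *: "degree (min_poly n z) = n"
    by (simp add: map_min_poly[OF assms] degree_frob_poly)
  have "to_ac (lead_coeff (min_poly n z)) = lead_coeff (map_poly to_ac (min_poly n z))"
    using d by (simp add: coeff_map_poly)
  also have "\<dots> = 1" by (simp only: map_min_poly[OF assms] lead_coeff_frob_poly)
  finally show "lead_coeff (min_poly n z) = 1" by simp
  show "min_poly n z \<noteq> 0" using * assms(2) by auto
qed

text \<open>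
  The remainder vanishes at all \<open>n\<close> conjugates of \<open>z\<close> and has degree less than \<open>n\<close>.
\<close>
lemma min_poly_dvd:
  fixes z :: "'a alg_closure"
  assumes per: "has_period frob n z" and n: "n > 0" and root: "poly (map_poly to_ac h) z = 0"
  shows "min_poly n z dvd h"
proof -
  have cyc: "(frob ^^ n) z = z" using per by (simp add: has_period_def)
  define r where "r = h mod min_poly n z"
  have "h = h div min_poly n z * min_poly n z + r"
    unfolding r_def by (rule div_mult_mod_eq[symmetric])
  then have "map_poly to_ac h = map_poly to_ac (h div min_poly n z * min_poly n z + r)" by (rule arg_cong)
  also have "\<dots> = map_poly to_ac (h div min_poly n z) * frob_poly n z + map_poly to_ac r"
    unfolding map_poly_to_ac_add map_poly_to_ac_mult map_min_poly[OF cyc n] ..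
  finally have "map_poly to_ac h = map_poly to_ac (h div min_poly n z) * frob_poly n z + map_poly to_ac r" .
  moreover have "poly (frob_poly n z) z = 0"
    unfolding poly_frob_poly_eq_0_iff using n by (auto intro!: exI[of _ 0])
  ultimately have rz: "poly (map_poly to_ac r) z = 0" using root by simp
  have "r = 0"
  proof (rule ccontr)
    assume r0: "r \<noteq> 0"
    have "degree r < n" using degree_mod_less'[OF degree_min_poly(3)[OF cyc n]] r0 degree_min_poly(1)[OF cyc n]
      by (simp add: r_def)
    moreover have "map_poly to_ac r \<noteq> 0" using r0 by (simp add: map_poly_eq_0_iff)
    then have "card {y. poly (map_poly to_ac r) y = 0} \<le> degree r"
      using card_poly_roots_bound[of "map_poly to_ac r"] by (simp add: degree_map_poly)
    moreover have "(\<lambda>i. (frob ^^ i) z) ` {..<n} \<subseteq> {y. poly (map_poly to_ac r) y = 0}"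
      using rz by (auto simp: poly_funpow_frob funpow_frob_0)
    then have "card ((\<lambda>i. (frob ^^ i) z) ` {..<n}) \<le> card {y. poly (map_poly to_ac r) y = 0}"
      using \<open>map_poly to_ac r \<noteq> 0\<close> by (intro card_mono poly_roots_finite)
    moreover have "inj_on (\<lambda>i. (frob ^^ i) z) {..<n}"
      using funpow_eq_iff[OF per n] by (auto simp: inj_on_def cong_def)
    then have "card ((\<lambda>i. (frob ^^ i) z) ` {..<n}) = n" by (simp add: card_image)
    ultimately show False by simp
  qed
  then show ?thesis by (auto simp: r_def mod_eq_0_iff_dvd)
qed

text \<open>
  The Frobenius orbit of \<open>z\<close> stays among the finitely many roots of \<open>m\<close>.
\<close>
lemma periodic_root:
  assumes "m \<noteq> 0" "poly (map_poly to_ac m) (z :: 'a alg_closure) = 0"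
  obtains n where "n > 0" "has_period frob n z"
proof -
  have "(\<lambda>i. (frob ^^ i) z) ` UNIV \<subseteq> {y. poly (map_poly to_ac m) y = 0}"
    using assms(2) by (auto simp: poly_funpow_frob funpow_frob_0)
  moreover have "finite {y. poly (map_poly to_ac m) y = 0}"
    using assms(1) by (intro poly_roots_finite) (simp add: map_poly_eq_0_iff)
  ultimately have "\<not> inj (\<lambda>i. (frob ^^ i) z)"
    using finite_imageD[of "\<lambda>i. (frob ^^ i) z" UNIV] finite_subset by auto
  then obtain i j where ij: "(frob ^^ i) z = (frob ^^ j) z" "i < j"
    unfolding inj_on_def by (metis linorder_neqE_nat)
  have "(frob ^^ (i + (j - i))) z = (frob ^^ i) ((frob ^^ (j - i)) z)"
    by (simp only: funpow_add comp_apply)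
  then have "(frob ^^ j) z = (frob ^^ i) ((frob ^^ (j - i)) z)" using ij(2) by simp
  then have "(frob ^^ (j - i)) z = z" using ij(1) by (simp add: funpow_frob_inj prime_card)
  then show thesis using has_period_exists[of "j - i" frob z] ij(2) that by auto
qed

lemma root_form_root:
  fixes z :: "'a alg_closure"
  assumes "(frob ^^ n) z = z" "n > 0"
  shows "form_eval (root_form n z) 1 y = 0 \<longleftrightarrow> (\<exists>i<n. y = (frob ^^ i) z)"
  unfolding root_form_def
  by (simp add: form_eval_1_homogenize degree_min_poly(1)[OF assms] map_min_poly[OF assms] poly_frob_poly_eq_0_iff)

lemma root_form_in_forms:
  fixes z :: "'a alg_closure"
  assumes "(frob ^^ n) z = z" "n > 0"
  shows "root_form n z \<in> forms n" "dehom (root_form n z) = min_poly n z"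
  using degree_min_poly(1)[OF assms] by (auto simp: forms_def root_form_def dehom_homogenize)

text \<open>
  After setting \<open>x = 1\<close>, the minimal polynomial of \<open>z\<close> divides a polynomial of degree at most \<open>n\<close>.
\<close>
lemma form_with_root:
  fixes z :: "'a alg_closure"
  assumes per: "has_period frob n z" and n: "n > 0"
    and f: "f \<in> forms n" "f \<noteq> 0" and root: "form_eval f 1 z = 0"
  obtains c where "c \<noteq> 0" "f = const2 c * root_form n z"
proof -
  have cyc: "(frob ^^ n) z = z" using per by (simp add: has_period_def)
  have fd: "f = homogenize n (dehom f)" and deg: "degree (dehom f) \<le> n" using forms_dehom[OF f(1)] by auto
  have nz: "dehom f \<noteq> 0" using fd f(2) by (auto simp: homogenize_def)
  have "poly (map_poly to_ac (dehom f)) z = 0"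
    using root form_eval_1_homogenize[OF deg, of z] fd by simp
  then obtain v where v: "dehom f = min_poly n z * v" using min_poly_dvd[OF per n] by blast
  then have "degree v = 0" using deg nz degree_min_poly[OF cyc n] by (auto simp: degree_mult_eq)
  then obtain c where "v = [:c:]" by (auto elim: degree_eq_zeroE)
  then have c: "dehom f = smult c (min_poly n z)" using v by simp
  then have "f = const2 c * root_form n z" using fd by (simp add: homogenize_smult root_form_def)
  moreover have "c \<noteq> 0" using c nz by auto
  ultimately show thesis using that by blast
qed

text \<open>
  The form is monic in \<open>y\<close>. In a factorization the leading coefficients are therefore units, so setting
  \<open>x = 1\<close> exposes the full degrees in \<open>y\<close>. The factor that vanishes at \<open>z\<close> has degree \<open>n\<close>, and the other
  one equals its leading coefficient.
\<close>
lemma irreducible_root_form: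
  fixes z :: "'a alg_closure"
  assumes per: "has_period frob n z" and n: "n > 0"
  shows "irreducible (root_form n z)"
proof (rule irreducibleI)
  have cyc: "(frob ^^ n) z = z" using per by (simp add: has_period_def)
  note deg = degree_min_poly[OF cyc n]
  have lead: "coeff (root_form n z) n = 1"
    using deg by (simp add: root_form_def coeff_homogenize)
  show nz: "root_form n z \<noteq> 0" using lead by auto
  have "degree (root_form n z) \<le> n"
    by (rule degree_le) (simp add: root_form_def coeff_homogenize)
  moreover have "degree (root_form n z) \<ge> n" by (rule le_degree) (simp add: lead)
  ultimately have rdeg: "degree (root_form n z) = n" by simp
  show "\<not> is_unit (root_form n z)" using is_unit_homogenize n unfolding root_form_def by blast
  fix g h assume gh: "root_form n z = g * h"
  have *: "is_unit h" if gh: "root_form n z = g * h" and root: "poly (map_poly to_ac (dehom g)) z = 0" for g h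
  proof -
    have "g \<noteq> 0" "h \<noteq> 0" using gh nz by auto
    then have sum: "degree g + degree h = n" using gh rdeg by (simp add: degree_mult_eq)
    have "lead_coeff g * lead_coeff h = 1"
      using lead rdeg gh by (metis lead_coeff_mult)
    then have lh: "is_unit (lead_coeff h)" by (metis dvd_triv_right)
    have "dehom g * dehom h = min_poly n z"
      using root_form_in_forms[OF cyc n] gh by (simp add: dehom_mult)
    then have "dehom g \<noteq> 0" using deg by auto
    moreover have "min_poly n z dvd dehom g" by (rule min_poly_dvd[OF per n root])
    ultimately have "n \<le> degree (dehom g)" using deg(1) dvd_imp_degree_le by metis
    then have "degree h = 0" using sum degree_dehom_le[of g] by simp
    then obtain q where "h = [:q:]" by (auto elim: degree_eq_zeroE)
    then show ?thesis using lh by (simp add: is_unit_const_poly_iff)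
  qed
  have "map_poly to_ac (dehom g) * map_poly to_ac (dehom h) = frob_poly n z"
    using root_form_in_forms(2)[OF cyc n] gh map_min_poly[OF cyc n] by (simp add: dehom_mult flip: map_poly_to_ac_mult)
  then have "poly (map_poly to_ac (dehom g)) z * poly (map_poly to_ac (dehom h)) z = 0"
    using poly_frob_poly_eq_0_iff[of n z z] n by (auto simp flip: poly_mult intro!: exI[of _ 0])
  then show "is_unit g \<or> is_unit h"
    using *[of g h] *[of h g] gh by (auto simp: mult.commute)
qed

text \<open>
  If the degree in \<open>y\<close> were less than \<open>n\<close>, then \<open>x\<close> would be a factor. Otherwise the minimal polynomial of
  a root splits off after setting \<open>x = 1\<close>, and its homogenization splits off from the form.
\<close>
lemma irreducible_form_root:
  fixes f :: "'a poly poly"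
  assumes n: "n > 1" and f: "f \<in> forms n" "irreducible f"
  obtains z c where "has_period frob n z" "c \<noteq> 0" "f = const2 c * root_form n z"
proof -
  define m where "m = dehom f"
  have fm: "f = homogenize n m" and deg: "degree m \<le> n" using forms_dehom[OF f(1)] by (auto simp: m_def)
  have f0: "f \<noteq> 0" using f(2) by auto
  have m0: "m \<noteq> 0" using fm f0 by (auto simp: homogenize_def)
  have factor: "degree u + degree v = n \<Longrightarrow> m = u * v \<Longrightarrow> degree u = 0 \<or> degree v = 0" for u v
  proof -
    assume uv: "degree u + degree v = n" "m = u * v"
    then have "f = homogenize (degree u) u * homogenize (degree v) v"
      using homogenize_mult[of u "degree u" v "degree v"] fm by simp
    from irreducibleD[OF f(2) this] show ?thesis
      by (elim disjE) (drule is_unit_homogenize, simp)+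
  qed
  have "degree m = n"
  proof (rule ccontr)
    assume "degree m \<noteq> n"
    then have "degree m \<le> n - 1" using deg by simp
    then have "homogenize (1 + (n - 1)) (1 * m) = homogenize 1 1 * homogenize (n - 1) m"
      by (intro homogenize_mult) auto
    then have "f = homogenize 1 1 * homogenize (n - 1) m" using fm n by simp
    then have "is_unit (homogenize 1 1 :: 'a poly poly) \<or> is_unit (homogenize (n - 1) m)"
      by (rule irreducibleD[OF f(2)])
    then show False
    proof
      assume "is_unit (homogenize 1 1 :: 'a poly poly)"
      then have "(1 :: nat) = 0" by (rule is_unit_homogenize)
      then show False by simp
    next
      assume "is_unit (homogenize (n - 1) m)"
      then have "n - 1 = 0" by (rule is_unit_homogenize)
      then show False using n by simp
    qed
  qed
  then have "degree (map_poly to_ac m) > 0" using n by (simp add: degree_map_poly)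
  then obtain z where z: "poly (map_poly to_ac m) z = 0" using alg_closed_imp_poly_has_root by blast
  obtain d where d: "d > 0" "has_period frob d z" using periodic_root[OF m0 z] .
  then obtain v where v: "m = min_poly d z * v" using min_poly_dvd[OF d(2,1) z] by blast
  have cyc: "(frob ^^ d) z = z" using d by (simp add: has_period_def)
  note dm = degree_min_poly[OF cyc d(1)]
  have "degree (min_poly d z) + degree v = n"
    using v m0 \<open>degree m = n\<close> by (auto simp: degree_mult_eq)
  then have "degree v = 0" "d = n" using factor[OF _ v] dm(1) d(1) by auto
  then obtain c where "v = [:c:]" by (auto elim: degree_eq_zeroE)
  then have c: "m = smult c (min_poly n z)" using v \<open>d = n\<close> by simp
  then have "f = const2 c * root_form n z" using fm by (simp add: homogenize_smult root_form_def)
  moreover have "c \<noteq> 0" using c m0 by auto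
  ultimately show thesis using that d(2) \<open>d = n\<close> by blast
qed

lemma irreducible_form_classes:
  assumes n: "n > 1"
  shows "irreducible_forms n // proportional = root_class n ` {z :: 'a alg_closure. has_period frob n z}"
proof (intro equalityI subsetI)
  fix K :: "'a poly poly set" assume "K \<in> irreducible_forms n // proportional"
  then obtain f where f: "f \<in> irreducible_forms n" "K = nonzero_multiples f"
    by (auto simp: quotient_def proportional_class)
  then have "f \<in> forms n" "irreducible f" by (auto simp: irreducible_forms_def binary_form_iff)
  then obtain z c where zc: "has_period frob n z" "c \<noteq> 0" "f = const2 c * root_form n z"
    using irreducible_form_root[OF n] by blast
  then show "K \<in> root_class n ` {z. has_period frob n z}"
    using f(2) by (auto simp: root_class_def nonzero_multiples_scale)
next
  fix K :: "'a poly poly set" assume "K \<in> root_class n ` {z. has_period frob n z}"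
  then obtain z where z: "has_period frob n z" "K = root_class n z" by blast
  have "(frob ^^ n) z = z" using z by (simp add: has_period_def)
  then have "root_form n z \<in> irreducible_forms n"
    using irreducible_root_form[OF z(1)] root_form_in_forms(1) n
    by (auto simp: irreducible_forms_def binary_form_iff)
  then show "K \<in> irreducible_forms n // proportional"
    unfolding quotient_def proportional_class z(2) root_class_def by blast
qed

lemma root_class_eq_iff:
  fixes y z :: "'a alg_closure"
  assumes y: "has_period frob n y" and z: "has_period frob n z" and n: "n > 0"
  shows "root_class n y = root_class n z \<longleftrightarrow> (\<exists>i. y = (frob ^^ i) z)"
proof
  have cz: "(frob ^^ n) z = z" and cy: "(frob ^^ n) y = y" using y z by (auto simp: has_period_def)
  assume "root_class n y = root_class n z"
  moreover have "root_form n y \<in> root_class n y"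
    by (auto simp: root_class_def nonzero_multiples_def intro!: exI[of _ 1])
  ultimately obtain c where c: "c \<noteq> 0" "root_form n y = const2 c * root_form n z"
    by (auto simp: root_class_def nonzero_multiples_def)
  have "form_eval (root_form n y) 1 y = 0" using root_form_root[OF cy n] n by (auto intro!: exI[of _ 0])
  then have "form_eval (root_form n z) 1 y = 0" using c by (simp add: form_eval_mult)
  then show "\<exists>i. y = (frob ^^ i) z" using root_form_root[OF cz n] by blast
next
  have cz: "(frob ^^ n) z = z" and cy: "(frob ^^ n) y = y" using y z by (auto simp: has_period_def)
  assume "\<exists>i. y = (frob ^^ i) z"
  then obtain i where "y = (frob ^^ i) z" by blast
  then have "y = (frob ^^ (i mod n)) z" using funpow_mod_fixed[OF cz] by simp
  then have root: "form_eval (root_form n z) 1 y = 0" using root_form_root[OF cz n] n by (auto intro: mod_less_divisor)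
  have "irreducible (root_form n z)" using irreducible_root_form[OF z n] .
  then have "root_form n z \<noteq> 0" by auto
  then obtain c where "c \<noteq> 0" "root_form n z = const2 c * root_form n y"
    using form_with_root[OF y n root_form_in_forms(1)[OF cz n] _ root] by blast
  then show "root_class n y = root_class n z" by (simp add: root_class_def nonzero_multiples_scale)
qed

lemma has_period_mob:
  fixes z :: "'a alg_closure"
  assumes det: "a * d - b * c \<noteq> 0" and z: "has_period frob n z" "n > 1"
  shows "has_period frob n (mob a b c d z)"
proof -
  have zF: "z \<notin> range to_ac" using frob_period_notin_base[OF prime_card z] .
  have "(frob ^^ j) (mob a b c d z) = mob a b c d z \<longleftrightarrow> (frob ^^ j) z = z" for j
  proof
    have jF: "(frob ^^ j) z \<notin> range to_ac" using zF by (induction j) (auto simp: frob_in_base_iff[OF prime_card])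
    assume "(frob ^^ j) (mob a b c d z) = mob a b c d z"
    then have "mob a b c d ((frob ^^ j) z) = mob a b c d z" by (simp add: funpow_frob_mob[OF prime_card])
    then show "(frob ^^ j) z = z" using mob_inverse[OF det jF] mob_inverse[OF det zF] by metis
  qed (simp add: funpow_frob_mob[OF prime_card])
  then show ?thesis using z by (simp add: has_period_def)
qed

text \<open>
  By homogeneity the transformed form vanishes at \<open>z\<close>, and \<open>form_with_root\<close> identifies it once it is known
  to be nonzero. Its value at the preimage of a point outside the base field that is not a root of
  the original form shows this.
\<close>
lemma form_act_root_class:
  fixes g :: "'a ^ 2 ^ 2"
  assumes det: "g $ 1 $ 1 * g $ 2 $ 2 - g $ 1 $ 2 * g $ 2 $ 1 \<noteq> 0"
    and z: "has_period frob n z" and n: "n > 1"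
  shows "form_act g ` root_class n (mob_mat g z) = root_class n z"
proof -
  define w where "w = mob_mat g z"
  define F where "F = root_form n w"
  have w: "has_period frob n w" unfolding w_def by (rule has_period_mob[OF det z n])
  then have cw: "(frob ^^ n) w = w" by (simp add: has_period_def)
  have n0: "n > 0" using n by simp
  have F: "F \<in> forms n" unfolding F_def by (rule root_form_in_forms(1)[OF cw n0])
  have eval: "form_eval (form_act g F) 1 y = (to_ac (g $ 1 $ 1) + to_ac (g $ 1 $ 2) * y) ^ n * form_eval F 1 (mob_mat g y)"
    if y: "y \<notin> range to_ac" for y
  proof -
    define s where "s = to_ac (g $ 1 $ 1) + to_ac (g $ 1 $ 2) * y"
    have s: "s \<noteq> 0" unfolding s_def by (rule mob_denom_nonzero[OF det y])
    then have "to_ac (g $ 2 $ 1) + to_ac (g $ 2 $ 2) * y = s * mob_mat g y"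
      by (simp add: mob_def s_def)
    then have "form_eval (form_act g F) 1 y = form_eval F (s * 1) (s * mob_mat g y)"
      unfolding form_eval_act[OF F] by (simp add: s_def)
    then show ?thesis unfolding form_eval_scale[OF F] s_def .
  qed
  have zF: "z \<notin> range to_ac" using frob_period_notin_base[OF prime_card z n] .
  have "form_eval F 1 w = 0" unfolding F_def root_form_root[OF cw n0] using n0 by (auto intro!: exI[of _ 0])
  then have root: "form_eval (form_act g F) 1 z = 0" using eval[OF zF] by (simp add: w_def)
  have nonzero: "form_act g F \<noteq> 0"
  proof -
    have "finite (range to_ac \<union> (\<lambda>i. (frob ^^ i) w) ` {..<n})" by simp
    then obtain v where v: "v \<notin> range to_ac" "v \<notin> (\<lambda>i. (frob ^^ i) w) ` {..<n}"
      using ex_new_if_finite[OF infinite_alg_closed] by (metis UnCI)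
    have det': "g $ 2 $ 2 * g $ 1 $ 1 - (- (g $ 1 $ 2)) * (- (g $ 2 $ 1)) \<noteq> 0"
      using det by (simp add: mult.commute)
    define y where "y = mob (g $ 2 $ 2) (- (g $ 1 $ 2)) (- (g $ 2 $ 1)) (g $ 1 $ 1) v"
    have y: "y \<notin> range to_ac" unfolding y_def by (rule mob_notin_base[OF det' v(1)])
    have "mob_mat g y = v" using mob_inverse[OF det' v(1)] by (simp add: y_def)
    moreover have "form_eval F 1 v \<noteq> 0" unfolding F_def root_form_root[OF cw n0] using v(2) by blast
    ultimately have "form_eval (form_act g F) 1 y \<noteq> 0"
      using eval[OF y] mob_denom_nonzero[OF det y] by simp
    then show ?thesis by auto
  qed
  obtain c where c: "c \<noteq> 0" "form_act g F = const2 c * root_form n z"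
    using form_with_root[OF z n0 form_act_in_forms[OF F] nonzero root] .
  have "form_act g ` root_class n w = nonzero_multiples (form_act g F)"
    unfolding root_class_def nonzero_multiples_def F_def[symmetric] setcompr_eq_image image_image
      form_act_scale[OF F] ..
  also have "\<dots> = root_class n z" using c by (simp add: root_class_def nonzero_multiples_scale)
  finally show ?thesis by (simp add: w_def)
qed

end

section \<open>Burnside's lemma for forms\<close>

lemma invertible_iff_det2:
  fixes g :: "'a::field ^ 2 ^ 2"
  shows "invertible g \<longleftrightarrow> g $ 1 $ 1 * g $ 2 $ 2 - g $ 1 $ 2 * g $ 2 $ 1 \<noteq> 0"
  by (simp add: invertible_det_nz det_2)

lemma group_GL2: "group (GL2 :: ('a::field ^ 2 ^ 2) monoid)"
proof (rule groupI)
  show "\<one>\<^bsub>GL2\<^esub> \<in> carrier (GL2 :: ('a ^ 2 ^ 2) monoid)"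
    by (simp add: GL2_def invertible_def exI[of _ "mat 1"])
  fix x :: "'a ^ 2 ^ 2" assume x: "x \<in> carrier GL2"
  show "\<one>\<^bsub>GL2\<^esub> \<otimes>\<^bsub>GL2\<^esub> x = x" by (simp add: GL2_def)
  from x obtain y where y: "x ** y = mat 1" "y ** x = mat 1" by (auto simp: GL2_def invertible_def)
  then have "y \<in> carrier GL2" "y \<otimes>\<^bsub>GL2\<^esub> x = \<one>\<^bsub>GL2\<^esub>"
    by (auto simp: GL2_def invertible_def)
  then show "\<exists>y\<in>carrier GL2. y \<otimes>\<^bsub>GL2\<^esub> x = \<one>\<^bsub>GL2\<^esub>" by blast
  fix y :: "'a ^ 2 ^ 2" assume "y \<in> carrier GL2"
  then show "x \<otimes>\<^bsub>GL2\<^esub> y \<in> carrier GL2" using x by (simp add: GL2_def invertible_mult)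
  fix z :: "'a ^ 2 ^ 2"
  show "x \<otimes>\<^bsub>GL2\<^esub> y \<otimes>\<^bsub>GL2\<^esub> z = x \<otimes>\<^bsub>GL2\<^esub> (y \<otimes>\<^bsub>GL2\<^esub> z)"
    by (simp add: GL2_def matrix_mul_assoc)
qed

lemma mob_mat_mult:
  fixes g h :: "'a::field ^ 2 ^ 2"
  assumes "invertible h" "z \<notin> range to_ac"
  shows "mob_mat (g ** h) z = mob_mat g (mob_mat h z)"
proof -
  have "to_ac (h $ 1 $ 1) + to_ac (h $ 1 $ 2) * z \<noteq> 0"
    using assms by (intro mob_denom_nonzero) (auto simp: invertible_iff_det2)
  from mob_comp[OF this] show ?thesis by (simp add: matrix_matrix_mult_def sum_2)
qed

context
  assumes prime_card: "prime CARD('a::{field,finite})"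
begin

context
  fixes n :: nat
  assumes n: "n > 1"
begin

definition points :: "'a alg_closure set"
  where "points = {z. has_period frob n z}"

definition form_classes :: "'a poly poly set set"
  where "form_classes = root_class n ` points"

text \<open>
  The inverse turns the right action on forms into a left action with the same orbits.
\<close>
definition left_act :: "'a ^ 2 ^ 2 \<Rightarrow> 'a poly poly set \<Rightarrow> 'a poly poly set"
  where "left_act g = (\<lambda>K\<in>form_classes. form_act (inv\<^bsub>GL2\<^esub> g) ` K)"

lemma finite_points: "finite points"
proof (rule finite_subset)
  show "points \<subseteq> {z. (frob ^^ n) z = z}" by (simp add: points_def has_period_def subset_iff)
  show "finite {z :: 'a alg_closure. (frob ^^ n) z = z}"
    using finite_frob_fixed(1)[OF prime_card] n by simp
qed

lemma points_notin_base: "z \<in> points \<Longrightarrow> z \<notin> range to_ac"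
  using frob_period_notin_base[OF prime_card _ n] by (auto simp: points_def)

lemma mob_mat_points: "g \<in> carrier GL2 \<Longrightarrow> z \<in> points \<Longrightarrow> mob_mat g z \<in> points"
  unfolding points_def GL2_def using has_period_mob[OF prime_card _ _ n] by (simp add: invertible_iff_det2)

lemma mob_mat_GL2:
  fixes g h :: "'a ^ 2 ^ 2"
  assumes "g \<in> carrier GL2" "h \<in> carrier GL2" "z \<in> points"
  shows "mob_mat (g \<otimes>\<^bsub>GL2\<^esub> h) z = mob_mat g (mob_mat h z)"
  using mob_mat_mult[of h z g] assms points_notin_base by (simp add: GL2_def)

lemma mob_mat_one: "mob_mat (\<one>\<^bsub>GL2\<^esub> :: 'a ^ 2 ^ 2) z = z"
  by (simp add: GL2_def mat_def mob_scalar)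

lemma left_act_root_class:
  fixes g :: "'a ^ 2 ^ 2"
  assumes g: "g \<in> carrier GL2" and z: "z \<in> points"
  shows "left_act g (root_class n z) = root_class n (mob_mat g z)"
proof -
  interpret group "GL2 :: ('a ^ 2 ^ 2) monoid" by (rule group_GL2)
  let ?h = "inv\<^bsub>GL2\<^esub> g"
  have h: "?h \<in> carrier GL2" using g by simp
  have "form_act ?h ` root_class n (mob_mat ?h (mob_mat g z)) = root_class n (mob_mat g z)"
    using mob_mat_points[OF g z] h n
    by (intro form_act_root_class[OF prime_card]) (auto simp: points_def GL2_def invertible_iff_det2)
  moreover have "mob_mat ?h (mob_mat g z) = z"
    using mob_mat_GL2[OF h g z] g by (simp add: mob_mat_one)
  ultimately show ?thesis using z by (simp add: left_act_def form_classes_def)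
qed

lemma left_act_closed: "g \<in> carrier GL2 \<Longrightarrow> K \<in> form_classes \<Longrightarrow> left_act g K \<in> form_classes"
  using left_act_root_class mob_mat_points by (auto simp: form_classes_def)

lemma left_act_mult:
  fixes g h :: "'a ^ 2 ^ 2"
  assumes gh: "g \<in> carrier GL2" "h \<in> carrier GL2" and K: "K \<in> form_classes"
  shows "left_act (g \<otimes>\<^bsub>GL2\<^esub> h) K = left_act g (left_act h K)"
proof -
  interpret group "GL2 :: ('a ^ 2 ^ 2) monoid" by (rule group_GL2)
  obtain z where z: "z \<in> points" "K = root_class n z" using K by (auto simp: form_classes_def)
  show ?thesis
    unfolding z(2) left_act_root_class[OF gh(2) z(1)] left_act_root_class[OF m_closed[OF gh] z(1)]
      left_act_root_class[OF gh(1) mob_mat_points[OF gh(2) z(1)]] mob_mat_GL2[OF gh z(1)] ..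
qed

lemma left_act_one: "K \<in> form_classes \<Longrightarrow> left_act \<one>\<^bsub>GL2\<^esub> K = K"
  using left_act_root_class[OF monoid.one_closed[OF group.is_monoid[OF group_GL2]]]
  by (auto simp: form_classes_def mob_mat_one)

lemma left_action: "group_action GL2 form_classes left_act"
proof -
  interpret group "GL2 :: ('a ^ 2 ^ 2) monoid" by (rule group_GL2)
  have bij: "left_act g \<in> Bij form_classes" if g: "g \<in> carrier GL2" for g
  proof -
    have "bij_betw (left_act g) form_classes form_classes"
    proof (rule bij_betwI[where g = "left_act (inv\<^bsub>GL2\<^esub> g)"])
      show "left_act g \<in> form_classes \<rightarrow> form_classes" using left_act_closed g by blast
      show "left_act (inv\<^bsub>GL2\<^esub> g) \<in> form_classes \<rightarrow> form_classes" using left_act_closed g by blast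
      show "left_act (inv\<^bsub>GL2\<^esub> g) (left_act g K) = K" if "K \<in> form_classes" for K
        using that g left_act_mult[of "inv\<^bsub>GL2\<^esub> g" g K] by (simp add: left_act_one)
      show "left_act g (left_act (inv\<^bsub>GL2\<^esub> g) K) = K" if "K \<in> form_classes" for K
        using that g left_act_mult[of g "inv\<^bsub>GL2\<^esub> g" K] by (simp add: left_act_one)
    qed
    then show ?thesis by (simp add: Bij_def left_act_def)
  qed
  have "left_act \<in> hom GL2 (BijGroup form_classes)"
  proof (rule homI)
    show "left_act g \<in> carrier (BijGroup form_classes)" if "g \<in> carrier GL2" for g
      using bij[OF that] by (simp add: BijGroup_def)
    fix g h :: "'a ^ 2 ^ 2" assume gh: "g \<in> carrier GL2" "h \<in> carrier GL2"
    have "left_act (g \<otimes>\<^bsub>GL2\<^esub> h) = compose form_classes (left_act g) (left_act h)"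
    proof
      fix K
      show "left_act (g \<otimes>\<^bsub>GL2\<^esub> h) K = compose form_classes (left_act g) (left_act h) K"
        using left_act_mult[OF gh] by (cases "K \<in> form_classes") (simp_all add: compose_def left_act_def)
    qed
    then show "left_act (g \<otimes>\<^bsub>GL2\<^esub> h) = left_act g \<otimes>\<^bsub>BijGroup form_classes\<^esub> left_act h"
      using bij gh by (simp add: BijGroup_def)
  qed
  then show ?thesis
    by (simp add: group_action_def group_hom_def group_hom_axioms_def group_GL2 group_BijGroup)
qed

lemma form_orbits_eq: "form_orbits n = orbits GL2 form_classes left_act"
proof -
  interpret group "GL2 :: ('a ^ 2 ^ 2) monoid" by (rule group_GL2)
  have "orbit GL2 (\<lambda>g K. form_act g ` K) K = orbit GL2 left_act K" if K: "K \<in> form_classes" for K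
  proof (intro equalityI subsetI)
    fix L assume "L \<in> orbit GL2 (\<lambda>g K. form_act g ` K) K"
    then obtain g where g: "g \<in> carrier GL2" "L = form_act g ` K" by (auto simp: orbit_def)
    then have "inv\<^bsub>GL2\<^esub> g \<in> carrier GL2" "L = left_act (inv\<^bsub>GL2\<^esub> g) K"
      using K by (auto simp: left_act_def)
    then show "L \<in> orbit GL2 left_act K" by (auto simp: orbit_def)
  next
    fix L assume "L \<in> orbit GL2 left_act K"
    then obtain g where g: "g \<in> carrier GL2" "L = left_act g K" by (auto simp: orbit_def)
    then have "inv\<^bsub>GL2\<^esub> g \<in> carrier GL2" "L = form_act (inv\<^bsub>GL2\<^esub> g) ` K"
      using K by (auto simp: left_act_def)
    then show "L \<in> orbit GL2 (\<lambda>g K. form_act g ` K) K" by (auto simp: orbit_def)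
  qed
  moreover have "irreducible_forms n // proportional = form_classes"
    unfolding form_classes_def points_def by (rule irreducible_form_classes[OF prime_card n])
  ultimately show ?thesis unfolding form_orbits_def orbits_def by fastforce
qed

text \<open>
  A class is invariant if and only if the matrix moves one of its \<open>n\<close> roots, hence all of them, inside
  their common Frobenius orbit.
\<close>
lemma card_invariants:
  fixes g :: "'a ^ 2 ^ 2"
  assumes g: "g \<in> carrier GL2"
  shows "n * card (invariants form_classes left_act g) =
    card {z. has_period frob n z \<and> (\<exists>i. mob_mat g z = (frob ^^ i) z)}"
proof -
  define W where "W = {z. has_period frob n z \<and> (\<exists>i. mob_mat g z = (frob ^^ i) z)}"
  have W: "W = {z \<in> points. root_class n z \<in> invariants form_classes left_act g}"
  proof -
    have "(\<exists>i. mob_mat g z = (frob ^^ i) z) \<longleftrightarrow> root_class n z \<in> invariants form_classes left_act g"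
      if z: "z \<in> points" for z
    proof -
      have "(\<exists>i. mob_mat g z = (frob ^^ i) z) \<longleftrightarrow> root_class n (mob_mat g z) = root_class n z"
        using root_class_eq_iff[OF prime_card, of n "mob_mat g z" z] mob_mat_points[OF g z] z n
        by (simp add: points_def)
      then show ?thesis using z left_act_root_class[OF g z] by (simp add: invariants_def form_classes_def)
    qed
    then show ?thesis by (auto simp: W_def points_def)
  qed
  have finW: "finite W" unfolding W using finite_points by simp
  have image: "root_class n ` W = invariants form_classes left_act g"
    unfolding W by (auto simp: invariants_def form_classes_def)
  have fibre: "card {z \<in> W. root_class n z = K} = n" if K: "K \<in> root_class n ` W" for K
  proof -
    obtain z where z: "z \<in> W" "K = root_class n z" using K by blast
    have zp: "has_period frob n z" using z by (simp add: W_def)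
    have n0: "n > 0" using n by simp
    have "{y \<in> W. root_class n y = K} = {y \<in> points. root_class n y = root_class n z}"
      using z unfolding W by auto
    also have "\<dots> = (\<lambda>i. (frob ^^ i) z) ` {..<n}"
    proof (intro equalityI subsetI)
      fix y assume "y \<in> {y \<in> points. root_class n y = root_class n z}"
      then obtain i where i: "y = (frob ^^ i) z"
        using root_class_eq_iff[OF prime_card _ zp n0] by (auto simp: points_def)
      then have "y = (frob ^^ (i mod n)) z"
        using funpow_mod_fixed[of n frob z i] zp by (simp add: has_period_def)
      then show "y \<in> (\<lambda>i. (frob ^^ i) z) ` {..<n}" using n0 by (auto intro: mod_less_divisor)
    next
      fix y assume "y \<in> (\<lambda>i. (frob ^^ i) z) ` {..<n}"
      then obtain i where i: "y = (frob ^^ i) z" by blast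
      have "has_period frob n y"
      proof -
        have "(frob ^^ j) y = (frob ^^ i) ((frob ^^ j) z)" for j
        proof -
          have "(frob ^^ (j + i)) z = (frob ^^ (i + j)) z" by (simp only: add.commute)
          then show ?thesis unfolding i by (simp only: funpow_add comp_apply)
        qed
        then show ?thesis using zp unfolding has_period_def i by (simp add: funpow_frob_inj[OF prime_card])
      qed
      then show "y \<in> {y \<in> points. root_class n y = root_class n z}"
        using root_class_eq_iff[OF prime_card _ zp n0, of y] i by (auto simp: points_def)
    qed
    also have "card \<dots> = n"
      using funpow_eq_iff[OF zp n0] by (subst card_image) (auto simp: inj_on_def cong_def)
    finally show ?thesis .
  qed
  have "card W = (\<Sum>K\<in>root_class n ` W. card {z \<in> W. root_class n z = K})"
    using finW sum.group[of W "root_class n ` W" "root_class n" "\<lambda>_. 1 :: nat"] by simp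
  also have "\<dots> = (\<Sum>K\<in>root_class n ` W. n)" using fibre by (intro sum.cong) auto
  also have "\<dots> = n * card (invariants form_classes left_act g)" unfolding image by simp
  finally show ?thesis by (simp add: W_def)
qed

theorem card_form_orbits_burnside:
  "n * (card (form_orbits n :: 'a poly poly set set set) * card (carrier (GL2 :: ('a ^ 2 ^ 2) monoid))) =
    (\<Sum>g\<in>carrier GL2. card {z :: 'a alg_closure. has_period frob n z \<and> (\<exists>i. mob_mat g z = (frob ^^ i) z)})"
proof -
  interpret group_action "GL2 :: ('a ^ 2 ^ 2) monoid" form_classes left_act by (rule left_action)
  have "finite form_classes" using finite_points by (simp add: form_classes_def)
  then have "card (form_orbits n :: 'a poly poly set set set) * card (carrier (GL2 :: ('a ^ 2 ^ 2) monoid)) =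
      (\<Sum>g\<in>carrier GL2. card (invariants form_classes left_act g))"
    using burnside by (simp add: form_orbits_eq Coset.order_def)
  then show ?thesis using card_invariants by (simp add: sum_distrib_left)
qed

end

end

section \<open>Counting matrices by their eigenvalues\<close>

type_synonym 'a entries = "'a \<times> 'a \<times> 'a \<times> 'a"
type_synonym 'a eigenpair = "'a alg_closure \<times> 'a alg_closure"

lemma card_product_eq:
  fixes v :: "'a::{field,finite}"
  shows "card {(b :: 'a, c). b * c = v} = (if v = 0 then 2 * CARD('a) - 1 else CARD('a) - 1)"
proof (cases "v = 0")
  case True
  have "{(b :: 'a, c). b * c = v} = (\<lambda>c. (0, c)) ` UNIV \<union> (\<lambda>b. (b, 0)) ` (UNIV - {0})"
    using True by auto
  also have "card \<dots> = CARD('a) + (CARD('a) - 1)"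
    by (subst card_Un_disjoint) (auto simp: card_image inj_on_def card_Diff_singleton)
  finally show ?thesis using True by simp
next
  case False
  have "{(b :: 'a, c). b * c = v} = (\<lambda>b. (b, v / b)) ` (UNIV - {0})"
    using False by (auto simp: field_simps image_iff)
  also have "card \<dots> = CARD('a) - 1"
    by (subst card_image) (auto simp: inj_on_def card_Diff_singleton)
  finally show ?thesis using False by simp
qed

text \<open>
  The entry \<open>a\<close> determines \<open>d\<close> and the product \<open>b * c\<close>. This product is 0 exactly if \<open>a\<close> is an eigenvalue,
  and then there are \<open>q\<close> further choices of \<open>(b, c)\<close>, where \<open>q\<close> is the order of the field.
\<close>
lemma card_trace_det:
  fixes t D :: "'a::{field,finite}"
  shows "card {(a, b, c, d). a + d = t \<and> a * d - b * c = D} =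
    CARD('a) * (CARD('a) - 1) + CARD('a) * card {a. a * (t - a) = D}"
proof -
  let ?q = "CARD('a)"
  let ?R = "{a. a * (t - a) = D}"
  obtain r where r: "?q = Suc r" by (metis Suc_pred' finite_UNIV_card_ge_0 finite)
  have "bij_betw (\<lambda>(a, b, c). (a, b, c, t - a)) (SIGMA a:UNIV. {(b, c). b * c = a * (t - a) - D})
      {(a, b, c, d). a + d = t \<and> a * d - b * c = D}"
    by (rule bij_betwI[where g = "\<lambda>(a, b, c, d). (a, b, c)"]) (auto simp: algebra_simps)
  then have "card {(a, b, c, d). a + d = t \<and> a * d - b * c = D} =
      card (SIGMA a:UNIV. {(b, c). b * c = a * (t - a) - D})"
    by (simp add: bij_betw_same_card)
  also have "\<dots> = (\<Sum>a\<in>UNIV. card {(b, c). b * c = a * (t - a) - D})" by simp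
  also have "\<dots> = (\<Sum>a\<in>UNIV. (?q - 1) + (if a \<in> ?R then ?q else 0))"
    by (intro sum.cong refl) (simp add: card_product_eq r)
  also have "\<dots> = ?q * (?q - 1) + ?q * card ?R"
    unfolding sum.distrib by (simp add: sum.If_cases mult.commute)
  finally show ?thesis .
qed

text \<open>
  Singular matrices are counted by the common value of \<open>a * d\<close> and \<open>b * c\<close>, zero or not.
\<close>
lemma card_GL2_entries:
  "card {(a :: 'a::{field,finite}, b, c, d). a * d - b * c \<noteq> 0} = (CARD('a)\<^sup>2 - 1) * (CARD('a)\<^sup>2 - CARD('a))"
proof -
  let ?q = "CARD('a)"
  obtain r where r: "?q = Suc r" by (metis Suc_pred' finite_UNIV_card_ge_0 finite)
  have product: "card {(b :: 'a, c). b * c = v} = (if v = 0 then 2 * r + 1 else r)" for v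
    using card_product_eq[of v] by (simp add: r)
  have Z: "card {(a :: 'a, b, c, d). a * d - b * c = 0} = r * r * r + (2 * r + 1) * (2 * r + 1)"
  proof -
    have "bij_betw (\<lambda>((a, d), (b, c)). (a, b, c, d)) (SIGMA (a, d):UNIV. {(b, c). b * c = a * d})
        {(a :: 'a, b, c, d). a * d - b * c = 0}"
      by (rule bij_betwI[where g = "\<lambda>(a, b, c, d). ((a, d), (b, c))"]) auto
    then have "card {(a :: 'a, b, c, d). a * d - b * c = 0} =
        card (SIGMA (a, d):UNIV. {(b :: 'a, c). b * c = a * d})"
      by (simp add: bij_betw_same_card)
    also have "\<dots> = (\<Sum>(a, d)\<in>UNIV. card {(b :: 'a, c). b * c = a * d})"
      by (subst card_SigmaI) (auto simp: case_prod_unfold)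
    also have "\<dots> = (\<Sum>x\<in>UNIV. if x \<in> {(a :: 'a, d). a * d = 0} then 2 * r + 1 else r)"
      unfolding product by (intro sum.cong refl) (simp add: case_prod_unfold)
    also have "\<dots> = (2 * r + 1) * card {(a :: 'a, d). a * d = 0} + r * card (- {(a :: 'a, d). a * d = 0})"
      by (subst sum.If_cases) (auto simp: mult.commute)
    also have "card {(a :: 'a, d). a * d = 0} = 2 * r + 1" unfolding product by simp
    also have "card (- {(a :: 'a, d). a * d = 0}) = r * r"
      unfolding Compl_eq_Diff_UNIV card_Diff_subset[OF finite subset_UNIV] product by (simp add: r)
    finally show ?thesis by (simp add: algebra_simps)
  qed
  have "{(a :: 'a, b, c, d). a * d - b * c \<noteq> 0} = - {(a :: 'a, b, c, d). a * d - b * c = 0}" by auto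
  then have "card {(a :: 'a, b, c, d). a * d - b * c \<noteq> 0} =
      Suc r * (Suc r * (Suc r * Suc r)) - (r * r * r + (2 * r + 1) * (2 * r + 1))"
    using Z unfolding Compl_eq_Diff_UNIV by (simp add: card_Diff_subset r)
  also have "\<dots> = ((Suc r)\<^sup>2 - 1) * ((Suc r)\<^sup>2 - Suc r)"
  proof -
    have "(Suc r)\<^sup>2 - 1 = r * r + 2 * r" "(Suc r)\<^sup>2 - Suc r = r * r + r"
      by (simp_all add: power2_eq_square)
    moreover have "Suc r * (Suc r * (Suc r * Suc r)) =
        (r * r + 2 * r) * (r * r + r) + (r * r * r + (2 * r + 1) * (2 * r + 1))"
      by (simp add: algebra_simps)
    ultimately show ?thesis by simp
  qed
  finally show ?thesis by (simp add: r)
qed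

lemma bij_GL2_entries:
  "bij_betw (\<lambda>g. (g $ 1 $ 1, g $ 1 $ 2, g $ 2 $ 1, g $ 2 $ 2)) (carrier (GL2 :: ('a::field ^ 2 ^ 2) monoid))
    {(a, b, c, d). a * d - b * c \<noteq> 0}"
  by (rule bij_betwI[where g = "\<lambda>(a, b, c, d). vector [vector [a, b], vector [c, d]]"])
    (auto simp: GL2_def invertible_iff_det2 vec_eq_iff forall_2)

definition eigen_matrices :: "'a::field eigenpair \<Rightarrow> 'a entries set"
  where "eigen_matrices kl = {(a, b, c, d).
    to_ac (a + d) = fst kl + snd kl \<and> to_ac (a * d - b * c) = fst kl * snd kl}"

lemma card_eigen_matrices:
  fixes k l :: "'a::{field,finite} alg_closure"
  assumes "k + l \<in> range to_ac" "k * l \<in> range to_ac"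
  shows "card (eigen_matrices (k, l)) = CARD('a) * (CARD('a) - 1) + CARD('a) * card ({k, l} \<inter> range to_ac)"
proof -
  obtain t D where tD: "k + l = to_ac t" "k * l = to_ac D" using assms by blast
  have "a * (t - a) = D \<longleftrightarrow> to_ac a \<in> {k, l}" for a
  proof -
    have "a * (t - a) = D \<longleftrightarrow> to_ac (a * (t - a)) = to_ac D" by (simp only: to_ac_eq_iff)
    also have "\<dots> \<longleftrightarrow> to_ac a * (k + l - to_ac a) = k * l" by (simp add: tD)
    also have "\<dots> \<longleftrightarrow> (to_ac a - k) * (to_ac a - l) = 0" by (auto simp: algebra_simps)
    finally show ?thesis by simp
  qed
  then have "to_ac ` {a. a * (t - a) = D} = {k, l} \<inter> range to_ac" by auto
  then have "card {a. a * (t - a) = D} = card ({k, l} \<inter> range to_ac)"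
    using card_image[OF inj_on_subset[OF inj_to_ac subset_UNIV], of "{a. a * (t - a) = D}"] by simp
  moreover have "eigen_matrices (k, l) = {(a, b, c, d). a + d = t \<and> a * d - b * c = D}"
    by (simp only: eigen_matrices_def fst_conv snd_conv tD to_ac_eq_iff)
  ultimately show ?thesis by (simp only: card_trace_det)
qed

lemma sum_product_pair_unique:
  fixes k l k' l' :: "'b::field"
  assumes "k + l = k' + l'" "k * l = k' * l'"
  shows "(k' = k \<and> l' = l) \<or> (k' = l \<and> l' = k)"
proof -
  have "(k' - k) * (k' - l) = k' * k' - (k + l) * k' + k * l" by (simp add: algebra_simps)
  also have "\<dots> = 0" unfolding assms by (simp add: algebra_simps)
  finally have "k' = k \<or> k' = l" by auto
  then show ?thesis using assms(1) by auto
qed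

text \<open>
  Let \<open>q\<close> be the order of the base field. For \<open>e \<noteq> 1\<close> dividing \<open>q - 1\<close>, respectively \<open>q + 1\<close>, \<open>split_pairs e\<close>
  and \<open>conj_pairs e\<close> contain the ordered pairs of distinct eigenvalues, both in the base field or conjugate
  over it, of the invertible matrices that have order \<open>e\<close> modulo scalars.
\<close>
definition split_pairs :: "nat \<Rightarrow> 'a::{field,finite} eigenpair set"
  where "split_pairs e = {(k, l). k \<in> range to_ac \<and> l \<in> range to_ac \<and> l \<noteq> 0 \<and> mult_order (k / l) e}"

definition conj_pairs :: "nat \<Rightarrow> 'a::{field,finite} eigenpair set"
  where "conj_pairs e = {(k, l). l \<noteq> 0 \<and> k = frob l \<and> mult_order (k / l) e}"

context
  assumes prime_card: "prime CARD('a::{field,finite})"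
begin

lemma frob_over_self: "l \<noteq> 0 \<Longrightarrow> frob l / l = l ^ (CARD('a) - 1)" for l :: "'a alg_closure"
  unfolding frob_def using power_diff[of l 1 "CARD('a)"] by simp

lemma card_split_pairs:
  assumes e: "e dvd CARD('a) - 1"
  shows "card (split_pairs e :: 'a eigenpair set) = (CARD('a) - 1) * totient e"
proof -
  let ?q = "CARD('a)"
  have q: "?q > 1" using prime_card prime_gt_1_nat by blast
  have nz: "of_nat e \<noteq> (0 :: 'a alg_closure)"
  proof
    assume "of_nat e = (0 :: 'a alg_closure)"
    then have "?q dvd e" unfolding of_nat_ac_eq_0_iff[OF prime_card] .
    from dvd_trans[OF this e] have "?q dvd ?q - 1" .
    then show False using q by (auto dest: dvd_imp_le)
  qed
  have base: "w \<in> range to_ac" if "mult_order w e" for w :: "'a alg_closure"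
  proof -
    have "w ^ (?q - 1) = 1" using that e by (simp add: mult_order_def)
    then have "w ^ ?q = w" using power_minus_mult[of ?q w] q by simp
    then show ?thesis by (simp add: frob_def flip: frob_eq_iff)
  qed
  have "bij_betw (\<lambda>(w, l). (w * l, l)) ({w. mult_order w e} \<times> (range to_ac - {0})) (split_pairs e :: 'a eigenpair set)"
  proof (rule bij_betwI[where g = "\<lambda>(k, l). (k / l, l)"])
    show "(\<lambda>(w, l). (w * l, l)) \<in> {w. mult_order w e} \<times> (range to_ac - {0}) \<rightarrow> (split_pairs e :: 'a eigenpair set)"
    proof
      fix x :: "'a eigenpair"
      assume "x \<in> {w. mult_order w e} \<times> (range to_ac - {0})"
      then obtain w l where x: "x = (w, l)" "mult_order w e" "l \<in> range to_ac" "l \<noteq> 0" by blast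
      from base[OF x(2)] obtain w' where w': "w = to_ac w'" by (rule rangeE)
      from x(3) obtain l' where l': "l = to_ac l'" by (rule rangeE)
      have "w * l = to_ac (w' * l')" by (simp add: w' l')
      then have "w * l \<in> range to_ac" by (rule range_eqI)
      then show "(case x of (w, l) \<Rightarrow> (w * l, l)) \<in> (split_pairs e :: 'a eigenpair set)" using x by (simp add: split_pairs_def)
    qed
  qed (auto simp: split_pairs_def)
  then have "card (split_pairs e :: 'a eigenpair set) = card ({w :: 'a alg_closure. mult_order w e} \<times> (range to_ac - {0 :: 'a alg_closure}))"
    by (simp add: bij_betw_same_card)
  also have "\<dots> = totient e * card (range to_ac - {0 :: 'a alg_closure})"
    by (simp add: card_cartesian_product card_mult_order[OF nz])
  also have "card (range to_ac - {0 :: 'a alg_closure}) = ?q - 1"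
  proof -
    have "to_ac 0 \<in> range (to_ac :: 'a \<Rightarrow> 'a alg_closure)" by (rule rangeI)
    then have "(0 :: 'a alg_closure) \<in> range to_ac" by (simp only: to_ac_0)
    then show ?thesis by (simp only: card_Diff_singleton card_image[OF inj_to_ac])
  qed
  finally show ?thesis by (simp add: mult.commute)
qed

text \<open>
  The quotient of conjugates is \<open>l\<^sup>q\<^sup>-\<^sup>1\<close>, where \<open>q\<close> is the order of the base field, and each of the elements
  of order \<open>e\<close> has \<open>q - 1\<close> roots of this kind.
\<close>
lemma card_conj_pairs:
  assumes e: "e dvd CARD('a) + 1"
  shows "card (conj_pairs e :: 'a eigenpair set) = (CARD('a) - 1) * totient e"
proof -
  let ?q = "CARD('a)"
  have q: "?q > 1" using prime_card prime_gt_1_nat by blast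
  have nz: "of_nat e \<noteq> (0 :: 'a alg_closure)"
  proof
    assume "of_nat e = (0 :: 'a alg_closure)"
    then have "?q dvd e" unfolding of_nat_ac_eq_0_iff[OF prime_card] .
    from dvd_trans[OF this e] have "?q dvd ?q + 1" .
    then have "?q dvd 1" by (simp only: dvd_add_right_iff[OF dvd_refl])
    then show False using q by simp
  qed
  have nzq: "of_nat (?q - 1) \<noteq> (0 :: 'a alg_closure)"
    unfolding of_nat_ac_eq_0_iff[OF prime_card] using q by (auto dest: dvd_imp_le)
  have w0: "w \<noteq> 0" if "mult_order w e" for w :: "'a alg_closure"
  proof
    assume "w = 0"
    moreover have "e > 0" using nz by (cases e) simp_all
    ultimately show False using mult_orderD[OF that] by (simp add: power_0_left)
  qed
  have fin: "finite {l :: 'a alg_closure. l ^ (?q - 1) = w}" if "w \<noteq> 0" for w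
    using card_power_eq[OF nzq that] q by (intro card_ge_0_finite) simp
  have finw: "finite {w :: 'a alg_closure. mult_order w e}"
  proof (rule finite_subset)
    show "{w :: 'a alg_closure. mult_order w e} \<subseteq> {w. w ^ e = 1}"
      using mult_orderD by auto
    have "e > 0" using nz by (cases e) simp_all
    moreover have "card {w :: 'a alg_closure. w ^ e = 1} = e" using card_power_eq[OF nz] by simp
    ultimately show "finite {w :: 'a alg_closure. w ^ e = 1}" by (intro card_ge_0_finite) simp
  qed
  have "bij_betw (\<lambda>l. (frob l, l)) (\<Union>w\<in>{w. mult_order w e}. {l. l ^ (?q - 1) = w}) (conj_pairs e :: 'a eigenpair set)"
  proof (rule bij_betwI[where g = snd])
    have l0: "l \<noteq> 0" if "mult_order (l ^ (?q - 1)) e" for l :: "'a alg_closure"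
      using w0[OF that] q by (auto simp: power_0_left)
    show "(\<lambda>l. (frob l, l)) \<in> (\<Union>w\<in>{w. mult_order w e}. {l. l ^ (?q - 1) = w}) \<rightarrow> (conj_pairs e :: 'a eigenpair set)"
      using l0 by (auto simp: conj_pairs_def frob_over_self)
  qed (auto simp: conj_pairs_def frob_over_self)
  then have "card (conj_pairs e :: 'a eigenpair set) = card (\<Union>w\<in>{w :: 'a alg_closure. mult_order w e}. {l. l ^ (?q - 1) = w})"
    by (simp add: bij_betw_same_card)
  also have "\<dots> = (\<Sum>w | mult_order w e. card {l :: 'a alg_closure. l ^ (?q - 1) = w})"
    by (rule card_UN_disjoint) (use finw fin w0 in auto)
  also have "\<dots> = (\<Sum>w :: 'a alg_closure | mult_order w e. ?q - 1)"
    using w0 card_power_eq[OF nzq] by (intro sum.cong) auto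
  finally show ?thesis using card_mult_order[OF nz] by simp
qed

lemma conj_pairs_swap:
  fixes k l :: "'a alg_closure"
  assumes e: "e dvd CARD('a) + 1" and kl: "(k, l) \<in> conj_pairs e"
  shows "l = frob k"
proof -
  have l: "l \<noteq> 0" "k = frob l" "mult_order (k / l) e" using kl by (auto simp: conj_pairs_def)
  have k: "k \<noteq> 0" using l by (simp add: frob_def)
  have "(k / l) ^ (CARD('a) + 1) = 1" using l(3) e unfolding mult_order_def by blast
  then have "1 = (k / l) ^ (CARD('a) + 1)" by (rule sym)
  also have "\<dots> = frob (k / l) * (k / l)" by (simp add: frob_def)
  also have "frob (k / l) = frob k / k" unfolding frob_divide l(2)[symmetric] ..
  also have "frob k / k * (k / l) = frob k / l" using k by simp
  finally have "frob k / l = 1" by simp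
  then show ?thesis using l(1) by simp
qed

end

section \<open>Summation over the general linear group\<close>

lemma scalar_in_eigen_matrices: "(a, 0, 0, a) \<in> eigen_matrices (to_ac a, to_ac a)"
  by (simp add: eigen_matrices_def)

lemma eigen_matrices_unique:
  assumes "g \<in> eigen_matrices (k, l)" "g \<in> eigen_matrices (k', l')"
  shows "(k' = k \<and> l' = l) \<or> (k' = l \<and> l' = k)"
proof -
  obtain a b c d where g: "g = (a, b, c, d)" by (cases g)
  have "k + l = k' + l'" "k * l = k' * l'"
    using assms unfolding g eigen_matrices_def by simp_all
  then show ?thesis by (rule sum_product_pair_unique)
qed

lemma eigen_matrices_swap: "eigen_matrices (l, k) = eigen_matrices (k, l)"
  by (simp add: eigen_matrices_def add.commute mult.commute)

lemma eigenvalues_exist: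
  fixes g :: "'a::field entries"
  obtains k l where "g \<in> eigen_matrices (k, l)"
proof -
  obtain a b c d where g: "g = (a, b, c, d)" by (cases g)
  obtain k where k: "poly [:to_ac (a * d - b * c), - to_ac (a + d), 1:] k = 0"
    using alg_closed_imp_poly_has_root[of "[:to_ac (a * d - b * c), - to_ac (a + d), 1:]"] by auto
  then have "to_ac (a * d - b * c) = k * (to_ac (a + d) - k)"
    by (simp add: algebra_simps eq_neg_iff_add_eq_0)
  then show thesis using that[of k "to_ac (a + d) - k"] by (simp add: g eigen_matrices_def)
qed

definition GL2_entries :: "'a::{field,finite} entries set"
  where "GL2_entries = {(a, b, c, d). a * d - b * c \<noteq> 0}"

definition scalar_entries :: "'a::{field,finite} entries set"
  where "scalar_entries = (\<lambda>a. (a, 0, 0, a)) ` (UNIV - {0})"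

definition double_entries :: "'a::{field,finite} entries set"
  where "double_entries = (\<Union>a\<in>UNIV - {0}. eigen_matrices (to_ac a, to_ac a) - {(a, 0, 0, a)})"

definition distinct_entries :: "'a::{field,finite} entries set"
  where "distinct_entries = {g \<in> GL2_entries. \<exists>k l. k \<noteq> l \<and> g \<in> eigen_matrices (k, l)}"

definition eigen_pairs :: "'a::{field,finite} eigenpair set"
  where "eigen_pairs = (\<Union>e\<in>{e. e dvd CARD('a) - 1 \<and> e \<noteq> 1}. split_pairs e) \<union>
    (\<Union>e\<in>{e. e dvd CARD('a) + 1 \<and> e \<noteq> 1}. conj_pairs e)"

context
  assumes prime_card: "prime CARD('a::{field,finite})"
begin

lemma card_gt_1: "CARD('a) > 1"
  using prime_card prime_gt_1_nat by blast

lemma GL2_entries_eigen: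
  fixes g :: "'a entries"
  assumes "g \<in> eigen_matrices (k, l)"
  shows "g \<in> GL2_entries \<longleftrightarrow> k \<noteq> 0 \<and> l \<noteq> 0"
proof -
  obtain a b c d where g: "g = (a, b, c, d)" by (cases g)
  have "to_ac (a * d - b * c) = k * l" using assms by (simp add: g eigen_matrices_def)
  then have "a * d - b * c = 0 \<longleftrightarrow> k = 0 \<or> l = 0"
    by (metis mult_eq_0_iff to_ac_eq_0_iff)
  then show ?thesis by (simp add: g GL2_entries_def)
qed

lemma frob_eigenvalue:
  fixes g :: "'a entries"
  assumes "g \<in> eigen_matrices (k, l)"
  shows "frob k = k \<or> frob k = l"
proof -
  obtain a b c d where g: "g = (a, b, c, d)" by (cases g)
  have "to_ac (a + d) = k + l" "to_ac (a * d - b * c) = k * l"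
    using assms by (simp_all add: g eigen_matrices_def)
  then have "frob (k + l) = k + l" "frob (k * l) = k * l" by (metis frob_to_ac)+
  then have s: "frob k + frob l = k + l" and m: "frob k * frob l = k * l" by (simp_all add: frob_add[OF prime_card])
  from sum_product_pair_unique[OF s[symmetric] m[symmetric]] show ?thesis by blast
qed

text \<open>
  The Frobenius map either fixes both eigenvalues or exchanges them. Their quotient satisfies
  \<open>w\<^sup>q\<^sup>-\<^sup>1 = 1\<close> in the first case and \<open>w\<^sup>q\<^sup>+\<^sup>1 = 1\<close> in the second, with \<open>q\<close> the order of the base field.
\<close>
lemma eigen_pair_in_eigen_pairs:
  fixes g :: "'a entries"
  assumes g: "g \<in> eigen_matrices (k, l)" "g \<in> GL2_entries" and kl: "k \<noteq> l"
  shows "(k, l) \<in> eigen_pairs"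
proof -
  have nz: "k \<noteq> 0" "l \<noteq> 0" using GL2_entries_eigen[OF g(1)] g(2) by auto
  have fk: "frob k = k \<or> frob k = l" by (rule frob_eigenvalue[OF g(1)])
  have fl: "frob l = l \<or> frob l = k"
    by (rule frob_eigenvalue) (use g(1) in \<open>simp add: eigen_matrices_swap\<close>)
  have e1: "e \<noteq> 1" if "mult_order (k / l) e" for e
    using mult_orderD[OF that] nz kl by auto
  have fk_iff: "frob k = k \<longleftrightarrow> frob l = l"
    using fk fl kl by (metis frob_inj[OF prime_card])
  have pw: "k ^ (CARD('a) - 1) * k = frob k" "l ^ (CARD('a) - 1) * l = frob l"
    using power_minus_mult[of "CARD('a)" k] power_minus_mult[of "CARD('a)" l] card_gt_1
    by (simp_all add: frob_def)
  show ?thesis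
  proof (cases "frob k = k")
    case True
    then have l: "frob l = l" using fk_iff by simp
    have "k ^ (CARD('a) - 1) = 1" "l ^ (CARD('a) - 1) = 1" using pw True l nz by auto
    then have "(k / l) ^ (CARD('a) - 1) = 1" by (simp only: power_divide) simp
    then obtain e where e: "e dvd CARD('a) - 1" "mult_order (k / l) e"
      using mult_order_exists[of "CARD('a) - 1" "k / l"] card_gt_1 by auto
    then have "(k, l) \<in> split_pairs e"
      using True l nz by (simp add: split_pairs_def frob_eq_iff)
    then show ?thesis using e e1 unfolding eigen_pairs_def by blast
  next
    case False
    then have k: "frob k = l" and l: "frob l = k" using fk fl fk_iff by auto
    have "(k / l) ^ (CARD('a) + 1) = frob (k / l) * (k / l)" by (simp add: frob_def)
    also have "\<dots> = (l / k) * (k / l)" by (simp add: k l)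
    also have "\<dots> = 1" using nz by simp
    finally obtain e where e: "e dvd CARD('a) + 1" "mult_order (k / l) e"
      using mult_order_exists[of "CARD('a) + 1" "k / l"] by auto
    then have "(k, l) \<in> conj_pairs e" using l nz by (simp add: conj_pairs_def)
    then show ?thesis using e e1 unfolding eigen_pairs_def by blast
  qed
qed

lemma eigen_pairs_distinct:
  fixes k l :: "'a alg_closure"
  assumes "(k, l) \<in> eigen_pairs"
  shows "k \<noteq> l" "k \<noteq> 0" "l \<noteq> 0"
proof -
  have "\<exists>e. (e dvd CARD('a) - 1 \<or> e dvd CARD('a) + 1) \<and> e \<noteq> 1 \<and> mult_order (k / l) e \<and> l \<noteq> 0"
    using assms unfolding eigen_pairs_def split_pairs_def conj_pairs_def by blast
  then obtain e where e: "mult_order (k / l) e" "e \<noteq> 1" "l \<noteq> 0"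
    and dvd: "e dvd CARD('a) - 1 \<or> e dvd CARD('a) + 1" by blast
  have e0: "e \<noteq> 0" using dvd card_gt_1 by (intro notI) simp
  show "l \<noteq> 0" by (rule e)
  show "k \<noteq> l"
  proof
    assume "k = l"
    then have "(k / l) ^ 1 = 1" using e(3) by simp
    then have "e dvd 1" using e(1) unfolding mult_order_def by blast
    then show False using e(2) by simp
  qed
  show "k \<noteq> 0" using mult_orderD[OF e(1)] e0 by (auto simp: power_0_left)
qed

lemma finite_pairs:
  "e dvd CARD('a) - 1 \<Longrightarrow> finite (split_pairs e :: 'a eigenpair set)" "e dvd CARD('a) + 1 \<Longrightarrow> finite (conj_pairs e :: 'a eigenpair set)"
proof -
  assume e: "e dvd CARD('a) - 1"
  then have "e > 0" using card_gt_1 by (intro Nat.gr0I) simp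
  then have "card (split_pairs e :: 'a eigenpair set) > 0" using card_split_pairs[OF prime_card e] card_gt_1 by simp
  then show "finite (split_pairs e :: 'a eigenpair set)" by (rule card_ge_0_finite)
next
  assume e: "e dvd CARD('a) + 1"
  then have "e > 0" by (intro Nat.gr0I) simp
  then have "card (conj_pairs e :: 'a eigenpair set) > 0" using card_conj_pairs[OF prime_card e] card_gt_1 by simp
  then show "finite (conj_pairs e :: 'a eigenpair set)" by (rule card_ge_0_finite)
qed

lemma finite_divisors: "finite {e. e dvd CARD('a) - 1 \<and> e \<noteq> 1}" "finite {e. e dvd CARD('a) + 1 \<and> e \<noteq> 1}"
  using card_gt_1 by simp_all

lemma sum_eigen_pairs:
  fixes f :: "'a eigenpair \<Rightarrow> int"
  shows "(\<Sum>kl\<in>eigen_pairs. f kl) =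
    (\<Sum>e | e dvd CARD('a) - 1 \<and> e \<noteq> 1. \<Sum>kl\<in>split_pairs e. f kl) +
    (\<Sum>e | e dvd CARD('a) + 1 \<and> e \<noteq> 1. \<Sum>kl\<in>conj_pairs e. f kl)"
proof -
  let ?A = "\<Union>e\<in>{e. e dvd CARD('a) - 1 \<and> e \<noteq> 1}. split_pairs e :: 'a eigenpair set"
  let ?B = "\<Union>e\<in>{e. e dvd CARD('a) + 1 \<and> e \<noteq> 1}. conj_pairs e :: 'a eigenpair set"
  have "?A \<inter> ?B = {}"
  proof (rule equals0I)
    fix x assume x: "x \<in> ?A \<inter> ?B"
    obtain k l where kl: "x = (k, l)" by (cases x)
    have "(k, l) \<in> eigen_pairs" using x kl by (auto simp: eigen_pairs_def)
    then have "k \<noteq> l" by (rule eigen_pairs_distinct)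
    moreover have "l \<in> range to_ac" using x kl by (auto simp: split_pairs_def)
    then have "frob l = l" by (simp add: frob_eq_iff)
    moreover have "k = frob l" using x kl by (auto simp: conj_pairs_def)
    ultimately show False by simp
  qed
  moreover have "finite ?A" "finite ?B" using finite_pairs finite_divisors by auto
  ultimately have "(\<Sum>kl\<in>eigen_pairs. f kl) = sum f ?A + sum f ?B"
    unfolding eigen_pairs_def by (intro sum.union_disjoint)
  also have "sum f ?A = (\<Sum>e | e dvd CARD('a) - 1 \<and> e \<noteq> 1. \<Sum>kl\<in>split_pairs e. f kl)"
    by (rule sum.UNION_disjoint[OF finite_divisors(1)])
      (use finite_pairs in \<open>auto simp: split_pairs_def dest: mult_order_unique\<close>)
  also have "sum f ?B = (\<Sum>e | e dvd CARD('a) + 1 \<and> e \<noteq> 1. \<Sum>kl\<in>conj_pairs e. f kl)"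
    by (rule sum.UNION_disjoint[OF finite_divisors(2)])
      (use finite_pairs in \<open>auto simp: conj_pairs_def dest: mult_order_unique\<close>)
  finally show ?thesis .
qed

lemma finite_eigen_pairs: "finite (eigen_pairs :: 'a eigenpair set)"
  unfolding eigen_pairs_def using finite_pairs finite_divisors by auto

text \<open>
  The factor 2 is the number of orderings of the two eigenvalues.
\<close>
lemma sum_distinct_entries:
  fixes f :: "'a entries \<Rightarrow> int"
  shows "2 * (\<Sum>g\<in>distinct_entries. f g) = (\<Sum>kl\<in>eigen_pairs. \<Sum>g\<in>eigen_matrices kl. f g)"
proof -
  have sub: "eigen_matrices kl = {g \<in> GL2_entries. g \<in> eigen_matrices kl}" if "kl \<in> eigen_pairs" for kl :: "'a eigenpair"
  proof -
    obtain k l where kl: "kl = (k, l)" by (cases kl)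
    then have "k \<noteq> 0 \<and> l \<noteq> 0" using that eigen_pairs_distinct by blast
    then show ?thesis using GL2_entries_eigen kl by blast
  qed
  have "(\<Sum>kl\<in>eigen_pairs. \<Sum>g\<in>eigen_matrices kl. f g) =
      (\<Sum>kl\<in>eigen_pairs. \<Sum>g\<in>{g \<in> GL2_entries. g \<in> eigen_matrices kl}. f g)"
    using sub by (intro sum.cong refl) auto
  also have "\<dots> = (\<Sum>g\<in>GL2_entries. \<Sum>kl\<in>{kl \<in> eigen_pairs. g \<in> eigen_matrices kl}. f g)"
    by (rule sum.swap_restrict[OF finite_eigen_pairs]) simp
  also have "\<dots> = (\<Sum>g\<in>GL2_entries. if g \<in> distinct_entries then 2 * f g else 0)"
  proof (rule sum.cong[OF refl])
    fix g :: "'a entries" assume g: "g \<in> GL2_entries"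
    show "(\<Sum>kl\<in>{kl \<in> eigen_pairs. g \<in> eigen_matrices kl}. f g) = (if g \<in> distinct_entries then 2 * f g else 0)"
    proof (cases "g \<in> distinct_entries")
      case True
      then obtain k l where kl: "k \<noteq> l" "g \<in> eigen_matrices (k, l)" by (auto simp: distinct_entries_def)
      have 1: "(k, l) \<in> eigen_pairs" by (rule eigen_pair_in_eigen_pairs[OF kl(2) g kl(1)])
      have 2: "(l, k) \<in> eigen_pairs"
        by (rule eigen_pair_in_eigen_pairs[OF _ g]) (use kl in \<open>simp_all add: eigen_matrices_swap\<close>)
      have "{kl \<in> eigen_pairs. g \<in> eigen_matrices kl} = {(k, l), (l, k)}"
      proof (intro equalityI subsetI)
        fix x assume x: "x \<in> {kl \<in> eigen_pairs. g \<in> eigen_matrices kl}"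
        obtain k' l' where x': "x = (k', l')" by (cases x)
        then have "g \<in> eigen_matrices (k', l')" using x by simp
        from eigen_matrices_unique[OF kl(2) this] show "x \<in> {(k, l), (l, k)}" using x' by blast
      next
        fix x assume "x \<in> {(k, l), (l, k)}"
        then show "x \<in> {kl \<in> eigen_pairs. g \<in> eigen_matrices kl}"
          using 1 2 kl(2) eigen_matrices_swap[of l k] by auto
      qed
      then show ?thesis using True kl(1) by simp
    next
      case False
      then have empty: "{kl \<in> eigen_pairs. g \<in> eigen_matrices kl} = {}"
        using g eigen_pairs_distinct(1) unfolding distinct_entries_def by auto
      show ?thesis unfolding empty using False by simp
    qed
  qed
  also have "\<dots> = (\<Sum>g\<in>GL2_entries \<inter> distinct_entries. 2 * f g)" by (simp add: sum.inter_restrict)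
  also have "GL2_entries \<inter> distinct_entries = distinct_entries" by (auto simp: distinct_entries_def)
  finally show ?thesis by (simp add: sum_distrib_left)
qed

text \<open>
  A double eigenvalue is fixed by the Frobenius map, so it lies in the base field.
\<close>
lemma sum_GL2_entries:
  fixes f :: "'a entries \<Rightarrow> int"
  shows "(\<Sum>g\<in>GL2_entries. f g) =
    (\<Sum>g\<in>scalar_entries. f g) + (\<Sum>g\<in>double_entries. f g) + (\<Sum>g\<in>distinct_entries. f g)"
proof -
  have split: "(GL2_entries :: 'a entries set) = scalar_entries \<union> double_entries \<union> distinct_entries"
  proof (intro equalityI subsetI)
    fix g :: "'a entries" assume g: "g \<in> GL2_entries"
    obtain k l where kl: "g \<in> eigen_matrices (k, l)" by (rule eigenvalues_exist)
    show "g \<in> scalar_entries \<union> double_entries \<union> distinct_entries"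
    proof (cases "k = l")
      case False
      then show ?thesis using g kl by (auto simp: distinct_entries_def)
    next
      case True
      then have "frob k = k" using frob_eigenvalue[OF kl] by auto
      then obtain a where a: "k = to_ac a" unfolding frob_eq_iff by blast
      have "a \<noteq> 0" using GL2_entries_eigen[OF kl] g a by auto
      then show ?thesis using kl True a by (auto simp: scalar_entries_def double_entries_def)
    qed
  next
    fix g :: "'a entries" assume "g \<in> scalar_entries \<union> double_entries \<union> distinct_entries"
    moreover have "g \<in> GL2_entries" if "g \<in> double_entries"
      using that GL2_entries_eigen by (fastforce simp: double_entries_def)
    ultimately show "g \<in> GL2_entries"
      by (auto simp: scalar_entries_def distinct_entries_def GL2_entries_def)
  qed
  have disj1: "(scalar_entries :: 'a entries set) \<inter> double_entries = {}"
    using eigen_matrices_unique scalar_in_eigen_matrices by (fastforce simp: scalar_entries_def double_entries_def)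
  have disj2: "(scalar_entries \<union> double_entries :: 'a entries set) \<inter> distinct_entries = {}"
    using eigen_matrices_unique scalar_in_eigen_matrices
    by (fastforce simp: scalar_entries_def double_entries_def distinct_entries_def)
  show ?thesis
    unfolding split sum.union_disjoint[OF finite finite disj2] sum.union_disjoint[OF finite finite disj1] ..
qed

lemma sum_double_entries:
  fixes N :: int and f :: "'a entries \<Rightarrow> int"
  assumes "\<And>g. g \<in> double_entries \<Longrightarrow> f g = N"
  shows "(\<Sum>g\<in>double_entries. f g) = (int CARD('a) - 1) * ((int CARD('a))\<^sup>2 - 1) * N"
proof -
  let ?E = "\<lambda>a :: 'a. eigen_matrices (to_ac a, to_ac a) - {(a, 0, 0, a)}"
  have c: "int (card (?E a)) = (int CARD('a))\<^sup>2 - 1" for a :: 'a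
  proof -
    have "to_ac a + to_ac a \<in> range to_ac" "to_ac a * to_ac a \<in> range to_ac"
      by (metis to_ac_add rangeI, metis to_ac_mult rangeI)
    from card_eigen_matrices[OF this]
    have "card (eigen_matrices (to_ac a, to_ac a)) = CARD('a) * (CARD('a) - 1) + CARD('a) * 1" by simp
    also have "\<dots> = CARD('a) * CARD('a)" using card_gt_1 by (simp add: algebra_simps)
    finally have "card (?E a) = CARD('a) * CARD('a) - 1"
      using scalar_in_eigen_matrices[of a] by (simp add: card_Diff_singleton)
    then show ?thesis using card_gt_1 by (simp add: power2_eq_square of_nat_diff)
  qed
  have "(\<Sum>g\<in>double_entries. f g) = (\<Sum>g\<in>(double_entries :: 'a entries set). N)" using assms by simp
  also have "\<dots> = (\<Sum>a\<in>UNIV - {0 :: 'a}. \<Sum>g\<in>?E a. N)"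
    unfolding double_entries_def
  proof (rule sum.UNION_disjoint)
    show "\<forall>a\<in>UNIV - {0}. \<forall>b\<in>UNIV - {0}. a \<noteq> b \<longrightarrow> ?E a \<inter> ?E b = {}"
    proof (intro ballI impI equals0I)
      fix a b :: 'a and g assume "a \<noteq> b" "g \<in> ?E a \<inter> ?E b"
      then show False using eigen_matrices_unique[of g "to_ac a" "to_ac a" "to_ac b" "to_ac b"] by simp
    qed
  qed auto
  also have "\<dots> = (\<Sum>a\<in>UNIV - {0 :: 'a}. ((int CARD('a))\<^sup>2 - 1) * N)" by (simp add: c)
  also have "\<dots> = (int CARD('a) - 1) * ((int CARD('a))\<^sup>2 - 1) * N"
    using card_gt_1 by (simp add: card_Diff_singleton of_nat_diff)
  finally show ?thesis .
qed

lemma sum_scalar_entries: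
  fixes N :: int and f :: "'a entries \<Rightarrow> int"
  assumes "\<And>g. g \<in> scalar_entries \<Longrightarrow> f g = N"
  shows "(\<Sum>g\<in>scalar_entries. f g) = (int CARD('a) - 1) * N"
proof -
  have "card (scalar_entries :: 'a entries set) = CARD('a) - 1"
    unfolding scalar_entries_def by (subst card_image) (auto simp: inj_on_def card_Diff_singleton)
  then show ?thesis using assms card_gt_1 by (simp add: of_nat_diff)
qed

lemma sum_split_pairs:
  fixes N :: int and f :: "'a entries \<Rightarrow> int"
  assumes e: "e dvd CARD('a) - 1" "e \<noteq> 1"
    and f: "\<And>k l g. (k, l) \<in> split_pairs e \<Longrightarrow> g \<in> eigen_matrices (k, l) \<Longrightarrow> f g = N"
  shows "(\<Sum>kl\<in>split_pairs e. \<Sum>g\<in>eigen_matrices kl. f g) =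
    (int CARD('a) - 1) * int (totient e) * ((int CARD('a))\<^sup>2 + int CARD('a)) * N"
proof -
  have "(\<Sum>g\<in>eigen_matrices kl. f g) = ((int CARD('a))\<^sup>2 + int CARD('a)) * N" if "kl \<in> split_pairs e" for kl
  proof -
    obtain k l where kl: "kl = (k, l)" by (cases kl)
    then have klp: "(k, l) \<in> split_pairs e" using that by simp
    then have "(k, l) \<in> eigen_pairs" using e by (auto simp: eigen_pairs_def)
    then have "k \<noteq> l" by (rule eigen_pairs_distinct)
    obtain x y where xy: "k = to_ac x" "l = to_ac y" using klp by (auto simp: split_pairs_def)
    have "card ({k, l} \<inter> range to_ac) = 2" using \<open>k \<noteq> l\<close> xy by (simp add: Int_absorb2)
    moreover have "k + l \<in> range to_ac" "k * l \<in> range to_ac"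
      unfolding xy by (metis to_ac_add rangeI, metis to_ac_mult rangeI)
    ultimately have "card (eigen_matrices (k, l)) = CARD('a) * (CARD('a) - 1) + CARD('a) * 2"
      using card_eigen_matrices[of k l] by simp
    then have "int (card (eigen_matrices (k, l))) = (int CARD('a))\<^sup>2 + int CARD('a)"
      using card_gt_1 by (simp add: of_nat_diff power2_eq_square algebra_simps)
    then show ?thesis using f[OF klp] kl by simp
  qed
  then have "(\<Sum>kl\<in>split_pairs e. \<Sum>g\<in>eigen_matrices kl. f g) =
      (\<Sum>kl\<in>(split_pairs e :: 'a eigenpair set). ((int CARD('a))\<^sup>2 + int CARD('a)) * N)" by simp
  then show ?thesis using card_gt_1 by (simp add: card_split_pairs[OF prime_card e(1)] of_nat_diff)
qed

lemma sum_conj_pairs: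
  fixes N :: int and f :: "'a entries \<Rightarrow> int"
  assumes e: "e dvd CARD('a) + 1" "e \<noteq> 1"
    and f: "\<And>k l g. (k, l) \<in> conj_pairs e \<Longrightarrow> g \<in> eigen_matrices (k, l) \<Longrightarrow> f g = N"
  shows "(\<Sum>kl\<in>conj_pairs e. \<Sum>g\<in>eigen_matrices kl. f g) =
    (int CARD('a) - 1) * int (totient e) * ((int CARD('a))\<^sup>2 - int CARD('a)) * N"
proof -
  have "(\<Sum>g\<in>eigen_matrices kl. f g) = ((int CARD('a))\<^sup>2 - int CARD('a)) * N" if "kl \<in> conj_pairs e" for kl
  proof -
    obtain k l where kl: "kl = (k, l)" by (cases kl)
    then have klp: "(k, l) \<in> conj_pairs e" using that by simp
    then have "(k, l) \<in> eigen_pairs" using e by (auto simp: eigen_pairs_def)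
    then have ne: "k \<noteq> l" by (rule eigen_pairs_distinct)
    have kfl: "k = frob l" "l \<noteq> 0" "mult_order (k / l) e" using klp by (auto simp: conj_pairs_def)
    have lk: "l = frob k"
      by (rule conj_pairs_swap[OF prime_card e(1) klp])
    have "frob k \<noteq> k" unfolding lk[symmetric] by (rule ne[symmetric])
    moreover have "frob l \<noteq> l" unfolding kfl(1)[symmetric] by (rule ne)
    ultimately have "k \<notin> range to_ac" "l \<notin> range to_ac" unfolding frob_eq_iff .
    then have "card ({k, l} \<inter> range to_ac) = 0" by simp
    moreover have "frob (k + l) = k + l" "frob (k * l) = k * l"
      unfolding frob_add[OF prime_card] frob_mult kfl(1)[symmetric] lk[symmetric] by (simp_all add: add.commute mult.commute)
    ultimately have "card (eigen_matrices (k, l)) = CARD('a) * (CARD('a) - 1)"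
      using card_eigen_matrices[of k l] unfolding frob_eq_iff by simp
    then have "int (card (eigen_matrices (k, l))) = (int CARD('a))\<^sup>2 - int CARD('a)"
      using card_gt_1 by (simp add: of_nat_diff power2_eq_square algebra_simps)
    then show ?thesis using f[OF klp] kl by simp
  qed
  then have "(\<Sum>kl\<in>conj_pairs e. \<Sum>g\<in>eigen_matrices kl. f g) =
      (\<Sum>kl\<in>(conj_pairs e :: 'a eigenpair set). ((int CARD('a))\<^sup>2 - int CARD('a)) * N)" by simp
  then show ?thesis using card_gt_1 by (simp add: card_conj_pairs[OF prime_card e(1)] of_nat_diff)
qed

end

section \<open>The orbit formula\<close>

definition orbit_count :: "nat \<Rightarrow> 'a::{field,finite} entries \<Rightarrow> int"
  where "orbit_count n = (\<lambda>(a, b, c, d).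
    int (card {z. has_period frob n z \<and> (\<exists>i. mob a b c d z = (frob ^^ i) z)}))"

text \<open>
  The common shape of \<open>A_fun\<close>, \<open>B_fun\<close> and \<open>C_fun\<close>, up to the factor \<open>n\<close>.
\<close>
definition level_sum :: "nat \<Rightarrow> nat \<Rightarrow> (nat \<Rightarrow> int) \<Rightarrow> int"
  where "level_sum n e c = (if e dvd n
    then int (totient e) * (\<Sum>t | t dvd n \<and> coprime t e. moebius t * c (n div (e * t))) else 0)"

lemma level_sum_cong:
  assumes "n > 0" "\<And>u. u > 0 \<Longrightarrow> c u = c' u"
  shows "level_sum n e c = level_sum n e c'"
proof (cases "e dvd n")
  case True
  have "c (n div (e * t)) = c' (n div (e * t))" if "t dvd n \<and> coprime t e" for t
  proof -
    have "e * t dvd n" using that True by (intro divides_mult) (auto simp: coprime_commute)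
    then show ?thesis using assms by (auto elim!: dvdE)
  qed
  then show ?thesis by (auto simp: level_sum_def intro!: sum.cong)
qed (simp add: level_sum_def)

context
  assumes prime_card: "prime CARD('a::{field,finite})"
begin

lemma orbit_count_scalar:
  assumes "n > 0" "a \<noteq> (0 :: 'a)"
  shows "orbit_count n (a, 0, 0, a) = (\<Sum>t | t dvd n. moebius t * int CARD('a) ^ (n div t))"
proof -
  have "{z :: 'a alg_closure. has_period frob n z \<and> (\<exists>i. mob a 0 0 a z = (frob ^^ i) z)} = {z. has_period frob n z}"
    using assms(2) by (auto simp: mob_scalar intro!: exI[of _ 0])
  then show ?thesis using card_frob_period[OF prime_card assms(1)] by (simp add: orbit_count_def)
qed

lemma orbit_count_double:
  assumes n: "n > 2" and g: "g \<in> (double_entries :: 'a entries set)"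
  shows "orbit_count n g = level_sum n CARD('a) (\<lambda>u. int CARD('a) ^ u)"
proof -
  obtain a b c d where abcd: "g = (a, b, c, d)" by (cases g)
  from g obtain k where k: "k \<noteq> 0" "g \<in> eigen_matrices (to_ac k, to_ac k)" "g \<noteq> (k, 0, 0, k)"
    by (auto simp: double_entries_def)
  have tr: "to_ac (a + d) = to_ac k + to_ac k" and dt: "to_ac (a * d - b * c) = to_ac k * to_ac k"
    using k(2) by (simp_all add: abcd eigen_matrices_def)
  have tr': "a + d = k + k" and dt': "a * d - b * c = k * k"
    using tr dt by (simp_all only: to_ac_add[symmetric] to_ac_mult[symmetric] to_ac_eq_iff)
  have det: "a * d - b * c \<noteq> 0" using dt' k(1) by simp
  have ns: "\<not> (b = 0 \<and> c = 0 \<and> a = d)"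
  proof
    assume *: "b = 0 \<and> c = 0 \<and> a = d"
    then have "g \<in> eigen_matrices (to_ac a, to_ac a)" by (simp add: abcd scalar_in_eigen_matrices)
    from eigen_matrices_unique[OF k(2) this] have "a = k" by simp
    then show False using k(3) * abcd by simp
  qed
  have per: "snd (power_coeffs (a + d) (a * d - b * c) j) = 0 \<longleftrightarrow> CARD('a) dvd j" for j
  proof -
    have "k * snd (power_coeffs (a + d) (a * d - b * c) j) = of_nat j * k ^ j"
      using power_coeffs_double[OF tr' dt'] by blast
    then have "snd (power_coeffs (a + d) (a * d - b * c) j) = 0 \<longleftrightarrow> of_nat j = (0 :: 'a)"
      using k(1) by (metis mult_eq_0_iff power_not_zero)
    then show ?thesis by (simp add: of_nat_eq_0_iff_char_dvd CHAR_eq_CARD[OF prime_card])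
  qed
  have "CARD('a) ^ u + 1 - card {h \<in> {to_ac k, to_ac k}. (frob ^^ u) h = h} = CARD('a) ^ u" for u
  proof -
    have "{h \<in> {to_ac k, to_ac k}. (frob ^^ u) h = h} = {to_ac k}" by auto
    then show ?thesis by simp
  qed
  then show ?thesis
    using card_mob_in_frob_orbit[OF prime_card det tr dt ns per _ n]
    by (simp add: orbit_count_def level_sum_def abcd)
qed

lemma orbit_count_distinct:
  assumes n: "n > 2" and g: "g \<in> eigen_matrices (k, l)" and kl: "k \<noteq> (l :: 'a alg_closure)" "k \<noteq> 0" "l \<noteq> 0"
    and e: "mult_order (k / l) e" "e > 0" and fr: "frob (frob k) = k" "frob (frob l) = l"
  shows "orbit_count n g =
    level_sum n e (\<lambda>u. int (CARD('a) ^ u + 1 - card {h \<in> {k, l}. (frob ^^ u) h = h}))"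
proof -
  obtain a b c d where abcd: "g = (a, b, c, d)" by (cases g)
  have tr: "to_ac (a + d) = k + l" and dt: "to_ac (a * d - b * c) = k * l"
    using g by (simp_all add: abcd eigen_matrices_def)
  have det: "a * d - b * c \<noteq> 0"
  proof
    assume "a * d - b * c = 0"
    then have "k * l = 0" using dt by (metis to_ac_0)
    then show False using kl by simp
  qed
  have ns: "\<not> (b = 0 \<and> c = 0 \<and> a = d)"
  proof
    assume *: "b = 0 \<and> c = 0 \<and> a = d"
    then have "g \<in> eigen_matrices (to_ac a, to_ac a)" by (simp add: abcd scalar_in_eigen_matrices)
    from eigen_matrices_unique[OF this g] show False using kl(1) by simp
  qed
  have per: "snd (power_coeffs (a + d) (a * d - b * c) j) = 0 \<longleftrightarrow> e dvd j" for j
    using power_coeffs_snd_distinct[OF tr dt kl(1) kl(3), of j] e(1) by (simp add: mult_order_def)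
  show ?thesis
    using card_mob_in_frob_orbit[OF prime_card det tr dt ns per e(2) n fr]
    by (simp add: orbit_count_def level_sum_def abcd)
qed

lemma orbit_count_split:
  fixes k l :: "'a alg_closure"
  assumes n: "n > 2" and e: "e dvd CARD('a) - 1" "e \<noteq> 1"
    and kl: "(k, l) \<in> split_pairs e" and g: "g \<in> eigen_matrices (k, l)"
  shows "orbit_count n g = level_sum n e (\<lambda>u. int CARD('a) ^ u - 1)"
proof -
  have "(k, l) \<in> eigen_pairs" using e kl unfolding eigen_pairs_def by blast
  note ne = eigen_pairs_distinct[OF prime_card this]
  have fixd: "frob k = k" "frob l = l" and ord: "mult_order (k / l) e"
    using kl by (simp_all add: split_pairs_def frob_eq_iff)
  have "e > 0" using e card_gt_1[OF prime_card] by (intro Nat.gr0I) simp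
  have fu: "(frob ^^ u) k = k" "(frob ^^ u) l = l" for u
    using fixd by (induction u) simp_all
  have "{h \<in> {k, l}. (frob ^^ u) h = h} = {k, l}" for u using fu[of u] by blast
  then have c: "card {h \<in> {k, l}. (frob ^^ u) h = h} = 2" for u using ne(1) by simp
  have "orbit_count n g = level_sum n e (\<lambda>u. int (CARD('a) ^ u + 1 - 2))"
    using orbit_count_distinct[OF n g ne ord \<open>e > 0\<close>] fixd unfolding c by simp
  also have "\<dots> = level_sum n e (\<lambda>u. int CARD('a) ^ u - 1)"
    using n by (intro level_sum_cong) (simp_all add: of_nat_diff)
  finally show ?thesis .
qed

lemma orbit_count_conj:
  fixes k l :: "'a alg_closure"
  assumes n: "n > 2" and e: "e dvd CARD('a) + 1" "e \<noteq> 1"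
    and kl: "(k, l) \<in> conj_pairs e" and g: "g \<in> eigen_matrices (k, l)"
  shows "orbit_count n g = level_sum n e (\<lambda>u. int CARD('a) ^ u - 1 + 2 * int (u mod 2))"
proof -
  have "(k, l) \<in> eigen_pairs" using e kl unfolding eigen_pairs_def by blast
  note ne = eigen_pairs_distinct[OF prime_card this]
  have kl': "k = frob l" and ord: "mult_order (k / l) e" using kl unfolding conj_pairs_def by blast+
  have lk: "l = frob k" by (rule conj_pairs_swap[OF prime_card e(1) kl])
  have "e > 0" using e by (intro Nat.gr0I) simp
  have fu: "(frob ^^ u) k = (if even u then k else l) \<and> (frob ^^ u) l = (if even u then l else k)" for u
    by (induction u) (auto simp flip: kl' lk)
  have c: "card {h \<in> {k, l}. (frob ^^ u) h = h} = (if even u then 2 else 0)" for u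
  proof (cases "even u")
    case True
    then have "{h \<in> {k, l}. (frob ^^ u) h = h} = {k, l}" using fu[of u] by auto
    then show ?thesis using ne(1) True by simp
  next
    case False
    then have empty: "{h \<in> {k, l}. (frob ^^ u) h = h} = {}" using fu[of u] ne(1) by auto
    show ?thesis unfolding empty using False by simp
  qed
  have "orbit_count n g = level_sum n e (\<lambda>u. int (CARD('a) ^ u + 1 - (if even u then 2 else 0)))"
    using orbit_count_distinct[OF n g ne ord \<open>e > 0\<close>] kl'[symmetric] lk[symmetric] unfolding c by simp
  also have "\<dots> = level_sum n e (\<lambda>u. int CARD('a) ^ u - 1 + 2 * int (u mod 2))"
    using n by (intro level_sum_cong) (auto simp: of_nat_diff odd_iff_mod_2_eq_one)
  finally show ?thesis .
qed

lemma sum_orbit_count: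
  assumes n: "n > 2"
  shows "2 * (\<Sum>g\<in>(GL2_entries :: 'a entries set). orbit_count n g) =
    2 * (int CARD('a) - 1) * (\<Sum>t | t dvd n. moebius t * int CARD('a) ^ (n div t)) +
    2 * (int CARD('a) - 1) * ((int CARD('a))\<^sup>2 - 1) * level_sum n CARD('a) (\<lambda>u. int CARD('a) ^ u) +
    (\<Sum>e | e dvd CARD('a) - 1 \<and> e \<noteq> 1. (int CARD('a) - 1) * int (totient e) *
      ((int CARD('a))\<^sup>2 + int CARD('a)) * level_sum n e (\<lambda>u. int CARD('a) ^ u - 1)) +
    (\<Sum>e | e dvd CARD('a) + 1 \<and> e \<noteq> 1. (int CARD('a) - 1) * int (totient e) *
      ((int CARD('a))\<^sup>2 - int CARD('a)) * level_sum n e (\<lambda>u. int CARD('a) ^ u - 1 + 2 * int (u mod 2)))"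
proof -
  have S: "(\<Sum>g\<in>(scalar_entries :: 'a entries set). orbit_count n g) =
      (int CARD('a) - 1) * (\<Sum>t | t dvd n. moebius t * int CARD('a) ^ (n div t))"
  proof (rule sum_scalar_entries[OF prime_card])
    fix g :: "'a entries" assume "g \<in> scalar_entries"
    then obtain a where "a \<noteq> 0" "g = (a, 0, 0, a)" by (auto simp: scalar_entries_def)
    then show "orbit_count n g = (\<Sum>t | t dvd n. moebius t * int CARD('a) ^ (n div t))"
      using orbit_count_scalar[of n a] n by simp
  qed
  have U: "(\<Sum>g\<in>(double_entries :: 'a entries set). orbit_count n g) =
      (int CARD('a) - 1) * ((int CARD('a))\<^sup>2 - 1) * level_sum n CARD('a) (\<lambda>u. int CARD('a) ^ u)"
    by (rule sum_double_entries[OF prime_card orbit_count_double[OF n]])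
  have V1: "(\<Sum>kl\<in>(split_pairs e :: 'a eigenpair set). \<Sum>g\<in>eigen_matrices kl. orbit_count n g) =
      (int CARD('a) - 1) * int (totient e) * ((int CARD('a))\<^sup>2 + int CARD('a)) * level_sum n e (\<lambda>u. int CARD('a) ^ u - 1)"
    if "e dvd CARD('a) - 1 \<and> e \<noteq> 1" for e
    by (rule sum_split_pairs[OF prime_card]) (use that orbit_count_split[OF n] in blast)+
  have V2: "(\<Sum>kl\<in>(conj_pairs e :: 'a eigenpair set). \<Sum>g\<in>eigen_matrices kl. orbit_count n g) =
      (int CARD('a) - 1) * int (totient e) * ((int CARD('a))\<^sup>2 - int CARD('a)) *
        level_sum n e (\<lambda>u. int CARD('a) ^ u - 1 + 2 * int (u mod 2))"
    if "e dvd CARD('a) + 1 \<and> e \<noteq> 1" for e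
    by (rule sum_conj_pairs[OF prime_card]) (use that orbit_count_conj[OF n] in blast)+
  have V: "2 * (\<Sum>g\<in>(distinct_entries :: 'a entries set). orbit_count n g) =
    (\<Sum>e | e dvd CARD('a) - 1 \<and> e \<noteq> 1. (int CARD('a) - 1) * int (totient e) *
      ((int CARD('a))\<^sup>2 + int CARD('a)) * level_sum n e (\<lambda>u. int CARD('a) ^ u - 1)) +
    (\<Sum>e | e dvd CARD('a) + 1 \<and> e \<noteq> 1. (int CARD('a) - 1) * int (totient e) *
      ((int CARD('a))\<^sup>2 - int CARD('a)) * level_sum n e (\<lambda>u. int CARD('a) ^ u - 1 + 2 * int (u mod 2)))"
    unfolding sum_distinct_entries[OF prime_card] sum_eigen_pairs[OF prime_card]
    by (intro arg_cong2[where f = "(+)"] sum.cong refl) (use V1 V2 in auto)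
  show ?thesis
    unfolding sum_GL2_entries[OF prime_card] S U distrib_left V by (simp add: algebra_simps)
qed

end

lemma coprime_part_quotient:
  assumes n: "n > 0" and e: "e dvd n"
  shows "coprime_part n e * ((n div e) div coprime_part n e) = n div e" "coprime_part n e > 0"
proof -
  have "coprime_part n e dvd n" "coprime (coprime_part n e) e" using coprime_part_props[OF n] by blast+
  then have "e * coprime_part n e dvd n" using e by (intro divides_mult) (auto simp: coprime_commute)
  moreover have "e \<noteq> 0" using e n by auto
  ultimately have "coprime_part n e dvd n div e" using dvd_div_iff_mult[OF _ e] by (simp add: mult.commute)
  then show "coprime_part n e * ((n div e) div coprime_part n e) = n div e" by simp
  show "coprime_part n e > 0" by (rule dvd_pos_nat[OF n coprime_part_props(1)[OF n]])
qed

lemma A_fun_level_sum: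
  assumes n: "n > 0" and e: "e dvd n"
  shows "real n * A_fun p n e = real_of_int (level_sum n e (\<lambda>u. int p ^ u - 1))"
proof -
  note k = coprime_part_quotient[OF n e]
  have D: "{t. t dvd coprime_part n e} = {t. t dvd n \<and> coprime t e}"
    using coprime_part_props(3)[OF n] by blast
  have "real n * A_fun p n e = real (totient e) *
      (\<Sum>t | t dvd n \<and> coprime t e. real_of_int (moebius t) * (real p ^ (n div e div t) - 1))"
    using n unfolding A_fun_def Let_def k(1) D by simp
  then show ?thesis using e by (simp add: level_sum_def div_mult2_eq)
qed

text \<open>
  The substitution of \<open>K div t\<close> for \<open>t\<close> moves the quotient from the Moebius function to the exponent.
\<close>
lemma C_fun_level_sum:
  assumes n: "n > 0" and e: "e dvd n"
  shows "real n * C_fun p n e = real_of_int (level_sum n e (\<lambda>u. int p ^ u - 1 + 2 * int (u mod 2)))"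
proof -
  note k = coprime_part_quotient[OF n e]
  define K where "K = coprime_part n e"
  define r where "r = n div e div K"
  have K: "K > 0" "K * r = n div e" using k by (simp_all add: K_def r_def)
  have D: "{t. t dvd K} = {t. t dvd n \<and> coprime t e}"
    using coprime_part_props(3)[OF n] by (simp add: K_def)
  have "(\<Sum>t | t dvd K. real_of_int (moebius (K div t)) * (real p ^ (r * t) - 1 + 2 * real (r * t mod 2))) =
      (\<Sum>t | t dvd K. real_of_int (moebius t) * (real p ^ (r * (K div t)) - 1 + 2 * real (r * (K div t) mod 2)))"
    by (rule sum.reindex_bij_witness[of _ "\<lambda>t. K div t" "\<lambda>t. K div t"]) (use K in \<open>auto elim!: dvdE\<close>)
  also have "\<dots> = (\<Sum>t | t dvd K. real_of_int (moebius t) * (real p ^ (n div e div t) - 1 + 2 * real (n div e div t mod 2)))"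
  proof (rule sum.cong[OF refl])
    fix t assume "t \<in> {t. t dvd K}"
    then have "r * (K div t) = n div e div t" unfolding K(2)[symmetric] by (simp add: div_mult_swap mult.commute)
    then show "real_of_int (moebius t) * (real p ^ (r * (K div t)) - 1 + 2 * real (r * (K div t) mod 2)) =
        real_of_int (moebius t) * (real p ^ (n div e div t) - 1 + 2 * real (n div e div t mod 2))" by simp
  qed
  finally have "real n * C_fun p n e = real (totient e) *
      (\<Sum>t | t dvd K. real_of_int (moebius t) * (real p ^ (n div e div t) - 1 + 2 * real (n div e div t mod 2)))"
    using n unfolding C_fun_def Let_def K_def[symmetric] r_def[symmetric] by simp
  then show ?thesis using e unfolding D by (simp add: level_sum_def div_mult2_eq)
qed

lemma B_fun_level_sum:
  assumes n: "n > 0" and p: "prime p"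
  shows "real n * B_fun p n = real_of_int (level_sum n p (\<lambda>u. int p ^ u))"
proof (cases "p dvd n")
  case True
  have "\<not> p dvd t \<longleftrightarrow> coprime t p" for t
    using p by (metis coprime_commute coprime_absorb_left not_prime_unit prime_imp_coprime_nat)
  then have "real n * B_fun p n = (real p - 1) *
      (\<Sum>t | t dvd n \<and> coprime t p. real_of_int (moebius t) * real p ^ (n div (p * t)))"
    using n True by (simp add: B_fun_def)
  moreover have "real (totient p) = real p - 1"
    using prime_ge_1_nat[OF p] by (simp add: totient_prime[OF p] of_nat_diff)
  ultimately show ?thesis using True by (simp add: level_sum_def)
qed (simp add: B_fun_def level_sum_def)

theorem mainTheorem1:
  fixes p n :: nat
  assumes "prime p" and "CARD('a::{field,finite}) = p" and "n > 2"
  shows "card (carrier (GL2 :: ('a ^ 2 ^ 2) monoid)) = (p\<^sup>2 - 1) * (p\<^sup>2 - p) \<and>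
    (let a = (real p - 1) / real n *
               (\<Sum>t | t dvd n. real_of_int (moebius t) * real p ^ (n div t));
         b = (real p - 1) * ((real p)\<^sup>2 - 1) * B_fun p n;
         c = (\<Sum>e | e dvd gcd n (p - 1) \<and> e \<noteq> 1.
               real (totient e) * ((real p - 1) / 2) * ((real p)\<^sup>2 + real p) * A_fun p n e);
         d = (\<Sum>e | e dvd gcd n (p + 1) \<and> e \<noteq> 1.
               real (totient e) * ((real p - 1) / 2) * ((real p)\<^sup>2 - real p) * C_fun p n e)
     in real (card (form_orbits n :: 'a poly poly set set set)) =
          1 / real (card (carrier (GL2 :: ('a ^ 2 ^ 2) monoid))) * (a + b + c + d))"
proof -
  have prime_card: "prime CARD('a)" using assms by simp
  have n: "n > 0" "n > 1" using assms(3) by simp_all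
  have p: "p > 1" using assms(1) by (rule prime_gt_1_nat)
  let ?G = "GL2 :: ('a ^ 2 ^ 2) monoid"
  let ?O = "form_orbits n :: 'a poly poly set set set"
  have cardG: "card (carrier ?G) = (p\<^sup>2 - 1) * (p\<^sup>2 - p)"
    using bij_betw_same_card[OF bij_GL2_entries[where ?'a = 'a]] card_GL2_entries[where ?'a = 'a]
    by (simp add: assms(2))
  define a where "a = (real p - 1) / real n * (\<Sum>t | t dvd n. real_of_int (moebius t) * real p ^ (n div t))"
  define b where "b = (real p - 1) * ((real p)\<^sup>2 - 1) * B_fun p n"
  define c where "c = (\<Sum>e | e dvd gcd n (p - 1) \<and> e \<noteq> 1.
               real (totient e) * ((real p - 1) / 2) * ((real p)\<^sup>2 + real p) * A_fun p n e)"
  define d where "d = (\<Sum>e | e dvd gcd n (p + 1) \<and> e \<noteq> 1.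
               real (totient e) * ((real p - 1) / 2) * ((real p)\<^sup>2 - real p) * C_fun p n e)"
  have "int (n * (card ?O * card (carrier ?G))) =
      (\<Sum>g\<in>carrier ?G. orbit_count n (g $ 1 $ 1, g $ 1 $ 2, g $ 2 $ 1, g $ 2 $ 2))"
    unfolding card_form_orbits_burnside[OF prime_card n(2)] by (simp add: orbit_count_def)
  also have "\<dots> = (\<Sum>x\<in>(GL2_entries :: 'a entries set). orbit_count n x)"
    by (rule sum.reindex_bij_betw[OF bij_GL2_entries[where ?'a = 'a, folded GL2_entries_def], of "orbit_count n"])
  finally have total: "2 * int (n * (card ?O * card (carrier ?G))) = 2 * (\<Sum>x\<in>(GL2_entries :: 'a entries set). orbit_count n x)"
    by simp
  have A: "real n * a = (real p - 1) * (\<Sum>t | t dvd n. real_of_int (moebius t) * real p ^ (n div t))"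
    using n by (simp add: a_def)
  have B: "real n * b = (real p - 1) * ((real p)\<^sup>2 - 1) * real_of_int (level_sum n p (\<lambda>u. int p ^ u))"
    by (simp add: b_def flip: B_fun_level_sum[OF n(1) assms(1)])
  \<comment> \<open>an order that does not divide \<open>n\<close> contributes 0\<close>
  have drop_nondivisors: "(\<Sum>e | e dvd m \<and> e \<noteq> 1. h e * real_of_int (level_sum n e c)) =
      (\<Sum>e | e dvd gcd n m \<and> e \<noteq> 1. h e * real_of_int (level_sum n e c))" if "m > 0" for m h c
    by (rule sum.mono_neutral_right) (use that in \<open>auto simp: level_sum_def\<close>)
  have C: "2 * (real n * c) = (\<Sum>e | e dvd p - 1 \<and> e \<noteq> 1. (real p - 1) * real (totient e) *
      ((real p)\<^sup>2 + real p) * real_of_int (level_sum n e (\<lambda>u. int p ^ u - 1)))"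
    unfolding drop_nondivisors[OF zero_less_diff[THEN iffD2, OF p]] c_def sum_distrib_left
    by (intro sum.cong refl) (simp flip: A_fun_level_sum[OF n(1)])
  have D: "2 * (real n * d) = (\<Sum>e | e dvd p + 1 \<and> e \<noteq> 1. (real p - 1) * real (totient e) *
      ((real p)\<^sup>2 - real p) * real_of_int (level_sum n e (\<lambda>u. int p ^ u - 1 + 2 * int (u mod 2))))"
    unfolding drop_nondivisors[OF trans_less_add2[OF zero_less_one]] d_def sum_distrib_left
    by (intro sum.cong refl) (simp flip: C_fun_level_sum[OF n(1)])
  have "2 * (real n * (real (card ?O) * real (card (carrier ?G)))) =
      real_of_int (2 * int (n * (card ?O * card (carrier ?G))))" by simp
  also have "\<dots> = 2 * (real n * a) + 2 * (real n * b) + 2 * (real n * c) + 2 * (real n * d)"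
    unfolding total sum_orbit_count[OF prime_card assms(3)] assms(2) A B C D by simp (simp add: algebra_simps)
  finally have "real n * (real (card ?O) * real (card (carrier ?G))) = real n * (a + b + c + d)"
    unfolding distrib_left by linarith
  then have "real (card ?O) * real (card (carrier ?G)) = a + b + c + d" using n by simp
  moreover have "real (card (carrier ?G)) \<noteq> 0"
  proof -
    have "p < p\<^sup>2" "1 < p\<^sup>2" using p by (simp_all add: power2_eq_square one_less_mult)
    then have "card (carrier ?G) \<noteq> 0" unfolding cardG by simp
    then show ?thesis unfolding of_nat_eq_0_iff .
  qed
  ultimately have "real (card ?O) = 1 / real (card (carrier ?G)) * (a + b + c + d)"
    using nonzero_eq_divide_eq[of "real (card (carrier ?G))" "real (card ?O)" "a + b + c + d"] by simp
  then show ?thesis unfolding Let_def a_def[symmetric] b_def[symmetric] c_def[symmetric] d_def[symmetric]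
    using cardG by blast
qed

end
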